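(* Let $A\in\mathbb{R}^{d\times d}$ and $B\in\mathbb{R}^{d\times m}$ be such that the linear system $\dot\gamma = A\gamma+Bu$ is controllable, let $E=\{\gamma\in\mathbb{R}^d : A\gamma=0\}$, and let $p=\dim E$. Let $L:\mathbb{R}^d\times\mathbb{R}^m\to\mathbb{R}$ satisfy: (1) there exists $\theta>0$ such that $L(\gamma,u)\ge\theta|u|^2$ for all $(\gamma,u)\in\mathbb{R}^d\times\mathbb{R}^m$; (2) there exists $\lambda>0$ such that $$L(\alpha\gamma+(1-\alpha)\eta,\ \alpha u+(1-\alpha)v)\le \alpha L(\gamma,u)+(1-\alpha)L(\eta,v)-\frac{\alpha(1-\alpha)\lambda}{2}\|u-v\|_2^2$$ for all $\gamma,\eta\in\mathbb{R}^d$, all $u,v\in\mathbb{R}^m$ and all $\alpha\in(0,1)$; (3) $L(\gamma,u)=L(P_E^{\perp}\gamma,u)$ for all $(\gamma,u)\in\mathbb{R}^d\times\mathbb{R}^m$. Let $c:\mathbb{R}^d\times\mathbb{R}^d\to\mathbb{R}$ be the associated optimal control cost (defined in the context). Let $R:E\to\mathbb{R}^p$ be an invertible linear map, and let $\mu,\nu\in\mathcal{P}^{eq}_2(\mathbb{R}^d)$ be such that $R_\#\mu$ and $R_\#\nu$ are absolutely continuous with respect to the Lebesgue measure on $\mathbb{R}^p$ and have compact supports. Then the optimal transport (Monge) problem $$\inf_{T}\int_{\mathbb{R}^d}c(x,T(x))\,d\mu(x)\quad\text{subject to}\quad T_\#\mu=\nu,$$ where the infimum is over Borel maps $T:\mathbb{R}^d\to\mathbb{R}^d$,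 has a solution $T$ (a map attaining the infimum), and this solution is unique (as usual, up to equality $\mu$-almost everywhere).
   Context: $P_E^{\perp}:\mathbb{R}^d\to\mathbb{R}^d$ is the orthogonal projection onto the orthogonal complement of $E$. The optimal control cost is $$c(x,y)=\inf_{(\gamma,u)\in\Gamma\times\mathcal{U}}\int_0^1L(\gamma(t),u(t))\,dt$$ subject to $\frac{d\gamma}{dt}=A\gamma(t)+Bu(t)$ for almost every $t\in[0,1]$, $\gamma(0)=x$, $\gamma(1)=y$, where $\Gamma=AC([0,1];\mathbb{R}^d)$ is the set of absolutely continuous curves and $\mathcal{U}=L^2(0,1;\mathbb{R}^m)$. $\mathcal{P}_2(\mathbb{R}^d)$ is the set of Borel probability measures on $\mathbb{R}^d$ with finite second moment, and $\mathcal{P}^{eq}_2(\mathbb{R}^d)=\{\mu\in\mathcal{P}_2(\mathbb{R}^d):\operatorname{supp}\mu\subseteq E\}$ is the set of equilibrium measures. The pushforward is $(T_\#\mu)(\Omega)=\mu(T^{-1}(\Omega))$ for Borel $\Omega$. Since $\mu\in\mathcal{P}^{eq}_2(\mathbb{R}^d)$ is concentrated on $E$, it is regarded as a measure on $E$ when forming $R_\#\mu$, which is a Borel probability measure on $\mathbb{R}^p$. *)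

theory Defs
  imports "HOL-Probability.Probability"
begin

section \<open>Linear control systems\<close>

definition abs_continuous_curve :: "real \<Rightarrow> real \<Rightarrow> (real \<Rightarrow> 'a::real_normed_vector) \<Rightarrow> bool" where
  "abs_continuous_curve s t f \<longleftrightarrow>
     (\<forall>\<epsilon>>0. \<exists>\<delta>>0. \<forall>(n::nat) a b.
        (\<forall>i<n. s \<le> a i \<and> a i \<le> b i \<and> b i \<le> t) \<and>
        disjoint_family_on (\<lambda>i. {a i<..<b i}) {..<n} \<and>
        (\<Sum>i<n. b i - a i) < \<delta> \<longrightarrow>
        (\<Sum>i<n. norm (f (b i) - f (a i))) < \<epsilon>)"

definition square_integrable :: "real \<Rightarrow> real \<Rightarrow> (real \<Rightarrow> 'a::euclidean_space) \<Rightarrow> bool" where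
  "square_integrable s t u \<longleftrightarrow>
     u \<in> borel_measurable (lebesgue_on {s..t}) \<and>
     integrable (lebesgue_on {s..t}) (\<lambda>r. (norm (u r))\<^sup>2)"

definition admissible ::
  "real^'d^'d \<Rightarrow> real^'m^'d \<Rightarrow> real \<Rightarrow> real^'d \<Rightarrow> real^'d \<Rightarrow> (real \<Rightarrow> real^'d) \<Rightarrow> (real \<Rightarrow> real^'m) \<Rightarrow> bool" where
  "admissible A B \<tau> x y \<gamma> u \<longleftrightarrow>
     abs_continuous_curve 0 \<tau> \<gamma> \<and> square_integrable 0 \<tau> u \<and>
     (AE t in lebesgue_on {0..\<tau>}.
        (\<gamma> has_vector_derivative (A *v \<gamma> t + B *v u t)) (at t within {0..\<tau>})) \<and>
     \<gamma> 0 = x \<and> \<gamma> \<tau> = y"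

definition controllable :: "real^'d^'d \<Rightarrow> real^'m^'d \<Rightarrow> bool" where
  "controllable A B \<longleftrightarrow> (\<forall>x y. \<exists>\<tau>>0. \<exists>\<gamma> u. admissible A B \<tau> x y \<gamma> u)"

definition equilibria :: "real^'d^'d \<Rightarrow> (real^'d) set" where
  "equilibria A = {\<gamma>. A *v \<gamma> = 0}"

definition orth_proj :: "'a::euclidean_space set \<Rightarrow> 'a \<Rightarrow> 'a" where
  "orth_proj W x = (THE z. z \<in> W \<and> x - z \<in> orthogonal_comp W)"

text \<open>The Lagrangian is meant to be nonnegative. Its integral along an admissible pair may be
  infinite, so the infimum is taken in the extended nonnegative reals.\<close>

definition control_cost ::
  "real^'d^'d \<Rightarrow> real^'m^'d \<Rightarrow> (real^'d \<Rightarrow> real^'m \<Rightarrow> real) \<Rightarrow> real^'d \<Rightarrow> real^'d \<Rightarrow> ennreal" where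
  "control_cost A B L x y =
     (INF (\<gamma>, u) \<in> {(\<gamma>, u). admissible A B 1 x y \<gamma> u}.
        \<integral>\<^sup>+ t. ennreal (L (\<gamma> t) (u t)) \<partial>(lebesgue_on {0..1}))"

section \<open>Measures\<close>

definition measure_supp :: "'a topology \<Rightarrow> 'a measure \<Rightarrow> 'a set" where
  "measure_supp X M = {x \<in> topspace X. \<forall>U. openin X U \<and> x \<in> U \<longrightarrow> emeasure M U > 0}"

definition P2 :: "'a::euclidean_space measure set" where
  "P2 = {M. sets M = sets borel \<and> prob_space M \<and> integrable M (\<lambda>x. (norm x)\<^sup>2)}"

definition P2_eq :: "real^'d^'d \<Rightarrow> (real^'d) measure set" where
  "P2_eq A = {M \<in> P2. measure_supp euclidean M \<subseteq> equilibria A}"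

text \<open>Since \<open>p = dim E\<close> depends on a term and may be \<open>0\<close>, the space \<open>\<real>\<^sup>p\<close> is represented by
  the extensional functions on \<open>{..<p}\<close>, with the product topology and the product of
  the one-dimensional Lebesgue measures. For \<open>p = 0\<close> this is the unit point mass on a one-point space.\<close>

abbreviation Rp_carrier :: "nat \<Rightarrow> (nat \<Rightarrow> real) set" where
  "Rp_carrier p \<equiv> {..<p} \<rightarrow>\<^sub>E UNIV"

abbreviation Rp_topology :: "nat \<Rightarrow> (nat \<Rightarrow> real) topology" where
  "Rp_topology p \<equiv> product_topology (\<lambda>_. euclideanreal) {..<p}"

abbreviation Rp_lebesgue :: "nat \<Rightarrow> (nat \<Rightarrow> real) measure" where
  "Rp_lebesgue p \<equiv> Pi\<^sub>M {..<p} (\<lambda>_. lborel)"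

definition linear_iso_Rp :: "'a::real_vector set \<Rightarrow> nat \<Rightarrow> ('a \<Rightarrow> nat \<Rightarrow> real) \<Rightarrow> bool" where
  "linear_iso_Rp E p R \<longleftrightarrow>
     bij_betw R E (Rp_carrier p) \<and>
     (\<forall>x\<in>E. \<forall>y\<in>E. \<forall>i<p. R (x + y) i = R x i + R y i) \<and>
     (\<forall>a. \<forall>x\<in>E. \<forall>i<p. R (a *\<^sub>R x) i = a * R x i)"

definition pushforward_Rp :: "'a set \<Rightarrow> nat \<Rightarrow> ('a \<Rightarrow> nat \<Rightarrow> real) \<Rightarrow> 'a measure \<Rightarrow> (nat \<Rightarrow> real) measure" where
  "pushforward_Rp E p R M = distr (restrict_space M E) (Rp_lebesgue p) R"

section \<open>The Monge problem\<close>

definition transport_maps :: "'a::topological_space measure \<Rightarrow> 'a measure \<Rightarrow> ('a \<Rightarrow> 'a) set" where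
  "transport_maps M N = {T \<in> borel_measurable borel. distr M borel T = N}"

definition monge_cost :: "('a \<Rightarrow> 'a \<Rightarrow> ennreal) \<Rightarrow> 'a measure \<Rightarrow> ('a \<Rightarrow> 'a) \<Rightarrow> ennreal" where
  "monge_cost c M T = (\<integral>\<^sup>+ x. c x (T x) \<partial>M)"

definition monge_solution ::
  "('a::topological_space \<Rightarrow> 'a \<Rightarrow> ennreal) \<Rightarrow> 'a measure \<Rightarrow> 'a measure \<Rightarrow> ('a \<Rightarrow> 'a) \<Rightarrow> bool" where
  "monge_solution c M N T \<longleftrightarrow>
     T \<in> transport_maps M N \<and> monge_cost c M T = (INF S \<in> transport_maps M N. monge_cost c M S)"

end

theory Submission
  imports Defs "HOL-Complex_Analysis.Great_Picard"
begin

text \<open>On \<open>E\<close> the cost is \<open>c x y = H (y - x)\<close> with \<open>H\<close> finite (steering by the controllability Gramian) and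
  strongly convex (the endpoint of a trajectory is bounded by the \<open>L\<^sup>2\<close> norm of its control). The Monge problem
  is solved through its dual, without transport plans: a maximiser \<open>\<psi>\<close> of
  \<open>\<integral> (INF y. c x y - \<psi> y) d\<mu> + \<integral> \<psi> d\<nu>\<close> exists by Arzela-Ascoli; strict convexity of \<open>H\<close> makes the minimising
  \<open>y = T x\<close> unique for almost every \<open>x\<close>; and the first variation of the dual functional at \<open>\<psi>\<close> says exactly that
  \<open>T\<close> pushes \<open>\<mu>\<close> to \<open>\<nu>\<close>. Optimality and uniqueness of \<open>T\<close> follow by integrating \<open>\<phi> x + \<psi> y \<le> c x y\<close>, where
  equality means \<open>y = T x\<close>. No differentiability of the potentials is needed for the almost everywhere uniqueness.\<close>

section \<open>Absolutely continuous curves\<close>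

text \<open>The cost on \<open>E\<close> depends on \<open>y - x\<close> alone because a trajectory
  shifted by an equilibrium is a trajectory with the same control, and \<open>L\<close> sees only
  the component of the state orthogonal to \<open>E\<close>. Controllability is assumed over an
  unspecified time, whereas the cost runs over unit time. The bridge is observability of the adjoint
  system, a condition on the powers of \<open>\<lambda>x. x v* A\<close> in which no time occurs:
  controllability implies it, and steering to 0 in unit time is built from it. Its proof pairs an
  adjoint curve with a trajectory that solves the equation only almost everywhere, hence the
  fundamental theorem of calculus for absolutely continuous curves. Strong convexity of
  \<open>L\<close> concerns the control; it reaches \<open>H\<close> because the difference of two
  endpoints is bounded by the difference of the controls. A proper subspace \<open>E\<close> is
  Lebesgue null in the ambient space, so exceptional sets are first measured by Lebesgue measure in
  coordinates on \<open>E\<close>; absolute continuity then makes them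
  \<open>\<mu>\<close>-null.\<close>

lemma abs_continuous_curve_finite_family:
  assumes "abs_continuous_curve a b f" "0 < \<epsilon>"
  obtains \<delta> where "0 < \<delta>"
    "\<And>(J :: 'j set) u v. finite J \<Longrightarrow> (\<And>j. j \<in> J \<Longrightarrow> a \<le> u j \<and> u j \<le> v j \<and> v j \<le> b) \<Longrightarrow>
      disjoint_family_on (\<lambda>j. {u j<..<v j}) J \<Longrightarrow> (\<Sum>j\<in>J. v j - u j) < \<delta> \<Longrightarrow>
      (\<Sum>j\<in>J. norm (f (v j) - f (u j))) < \<epsilon>"
proof -
  from assms obtain \<delta> where \<delta>: "0 < \<delta>"
    "\<And>(n::nat) u v. (\<forall>i<n. a \<le> u i \<and> u i \<le> v i \<and> v i \<le> b) \<and>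
        disjoint_family_on (\<lambda>i. {u i<..<v i}) {..<n} \<and> (\<Sum>i<n. v i - u i) < \<delta> \<Longrightarrow>
        (\<Sum>i<n. norm (f (v i) - f (u i))) < \<epsilon>"
    unfolding abs_continuous_curve_def by meson
  show ?thesis
  proof (rule that[OF \<delta>(1)])
    fix J :: "'j set" and u v
    assume J: "finite J" and uv: "\<And>j. j \<in> J \<Longrightarrow> a \<le> u j \<and> u j \<le> v j \<and> v j \<le> b"
      and disj: "disjoint_family_on (\<lambda>j. {u j<..<v j}) J" and small: "(\<Sum>j\<in>J. v j - u j) < \<delta>"
    \<comment> \<open>The definition numbers the intervals by naturals, but the pieces of a tagged
      division are indexed by themselves; the family is therefore renumbered.\<close>
    obtain h where h: "bij_betw h {0..<card J} J" using ex_bij_betw_nat_finite[OF J] by blast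
    then have h': "bij_betw h {..<card J} J" by (simp add: atLeast0LessThan)
    have sums: "(\<Sum>i<card J. g (h i)) = (\<Sum>j\<in>J. g j)" for g :: "'j \<Rightarrow> real"
      by (rule sum.reindex_bij_betw[OF h'])
    have hJ: "h i \<in> J" if "i < card J" for i using h' that by (auto simp: bij_betw_def)
    have inj: "inj_on h {..<card J}" using h' by (simp add: bij_betw_def)
    have "disjoint_family_on (\<lambda>i. {u (h i)<..<v (h i)}) {..<card J}"
      unfolding disjoint_family_on_def
    proof (intro ballI impI)
      fix i j assume ij: "i \<in> {..<card J}" "j \<in> {..<card J}" "i \<noteq> j"
      then have "h i \<noteq> h j" using inj_onD[OF inj] by blast
      then show "{u (h i)<..<v (h i)} \<inter> {u (h j)<..<v (h j)} = {}"
        using disj hJ ij unfolding disjoint_family_on_def by blast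
    qed
    then have "(\<Sum>i<card J. norm (f (v (h i)) - f (u (h i)))) < \<epsilon>"
      using uv hJ small sums[of "\<lambda>j. v j - u j"] by (intro \<delta>(2)) auto
    then show "(\<Sum>j\<in>J. norm (f (v j) - f (u j))) < \<epsilon>"
      using sums[of "\<lambda>j. norm (f (v j) - f (u j))"] by simp
  qed
qed

lemma abs_continuous_curve_continuous_on:
  assumes "abs_continuous_curve a b f"
  shows "continuous_on {a..b} f"
  unfolding continuous_on_iff
proof (intro ballI allI impI)
  fix x and \<epsilon> :: real assume x: "x \<in> {a..b}" and "0 < \<epsilon>"
  obtain \<delta> where \<delta>: "0 < \<delta>"
    "\<And>(J :: unit set) u v. finite J \<Longrightarrow> (\<And>j. j \<in> J \<Longrightarrow> a \<le> u j \<and> u j \<le> v j \<and> v j \<le> b) \<Longrightarrow>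
      disjoint_family_on (\<lambda>j. {u j<..<v j}) J \<Longrightarrow> (\<Sum>j\<in>J. v j - u j) < \<delta> \<Longrightarrow>
      (\<Sum>j\<in>J. norm (f (v j) - f (u j))) < \<epsilon>"
    by (rule abs_continuous_curve_finite_family[OF assms \<open>0 < \<epsilon>\<close>]) blast
  have "dist (f y) (f x) < \<epsilon>" if y: "y \<in> {a..b}" "dist y x < \<delta>" for y
  proof -
    have "norm (f (max x y) - f (min x y)) < \<epsilon>"
      using \<delta>(2)[of "{()}" "\<lambda>_. min x y" "\<lambda>_. max x y"] x y
      by (auto simp: disjoint_family_on_def dist_real_def max_def min_def split: if_splits)
    then show ?thesis by (auto simp: dist_norm max_def min_def norm_minus_commute split: if_splits)
  qed
  with \<delta>(1) show "\<exists>d>0. \<forall>x'\<in>{a..b}. dist x' x < d \<longrightarrow> dist (f x') (f x) < \<epsilon>" by blast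
qed

lemma lipschitz_abs_continuous_curve:
  assumes "\<And>s t. a \<le> s \<Longrightarrow> s \<le> t \<Longrightarrow> t \<le> b \<Longrightarrow> norm (f t - f s) \<le> C * (t - s)"
  shows "abs_continuous_curve a b f"
  unfolding abs_continuous_curve_def
proof (intro allI impI)
  fix \<epsilon> :: real assume "0 < \<epsilon>"
  define D where "D = max C 1"
  have D: "D > 0" "C \<le> D" by (auto simp: D_def)
  show "\<exists>\<delta>>0. \<forall>(n::nat) u v. (\<forall>i<n. a \<le> u i \<and> u i \<le> v i \<and> v i \<le> b) \<and>
        disjoint_family_on (\<lambda>i. {u i<..<v i}) {..<n} \<and> (\<Sum>i<n. v i - u i) < \<delta> \<longrightarrow>
        (\<Sum>i<n. norm (f (v i) - f (u i))) < \<epsilon>"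
  proof (intro exI[of _ "\<epsilon> / D"] conjI allI impI, goal_cases)
    case (2 n u v)
    have "(\<Sum>i<n. norm (f (v i) - f (u i))) \<le> (\<Sum>i<n. D * (v i - u i))"
    proof (rule sum_mono)
      fix i assume "i \<in> {..<n}"
      then have i: "a \<le> u i" "u i \<le> v i" "v i \<le> b" using 2 by auto
      from assms[OF i] have "norm (f (v i) - f (u i)) \<le> C * (v i - u i)" .
      also have "\<dots> \<le> D * (v i - u i)" using D(2) i by (intro mult_right_mono) auto
      finally show "norm (f (v i) - f (u i)) \<le> D * (v i - u i)" .
    qed
    also have "\<dots> = D * (\<Sum>i<n. v i - u i)" by (simp add: sum_distrib_left)
    also have "\<dots> < \<epsilon>" using 2 D(1) by (simp add: field_simps)
    finally show ?case .
  qed (use D \<open>0 < \<epsilon>\<close> in simp)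
qed

lemma abs_continuous_curve_lincomb:
  assumes f: "abs_continuous_curve a b f" and g: "abs_continuous_curve a b g"
  shows "abs_continuous_curve a b (\<lambda>t. c *\<^sub>R f t + d *\<^sub>R g t)"
  unfolding abs_continuous_curve_def
proof (intro allI impI)
  fix \<epsilon> :: real assume \<epsilon>: "0 < \<epsilon>"
  \<comment> \<open>The summand 1 keeps \<open>D\<close> positive when both coefficients vanish and
    makes the last estimate strict.\<close>
  define D where "D = \<bar>c\<bar> + \<bar>d\<bar> + 1"
  have D: "D > 0" "\<bar>c\<bar> + \<bar>d\<bar> < D" by (auto simp: D_def add_nonneg_pos)
  have \<epsilon>D: "\<epsilon> / D > 0" using \<epsilon> D by simp
  let ?P = "\<lambda>\<delta> (h :: real \<Rightarrow> 'a). \<forall>(n::nat) u v. (\<forall>i<n. a \<le> u i \<and> u i \<le> v i \<and> v i \<le> b) \<and>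
        disjoint_family_on (\<lambda>i. {u i<..<v i}) {..<n} \<and> (\<Sum>i<n. v i - u i) < \<delta> \<longrightarrow>
        (\<Sum>i<n. norm (h (v i) - h (u i))) < \<epsilon> / D"
  obtain \<delta>1 where \<delta>1: "\<delta>1 > 0" "?P \<delta>1 f"
    using f[unfolded abs_continuous_curve_def, rule_format, OF \<epsilon>D] by blast
  obtain \<delta>2 where \<delta>2: "\<delta>2 > 0" "?P \<delta>2 g"
    using g[unfolded abs_continuous_curve_def, rule_format, OF \<epsilon>D] by blast
  show "\<exists>\<delta>>0. \<forall>(n::nat) u v. (\<forall>i<n. a \<le> u i \<and> u i \<le> v i \<and> v i \<le> b) \<and>
        disjoint_family_on (\<lambda>i. {u i<..<v i}) {..<n} \<and> (\<Sum>i<n. v i - u i) < \<delta> \<longrightarrow>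
        (\<Sum>i<n. norm ((c *\<^sub>R f (v i) + d *\<^sub>R g (v i)) - (c *\<^sub>R f (u i) + d *\<^sub>R g (u i)))) < \<epsilon>"
  proof (intro exI[of _ "min \<delta>1 \<delta>2"] conjI allI impI, goal_cases)
    case (2 n u v)
    let ?F = "\<Sum>i<n. norm (f (v i) - f (u i))" and ?G = "\<Sum>i<n. norm (g (v i) - g (u i))"
    have F: "?F < \<epsilon> / D" "?G < \<epsilon> / D" using 2 \<delta>1(2) \<delta>2(2) by auto
    have "(\<Sum>i<n. norm ((c *\<^sub>R f (v i) + d *\<^sub>R g (v i)) - (c *\<^sub>R f (u i) + d *\<^sub>R g (u i))))
      \<le> (\<Sum>i<n. \<bar>c\<bar> * norm (f (v i) - f (u i)) + \<bar>d\<bar> * norm (g (v i) - g (u i)))"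
    proof (rule sum_mono)
      fix i
      have "(c *\<^sub>R f (v i) + d *\<^sub>R g (v i)) - (c *\<^sub>R f (u i) + d *\<^sub>R g (u i))
        = c *\<^sub>R (f (v i) - f (u i)) + d *\<^sub>R (g (v i) - g (u i))" by (simp add: algebra_simps)
      then show "norm ((c *\<^sub>R f (v i) + d *\<^sub>R g (v i)) - (c *\<^sub>R f (u i) + d *\<^sub>R g (u i)))
        \<le> \<bar>c\<bar> * norm (f (v i) - f (u i)) + \<bar>d\<bar> * norm (g (v i) - g (u i))"
        by (metis norm_scaleR norm_triangle_ineq)
    qed
    also have "\<dots> = \<bar>c\<bar> * ?F + \<bar>d\<bar> * ?G" by (simp add: sum.distrib sum_distrib_left)
    also have "\<dots> \<le> \<bar>c\<bar> * (\<epsilon> / D) + \<bar>d\<bar> * (\<epsilon> / D)"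
      using F by (intro add_mono mult_left_mono) auto
    also have "\<dots> = (\<bar>c\<bar> + \<bar>d\<bar>) * (\<epsilon> / D)" by (simp only: distrib_right)
    also have "\<dots> < D * (\<epsilon> / D)" using D \<epsilon>D by (intro mult_strict_right_mono) auto
    also have "\<dots> = \<epsilon>" using D by simp
    finally show ?case .
  qed (use \<delta>1 \<delta>2 in simp)
qed

text \<open>The Lipschitz factor is meant for an adjoint curve, the other one for a trajectory. The
  increment of the product splits as
  \<open>p v \<bullet> (f v - f u) + (p v - p u) \<bullet> f u\<close>: the first term is small by
  absolute continuity of \<open>f\<close>, the second by the total length of the intervals.\<close>

lemma abs_continuous_curve_inner:
  assumes f: "abs_continuous_curve a b (f :: real \<Rightarrow> 'a::real_inner)"
    and p: "\<And>s t. a \<le> s \<Longrightarrow> s \<le> t \<Longrightarrow> t \<le> b \<Longrightarrow> norm (p t - p s) \<le> C * (t - s)"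
  shows "abs_continuous_curve a b (\<lambda>t. p t \<bullet> f t)"
  unfolding abs_continuous_curve_def
proof (intro allI impI)
  fix \<epsilon> :: real assume \<epsilon>: "0 < \<epsilon>"
  have cont: "continuous_on {a..b} f" "continuous_on {a..b} p"
    using f p by (auto intro: abs_continuous_curve_continuous_on lipschitz_abs_continuous_curve)
  then have "bounded (f ` {a..b})" "bounded (p ` {a..b})"
    by (auto intro: compact_imp_bounded compact_continuous_image)
  then obtain M N where M: "0 < M" "\<And>t. t \<in> {a..b} \<Longrightarrow> norm (f t) \<le> M"
    and N: "0 < N" "\<And>t. t \<in> {a..b} \<Longrightarrow> norm (p t) \<le> N"
    unfolding bounded_pos by (meson imageI)
  define D where "D = M * \<bar>C\<bar> + 1"
  have D: "D > 0" "M * \<bar>C\<bar> \<le> D" using M(1) by (auto simp: D_def add_nonneg_pos)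
  have "\<epsilon> / (2 * N) > 0" using \<epsilon> N by simp
  from f[unfolded abs_continuous_curve_def, rule_format, OF this]
  obtain \<delta> where \<delta>: "\<delta> > 0" "\<And>(n::nat) u v. (\<forall>i<n. a \<le> u i \<and> u i \<le> v i \<and> v i \<le> b) \<and>
        disjoint_family_on (\<lambda>i. {u i<..<v i}) {..<n} \<and> (\<Sum>i<n. v i - u i) < \<delta> \<Longrightarrow>
        (\<Sum>i<n. norm (f (v i) - f (u i))) < \<epsilon> / (2 * N)" by blast
  show "\<exists>\<delta>>0. \<forall>(n::nat) u v. (\<forall>i<n. a \<le> u i \<and> u i \<le> v i \<and> v i \<le> b) \<and>
        disjoint_family_on (\<lambda>i. {u i<..<v i}) {..<n} \<and> (\<Sum>i<n. v i - u i) < \<delta> \<longrightarrow>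
        (\<Sum>i<n. norm (p (v i) \<bullet> f (v i) - p (u i) \<bullet> f (u i))) < \<epsilon>"
  proof (intro exI[of _ "min \<delta> (\<epsilon> / (2 * D))"] conjI allI impI, goal_cases)
    case (2 n u v)
    let ?F = "\<Sum>i<n. norm (f (v i) - f (u i))" and ?G = "\<Sum>i<n. v i - u i"
    have F: "?F < \<epsilon> / (2 * N)" using 2 \<delta>(2)[of n u v] by auto
    have G: "0 \<le> ?G" using 2 by (intro sum_nonneg) auto
    have "(\<Sum>i<n. norm (p (v i) \<bullet> f (v i) - p (u i) \<bullet> f (u i)))
      \<le> (\<Sum>i<n. N * norm (f (v i) - f (u i)) + M * \<bar>C\<bar> * (v i - u i))"
    proof (rule sum_mono)
      fix i assume "i \<in> {..<n}"
      then have i: "a \<le> u i" "u i \<le> v i" "v i \<le> b" using 2 by auto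
      have "p (v i) \<bullet> f (v i) - p (u i) \<bullet> f (u i) = p (v i) \<bullet> (f (v i) - f (u i)) + (p (v i) - p (u i)) \<bullet> f (u i)"
        by (simp add: inner_diff)
      then have "norm (p (v i) \<bullet> f (v i) - p (u i) \<bullet> f (u i))
        \<le> norm (p (v i) \<bullet> (f (v i) - f (u i))) + norm ((p (v i) - p (u i)) \<bullet> f (u i))"
        by (metis norm_triangle_ineq)
      also have "\<dots> \<le> norm (p (v i)) * norm (f (v i) - f (u i)) + norm (p (v i) - p (u i)) * norm (f (u i))"
        unfolding real_norm_def by (intro add_mono Cauchy_Schwarz_ineq2)
      also have "\<dots> \<le> N * norm (f (v i) - f (u i)) + (\<bar>C\<bar> * (v i - u i)) * M"
      proof (intro add_mono mult_mono)
        have "norm (p (v i) - p (u i)) \<le> C * (v i - u i)" using i by (rule p)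
        also have "\<dots> \<le> \<bar>C\<bar> * (v i - u i)" using i by (intro mult_right_mono) auto
        finally show "norm (p (v i) - p (u i)) \<le> \<bar>C\<bar> * (v i - u i)" .
      qed (use i N M in auto)
      finally show "norm (p (v i) \<bullet> f (v i) - p (u i) \<bullet> f (u i))
        \<le> N * norm (f (v i) - f (u i)) + M * \<bar>C\<bar> * (v i - u i)" by (simp add: mult_ac)
    qed
    also have "\<dots> = N * ?F + M * \<bar>C\<bar> * ?G" by (simp add: sum.distrib sum_distrib_left)
    also have "\<dots> < \<epsilon> / 2 + \<epsilon> / 2"
    proof (rule add_strict_mono)
      show "N * ?F < \<epsilon> / 2" using F N by (simp add: field_simps)
      have "M * \<bar>C\<bar> * ?G \<le> D * ?G" using D(2) G by (rule mult_right_mono)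
      also have "\<dots> < \<epsilon> / 2" using 2 D by (simp add: field_simps)
      finally show "M * \<bar>C\<bar> * ?G < \<epsilon> / 2" .
    qed
    finally show ?case by simp
  qed (use \<delta> D \<epsilon> in simp)
qed

text \<open>Supplies the gauge at exceptional tags: pieces tagged there stay inside
  \<open>U\<close>, so their total length is below the \<open>\<delta>\<close> of absolute
  continuity.\<close>

lemma negligible_open_superset:
  assumes "negligible (N :: 'a::euclidean_space set)" "0 < \<delta>"
  obtains U where "open U" "N \<subseteq> U" "U \<in> lmeasurable" "measure lebesgue U < \<delta>"
proof -
  have N: "N \<in> null_sets lebesgue" using assms(1) by (simp add: negligible_iff_null_sets)
  then obtain U where U: "open U" "N \<subseteq> U" "U - N \<in> lmeasurable" "emeasure lebesgue (U - N) < ennreal \<delta>"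
    using sets_lebesgue_outer_open[of N \<delta>] assms(2) by blast
  have U_sets: "U \<in> sets lebesgue" using U(1) by (simp add: borel_open sets_completionI_sets)
  have "emeasure lebesgue U = emeasure lebesgue (U - N)"
    using N U_sets by (simp add: emeasure_Diff_null_set)
  then have "emeasure lebesgue U < ennreal \<delta>" using U(4) by simp
  moreover from this have "U \<in> lmeasurable"
    using U_sets by (auto intro!: fmeasurableI simp: less_top[symmetric] elim: less_trans)
  ultimately show ?thesis
    using that[of U] U(1,2) assms(2)
    by (auto simp: emeasure_eq_measure2 ennreal_less_iff)
qed

text \<open>The library version only allows countably many exceptional points; absolute continuity controls the
  contribution to a Riemann sum of the tags in the exceptional null set.\<close>
lemma fundamental_theorem_of_calculus_abs_continuous:
  fixes f :: "real \<Rightarrow> 'a::banach"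
  assumes ab: "a < b" and ac: "abs_continuous_curve a b f"
    and deriv: "AE t in lebesgue_on {a..b}. (f has_vector_derivative f' t) (at t within {a..b})"
  shows "(f' has_integral (f b - f a)) {a..b}"
proof -
  define N where "N = {t \<in> {a..b}. \<not> (f has_vector_derivative f' t) (at t within {a..b})}"
  have "AE t in lebesgue. t \<in> {a..b} \<longrightarrow> (f has_vector_derivative f' t) (at t within {a..b})"
    using deriv by (simp add: AE_restrict_space_iff)
  then obtain N' where "N' \<in> null_sets lebesgue" "N \<subseteq> N'"
    unfolding eventually_ae_filter N_def by auto
  then have N: "negligible N" using negligible_iff_null_sets negligible_subset by blast
  \<comment> \<open>With the value 0 on \<open>N\<close>, an exceptional tag contributes nothing to
    the Riemann sum, and only the increment of \<open>f\<close> over its piece remains to be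
    bounded.\<close>
  define g where "g t = (if t \<in> N then 0 else f' t)" for t
  have "(g has_integral (f b - f a)) {a..b}"
    unfolding has_integral_factor_content_real
  proof (intro allI impI)
    fix \<epsilon> :: real assume \<epsilon>: "0 < \<epsilon>"
    define e where "e = \<epsilon> / 2"
    have e: "0 < e" "0 < e * (b - a)" using \<epsilon> ab by (auto simp: e_def)
    obtain \<delta> where \<delta>: "0 < \<delta>"
      "\<And>(J :: (real \<times> real set) set) u v. finite J \<Longrightarrow> (\<And>j. j \<in> J \<Longrightarrow> a \<le> u j \<and> u j \<le> v j \<and> v j \<le> b) \<Longrightarrow>
      disjoint_family_on (\<lambda>j. {u j<..<v j}) J \<Longrightarrow> (\<Sum>j\<in>J. v j - u j) < \<delta> \<Longrightarrow>
      (\<Sum>j\<in>J. norm (f (v j) - f (u j))) < e * (b - a)"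
      by (rule abs_continuous_curve_finite_family[OF ac e(2)]) blast
    obtain U where U: "open U" "N \<subseteq> U" "U \<in> lmeasurable" "measure lebesgue U < \<delta>"
      using negligible_open_superset[OF N \<delta>(1)] by blast
    have "\<exists>d>0. t \<in> {a..b} - N \<longrightarrow>
       (\<forall>y\<in>{a..b}. norm (y-t) < d \<longrightarrow> norm (f y - f t - (y-t) *\<^sub>R f' t) \<le> e * norm (y-t))" for t
    proof (cases "t \<in> {a..b} - N")
      case True
      then have "(f has_vector_derivative f' t) (at t within {a..b})" by (auto simp: N_def)
      then show ?thesis unfolding has_vector_derivative_def has_derivative_within_alt using e(1) by blast
    qed (auto intro: exI[of _ 1])
    then obtain d where d: "\<And>t. 0 < d t"
      "\<And>t y. t \<in> {a..b} - N \<Longrightarrow> y \<in> {a..b} \<Longrightarrow> norm (y-t) < d t \<Longrightarrow>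
         norm (f y - f t - (y-t) *\<^sub>R f' t) \<le> e * norm (y-t)" by metis
    \<comment> \<open>At a regular tag the gauge is the radius of the derivative estimate; at an
      exceptional tag it confines the piece to the small open set \<open>U\<close>.\<close>
    define \<gamma> where "\<gamma> t = (if t \<in> N then U else ball t (d t))" for t
    have "gauge \<gamma>" unfolding gauge_def \<gamma>_def using U d(1) by auto
    moreover have "norm ((\<Sum>(x,k)\<in>p. measure lborel k *\<^sub>R g x) - (f b - f a)) \<le> \<epsilon> * measure lborel {a..b}"
      if p: "p tagged_division_of {a..b}" and fine: "\<gamma> fine p" for p
    proof -
      have fin: "finite p" using p by blast
      have shape: "k = {Inf k..Sup k}"
        and interval: "Inf k \<le> Sup k \<and> x \<in> {Inf k..Sup k} \<and> a \<le> Inf k \<and> Sup k \<le> b \<and> {Inf k..Sup k} \<subseteq> \<gamma> x"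
        if xk: "(x, k) \<in> p" for x k
      proof -
        obtain u v where k: "k = {u..v}" using tagged_division_ofD(4)[OF p xk] by auto
        have x: "x \<in> k" "k \<subseteq> {a..b}" using tagged_division_ofD(2,3)[OF p xk] .
        then have uv: "Inf k = u" "Sup k = v" "u \<le> v" using k by auto
        have "k \<subseteq> \<gamma> x" using fine xk by (auto simp: fine_def)
        then show "Inf k \<le> Sup k \<and> x \<in> {Inf k..Sup k} \<and> a \<le> Inf k \<and> Sup k \<le> b \<and> {Inf k..Sup k} \<subseteq> \<gamma> x"
          unfolding uv using uv(3) x unfolding k by auto
        show "k = {Inf k..Sup k}" unfolding uv by (rule k)
      qed
      define q where "q = {j \<in> p. fst j \<in> N}"
      define r where "r = p - q"
      have fin': "finite q" "finite r" using fin by (auto simp: q_def r_def)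
      have split: "sum h p = sum h q + sum h r" for h :: "real \<times> real set \<Rightarrow> 'a"
        unfolding r_def using sum.subset_diff[of q p h] fin by (auto simp: q_def add.commute)
      have len: "(\<Sum>(x,k)\<in>p. Sup k - Inf k) = b - a"
        using additive_tagged_division_1[of a b p "\<lambda>x. x"] ab p by simp
      have incr: "(\<Sum>(x,k)\<in>p. f (Sup k) - f (Inf k)) = f b - f a"
        using additive_tagged_division_1[of a b p f] ab p by simp
      let ?h = "\<lambda>(x,k). measure lborel k *\<^sub>R g x - (f (Sup k) - f (Inf k))"
      have total: "(\<Sum>(x,k)\<in>p. measure lborel k *\<^sub>R g x) - (f b - f a) = sum ?h q + sum ?h r"
        unfolding incr[symmetric] split[symmetric] by (simp add: sum_subtractf case_prod_unfold)
      have "norm (sum ?h r) \<le> (\<Sum>(x,k)\<in>r. e * (Sup k - Inf k))"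
      proof (rule sum_norm_le, clarify)
        fix x k assume xk: "(x, k) \<in> r"
        then have xp: "(x, k) \<in> p" and xN: "x \<notin> N" by (auto simp: r_def q_def)
        define u v where "u = Inf k" and "v = Sup k"
        have k: "k = {u..v}" unfolding u_def v_def by (rule shape[OF xp])
        have uv: "u \<le> v" "x \<in> {u..v}" "a \<le> u" "v \<le> b" "{u..v} \<subseteq> \<gamma> x"
          using interval[OF xp] unfolding u_def v_def by auto
        have x: "x \<in> {a..b} - N" using uv xN by auto
        have "u \<in> \<gamma> x" "v \<in> \<gamma> x" using uv by auto
        then have near: "norm (u - x) < d x" "norm (v - x) < d x"
          using xN unfolding \<gamma>_def by (simp_all add: dist_norm norm_minus_commute)
        \<comment> \<open>The increment over the piece is split at the tag, so that the derivative
          estimate at \<open>x\<close> applies to both ends.\<close>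
        have "norm (measure lborel k *\<^sub>R g x - (f v - f u))
          = norm ((f u - f x - (u - x) *\<^sub>R f' x) - (f v - f x - (v - x) *\<^sub>R f' x))"
          using uv xN by (simp add: k g_def algebra_simps)
        also have "\<dots> \<le> norm (f u - f x - (u - x) *\<^sub>R f' x) + norm (f v - f x - (v - x) *\<^sub>R f' x)"
          by (rule norm_triangle_ineq4)
        also have "\<dots> \<le> e * norm (u - x) + e * norm (v - x)"
          using uv x near by (intro add_mono d(2)) auto
        also have "\<dots> = e * (v - u)" using uv by (simp add: algebra_simps)
        finally show "norm (measure lborel k *\<^sub>R g x - (f (Sup k) - f (Inf k))) \<le> e * (Sup k - Inf k)"
          by (simp add: u_def v_def)
      qed
      also have "\<dots> \<le> (\<Sum>(x,k)\<in>p. e * (Sup k - Inf k))"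
      proof (rule sum_mono2[OF fin])
        fix j assume "j \<in> p - r"
        then show "0 \<le> (case j of (x, k) \<Rightarrow> e * (Sup k - Inf k))"
          using interval[of "fst j" "snd j"] e(1) by (auto simp: case_prod_unfold)
      qed (auto simp: r_def)
      also have "\<dots> = e * (b - a)" unfolding len[symmetric] by (simp add: sum_distrib_left case_prod_unfold)
      finally have part_r: "norm (sum ?h r) \<le> e * (b - a)" .
      have disj: "disjoint_family_on (\<lambda>j. {Inf (snd j)<..<Sup (snd j)}) p"
        unfolding disjoint_family_on_def
      proof (intro ballI impI)
        fix i j assume ij: "i \<in> p" "j \<in> p" "i \<noteq> j"
        have int: "interior (snd j) = {Inf (snd j)<..<Sup (snd j)}" if "j \<in> p" for j
        proof -
          have "snd j = {Inf (snd j)..Sup (snd j)}" by (rule shape[of "fst j"]) (simp add: that)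
          then have "interior (snd j) = interior {Inf (snd j)..Sup (snd j)}" by (rule arg_cong)
          also have "\<dots> = {Inf (snd j)<..<Sup (snd j)}" by (rule interior_atLeastAtMost_real)
          finally show ?thesis .
        qed
        have "interior (snd i) \<inter> interior (snd j) = {}"
          using tagged_division_ofD(5)[OF p, of "fst i" "snd i" "fst j" "snd j"] ij by auto
        then show "{Inf (snd i)<..<Sup (snd i)} \<inter> {Inf (snd j)<..<Sup (snd j)} = {}"
          using int ij by simp
      qed
      then have disj_q: "disjoint_family_on (\<lambda>j. {Inf (snd j)<..<Sup (snd j)}) q"
        by (auto simp: disjoint_family_on_def q_def)
      have interval': "Inf (snd j) \<le> Sup (snd j)" "a \<le> Inf (snd j)" "Sup (snd j) \<le> b"
        "{Inf (snd j)..Sup (snd j)} \<subseteq> U" if "j \<in> q" for j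
      proof -
        obtain x k where j: "j = (x, k)" by fastforce
        have "(x, k) \<in> p" "x \<in> N" using that by (auto simp: q_def j)
        with interval[of x k] show "Inf (snd j) \<le> Sup (snd j)" "a \<le> Inf (snd j)" "Sup (snd j) \<le> b"
          "{Inf (snd j)..Sup (snd j)} \<subseteq> U" unfolding j \<gamma>_def by simp_all
      qed
      \<comment> \<open>The pieces have disjoint interiors inside \<open>U\<close>, so their lengths
        add up to at most the measure of \<open>U\<close>.\<close>
      have "(\<Sum>j\<in>q. Sup (snd j) - Inf (snd j)) = (\<Sum>j\<in>q. measure lebesgue {Inf (snd j)<..<Sup (snd j)})"
      proof (rule sum.cong)
        fix j assume "j \<in> q"
        then show "Sup (snd j) - Inf (snd j) = measure lebesgue {Inf (snd j)<..<Sup (snd j)}"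
          using interval'(1)[of j] by simp
      qed simp
      also have "\<dots> = measure lebesgue (\<Union>j\<in>q. {Inf (snd j)<..<Sup (snd j)})"
      proof (rule measure_UNION'[symmetric])
        show "pairwise (\<lambda>i j. disjnt {Inf (snd i)<..<Sup (snd i)} {Inf (snd j)<..<Sup (snd j)}) q"
          using disj_q unfolding disjoint_family_on_def pairwise_def disjnt_def by blast
      qed (use fin' in simp_all)
      also have "\<dots> \<le> measure lebesgue U"
      proof (rule measure_mono_fmeasurable)
        show "(\<Union>j\<in>q. {Inf (snd j)<..<Sup (snd j)}) \<subseteq> U"
        proof (rule UN_least)
          fix j assume "j \<in> q"
          then show "{Inf (snd j)<..<Sup (snd j)} \<subseteq> U"
            using interval'(4)[of j] by (meson greaterThanLessThan_subseteq_atLeastAtMost_iff order_refl order_trans)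
        qed
      qed (use U fin' in auto)
      finally have small: "(\<Sum>j\<in>q. Sup (snd j) - Inf (snd j)) < \<delta>" using U(4) by simp
      have "norm (sum ?h q) \<le> (\<Sum>j\<in>q. norm (f (Sup (snd j)) - f (Inf (snd j))))"
      proof (rule sum_norm_le)
        fix j assume "j \<in> q"
        then show "norm (?h j) \<le> norm (f (Sup (snd j)) - f (Inf (snd j)))"
          by (cases j) (simp add: q_def g_def norm_minus_commute)
      qed
      also have "\<dots> < e * (b - a)"
      proof (rule \<delta>(2)[OF fin'(1) _ disj_q small])
        fix j assume "j \<in> q"
        then show "a \<le> Inf (snd j) \<and> Inf (snd j) \<le> Sup (snd j) \<and> Sup (snd j) \<le> b"
          using interval'(1-3)[of j] by blast
      qed
      finally have part_q: "norm (sum ?h q) < e * (b - a)" .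
      have "norm (sum ?h q + sum ?h r) \<le> e * (b - a) + e * (b - a)"
        using part_q part_r by (intro norm_triangle_le) auto
      then show ?thesis unfolding total using ab by (simp add: e_def)
    qed
    ultimately show "\<exists>d. gauge d \<and> (\<forall>p. p tagged_division_of {a..b} \<and> d fine p \<longrightarrow>
      norm ((\<Sum>(x,k)\<in>p. measure lborel k *\<^sub>R g x) - (f b - f a)) \<le> \<epsilon> * measure lborel {a..b})"
      by (intro exI[of _ \<gamma>]) simp
  qed
  then show ?thesis by (rule has_integral_spike[OF N, rotated]) (simp add: g_def)
qed

section \<open>Linear flows\<close>

text \<open>The exponential \<open>exp (t F)\<close> applied to \<open>x\<close>, with the series
  taken in the vector space itself.\<close>

definition flow :: "('a::euclidean_space \<Rightarrow> 'a) \<Rightarrow> real \<Rightarrow> 'a \<Rightarrow> 'a" where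
  "flow F t x = (\<Sum>k. (t ^ k / fact k) *\<^sub>R (F ^^ k) x)"

context
  fixes F :: "'a::euclidean_space \<Rightarrow> 'a"
  assumes F: "linear F"
begin

lemma linear_funpow: "linear (F ^^ k)"
proof (induction k)
  case 0
  show ?case using linear_id by (simp add: id_def)
next
  case (Suc k)
  show ?case using linear_compose[OF Suc F] by (simp add: o_def)
qed

text \<open>If \<open>C\<close> bounds the operator \<open>F\<close>, the terms are dominated by
  those of \<open>exp (C * \<bar>t\<bar>) * norm x\<close>; this one majorant gives both convergence
  and growth.\<close>

lemma flow_bound:
  shows "\<exists>C>0. \<forall>t x. summable (\<lambda>k. (t ^ k / fact k) *\<^sub>R (F ^^ k) x) \<and>
    norm (flow F t x) \<le> exp (C * \<bar>t\<bar>) * norm x"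
proof -
  obtain C where C: "0 < C" "\<And>x. norm (F x) \<le> C * norm x" using linear_bounded_pos[OF F] by blast
  have pow: "norm ((F ^^ k) x) \<le> C ^ k * norm x" for k x
  proof (induction k)
    case (Suc k)
    have "norm ((F ^^ Suc k) x) \<le> C * norm ((F ^^ k) x)" using C(2) by simp
    also have "\<dots> \<le> C * (C ^ k * norm x)" using C(1) Suc by (intro mult_left_mono) auto
    finally show ?case by (simp add: mult.assoc)
  qed simp
  have exp: "(\<lambda>k. (C * \<bar>t\<bar>) ^ k / fact k * norm x) sums (exp (C * \<bar>t\<bar>) * norm x)" for t and x :: 'a
    using sums_mult2[OF exp_converges[of "C * \<bar>t\<bar>"], of "norm x"] by (simp add: divide_inverse_commute)
  have summand: "norm ((t ^ k / fact k) *\<^sub>R (F ^^ k) x) \<le> (C * \<bar>t\<bar>) ^ k / fact k * norm x" for t k x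
  proof -
    have "norm ((t ^ k / fact k) *\<^sub>R (F ^^ k) x) = \<bar>t\<bar> ^ k / fact k * norm ((F ^^ k) x)"
      by (simp add: power_abs)
    also have "\<dots> \<le> \<bar>t\<bar> ^ k / fact k * (C ^ k * norm x)" by (intro mult_left_mono pow) auto
    finally show ?thesis by (simp add: power_mult_distrib mult_ac)
  qed
  show ?thesis
  proof (intro exI[of _ C] conjI allI C(1))
    fix t x
    show "summable (\<lambda>k. (t ^ k / fact k) *\<^sub>R (F ^^ k) x)"
      by (rule summable_comparison_test'[OF sums_summable[OF exp] summand])
    show "norm (flow F t x) \<le> exp (C * \<bar>t\<bar>) * norm x"
      unfolding flow_def sums_unique[OF exp, of t x]
      by (rule norm_suminf_le[OF summand sums_summable[OF exp]])
  qed
qed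

lemma summable_flow: "summable (\<lambda>k. (t ^ k / fact k) *\<^sub>R (F ^^ k) x)"
  using flow_bound by blast

lemma flow_0: "flow F 0 x = x"
  unfolding flow_def by (subst suminf_finite[of "{0}"]) auto

lemma bounded_linear_flow:
  assumes "bounded_linear f"
  shows "f (flow F t x) = (\<Sum>k. (t ^ k / fact k) *\<^sub>R f ((F ^^ k) x))"
proof -
  interpret f: bounded_linear f by fact
  show ?thesis unfolding flow_def f.suminf[OF summable_flow] by (simp add: f.scaleR)
qed

lemma F_flow: "F (flow F t x) = flow F t (F x)"
  unfolding bounded_linear_flow[OF linear_conv_bounded_linear[THEN iffD1, OF F]]
  by (simp add: flow_def funpow_swap1)

lemma linear_flow: "linear (flow F t)"
proof (rule linearI)
  fix x y
  have "flow F t (x + y) = (\<Sum>k. (t ^ k / fact k) *\<^sub>R (F ^^ k) x + (t ^ k / fact k) *\<^sub>R (F ^^ k) y)"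
    unfolding flow_def linear_add[OF linear_funpow] scaleR_add_right ..
  then show "flow F t (x + y) = flow F t x + flow F t y"
    unfolding flow_def by (simp only: suminf_add[OF summable_flow summable_flow])
next
  fix c x
  have "flow F t (c *\<^sub>R x) = (\<Sum>k. c *\<^sub>R ((t ^ k / fact k) *\<^sub>R (F ^^ k) x))"
    unfolding flow_def linear_scale[OF linear_funpow] by (simp only: scaleR_scaleR mult.commute)
  then show "flow F t (c *\<^sub>R x) = c *\<^sub>R flow F t x"
    unfolding flow_def by (simp only: bounded_linear.suminf[OF bounded_linear_scaleR_right summable_flow])
qed

text \<open>Each coordinate of the flow is a real power series in \<open>t\<close>, and termwise
  differentiation shifts its coefficients, \<open>diffs (c x) = c (F x)\<close>.\<close>

lemma flow_has_vector_derivative: "((\<lambda>t. flow F t x) has_vector_derivative F (flow F t x)) (at t within S)"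
  unfolding has_vector_derivative_def
proof (rule has_derivative_componentwise_within[THEN iffD2], rule ballI)
  fix b :: 'a assume "b \<in> Basis"
  define c where "c y k = ((F ^^ k) y \<bullet> b) / fact k" for y k
  have comp: "flow F s y \<bullet> b = (\<Sum>k. c y k * s ^ k)" for s y
    unfolding bounded_linear_flow[OF bounded_linear_inner_left] by (simp add: c_def mult.commute)
  have summ: "summable (\<lambda>k. c y k * s ^ k)" for s y
    using bounded_linear.summable[OF bounded_linear_inner_left[of b] summable_flow[of s y]]
    by (simp add: c_def mult.commute)
  have "diffs (c x) = c (F x)"
    by (rule ext) (simp add: diffs_def c_def funpow_swap1 del: of_nat_Suc)
  then have "((\<lambda>s. \<Sum>k. c x k * s ^ k) has_field_derivative (\<Sum>k. c (F x) k * t ^ k)) (at t within S)"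
    using termdiffs_strong_converges_everywhere[OF summ, of x t]
    by (auto intro: has_field_derivative_at_within)
  then show "((\<lambda>s. flow F s x \<bullet> b) has_derivative (\<lambda>s. (s *\<^sub>R F (flow F t x)) \<bullet> b)) (at t within S)"
    unfolding F_flow inner_scaleR_left comp has_real_derivative_iff_has_vector_derivative
      has_vector_derivative_def real_scaleR_def .
qed

end

section \<open>Controllability\<close>

lemma C1_lipschitz:
  fixes p :: "real \<Rightarrow> 'a::real_normed_vector"
  assumes deriv: "\<And>t. (p has_vector_derivative p' t) (at t)" and cont: "continuous_on {a..b} p'"
  shows "\<exists>C. \<forall>s t. a \<le> s \<longrightarrow> s \<le> t \<longrightarrow> t \<le> b \<longrightarrow> norm (p t - p s) \<le> C * (t - s)"
proof -
  have "bounded (p' ` {a..b})" using cont by (auto intro: compact_imp_bounded compact_continuous_image)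
  then obtain C where "\<forall>x\<in>p' ` {a..b}. norm x \<le> C" unfolding bounded_iff by blast
  then have C: "norm (p' t) \<le> C" if "t \<in> {a..b}" for t using that by blast
  show ?thesis
  proof (intro exI[of _ C] allI impI)
    fix s t assume st: "a \<le> s" "s \<le> t" "t \<le> b"
    have "norm (p t - p s) \<le> C * norm (t - s)"
    proof (rule differentiable_bound)
      show "(p has_derivative (\<lambda>h. h *\<^sub>R p' x)) (at x within {a..b})" for x
        using deriv[of x] has_derivative_at_withinI by (auto simp: has_vector_derivative_def)
      show "onorm (\<lambda>h. h *\<^sub>R p' x) \<le> C" if "x \<in> {a..b}" for x
        using C[OF that] by (intro onorm_le) (simp add: mult.commute[of C] mult_left_mono)
    qed (use st in auto)
    then show "norm (p t - p s) \<le> C * (t - s)" using st by simp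
  qed
qed

lemma linear_vector_matrix_mult: "linear (\<lambda>x. x v* (A :: real^'n^'m))"
  unfolding transpose_matrix_vector[symmetric] by (rule matrix_vector_mul_linear)

lemma bounded_linear_vector_matrix_mult: "bounded_linear (\<lambda>x. x v* (A :: real^'n^'m))"
  using linear_vector_matrix_mult by (simp add: linear_conv_bounded_linear)

text \<open>Along a solution of the adjoint equation the terms with \<open>A\<close> cancel in the
  derivative of \<open>p t \<bullet> \<gamma> t\<close>, which leaves an integral of the control
  alone. This duality gives both observability and the endpoint bound.\<close>

lemma admissible_pairing:
  fixes A :: "real^'d^'d" and B :: "real^'m^'d"
  assumes adm: "admissible A B \<tau> x y \<gamma> u" and \<tau>: "0 < \<tau>"
    and p: "\<And>t. (p has_vector_derivative - (p t v* A)) (at t)"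
  shows "((\<lambda>t. (p t v* B) \<bullet> u t) has_integral (p \<tau> \<bullet> y - p 0 \<bullet> x)) {0..\<tau>}"
proof -
  have ac: "abs_continuous_curve 0 \<tau> \<gamma>"
    and deriv: "AE t in lebesgue_on {0..\<tau>}. (\<gamma> has_vector_derivative (A *v \<gamma> t + B *v u t)) (at t within {0..\<tau>})"
    and ends: "\<gamma> 0 = x" "\<gamma> \<tau> = y"
    using adm by (auto simp: admissible_def)
  have "continuous_on S p" for S
    using p by (intro continuous_on_vector_derivative[of S p "\<lambda>t. - (p t v* A)"]) (auto intro: has_vector_derivative_at_within)
  then have "continuous_on {0..\<tau>} (\<lambda>t. - (p t v* A))"
    by (intro continuous_intros linear_continuous_on_compose[OF _ linear_vector_matrix_mult])
  then obtain C where C: "\<And>s t. 0 \<le> s \<Longrightarrow> s \<le> t \<Longrightarrow> t \<le> \<tau> \<Longrightarrow> norm (p t - p s) \<le> C * (t - s)"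
    using C1_lipschitz[OF p] by blast
  have "abs_continuous_curve 0 \<tau> (\<lambda>t. p t \<bullet> \<gamma> t)"
    by (rule abs_continuous_curve_inner[OF ac C])
  then show ?thesis unfolding ends[symmetric]
  proof (rule fundamental_theorem_of_calculus_abs_continuous[OF \<tau>])
    show "AE t in lebesgue_on {0..\<tau>}.
      ((\<lambda>t. p t \<bullet> \<gamma> t) has_vector_derivative (p t v* B) \<bullet> u t) (at t within {0..\<tau>})"
      using deriv
    proof eventually_elim
      case (elim t)
      have "((\<lambda>t. p t \<bullet> \<gamma> t) has_vector_derivative
          (p t \<bullet> (A *v \<gamma> t + B *v u t) + (- (p t v* A)) \<bullet> \<gamma> t)) (at t within {0..\<tau>})"
        using bounded_bilinear.has_vector_derivative[OF bounded_bilinear_inner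
            has_vector_derivative_at_within[OF p] elim] .
      then show ?case by (simp add: inner_add_right dot_lmul_matrix)
    qed
  qed
qed

text \<open>Running the flow backwards from \<open>\<tau>\<close> prescribes the terminal value
  \<open>e\<close>, so the pairing singles out the component of the endpoint along
  \<open>e\<close>.\<close>

lemma adjoint_flow:
  fixes A :: "real^'d^'d"
  shows "((\<lambda>t. flow (\<lambda>x. x v* A) (\<tau> - t) e) has_vector_derivative - (flow (\<lambda>x. x v* A) (\<tau> - t) e v* A)) (at t)"
proof -
  have "((\<lambda>t. \<tau> - t) has_vector_derivative (- 1)) (at t)"
    by (auto intro!: derivative_eq_intros)
  from vector_diff_chain_at[OF this flow_has_vector_derivative[OF linear_vector_matrix_mult]]
  show ?thesis by (simp add: o_def)
qed

text \<open>Kalman's condition in dual form. Steer from 0 to \<open>e\<close> itself and pair with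
  the adjoint curve ending in \<open>e\<close>: the hypothesis annihilates every term of the series
  for \<open>p t v* B\<close>, so the integral is 0, while the boundary term is
  \<open>e \<bullet> e\<close>. Any time \<open>\<tau>\<close> will do.\<close>

lemma observable_if_controllable:
  fixes A :: "real^'d^'d" and B :: "real^'m^'d"
  assumes "controllable A B" and e: "\<And>k. (((\<lambda>x. x v* A) ^^ k) e) v* B = 0"
  shows "e = 0"
proof -
  obtain \<tau> \<gamma> u where \<tau>: "0 < \<tau>" and adm: "admissible A B \<tau> 0 e \<gamma> u"
    using assms(1) unfolding controllable_def by metis
  define p where "p = (\<lambda>t. flow (\<lambda>x. x v* A) (\<tau> - t) e)"
  have p0: "p t v* B = 0" for t
    unfolding p_def bounded_linear_flow[OF linear_vector_matrix_mult bounded_linear_vector_matrix_mult] e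
    by simp
  have "((\<lambda>t. (p t v* B) \<bullet> u t) has_integral (p \<tau> \<bullet> e - p 0 \<bullet> 0)) {0..\<tau>}"
    unfolding p_def by (rule admissible_pairing[OF adm \<tau> adjoint_flow])
  then have "((\<lambda>t. 0) has_integral (e \<bullet> e)) {0..\<tau>}"
    unfolding p0 by (simp add: p_def flow_0[OF linear_vector_matrix_mult])
  then have "e \<bullet> e = 0" using has_integral_0_eq by blast
  then show ?thesis by simp
qed

text \<open>The adjoint feedback \<open>u = B\<^sup>T q\<close>, \<open>q' = A\<^sup>T q\<close>, run backwards in time: the endpoint map
  \<open>q 0 \<mapsto> g 1\<close> is injective, since \<open>q 1 \<bullet> g 1 = - \<integral> \<bar>B\<^sup>T q\<bar>\<^sup>2\<close>, hence onto.\<close>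
lemma steer_to_zero:
  fixes A :: "real^'d^'d" and B :: "real^'m^'d"
  assumes "controllable A B"
  obtains \<gamma> u where "\<And>t. (\<gamma> has_vector_derivative (A *v \<gamma> t + B *v u t)) (at t)"
    "continuous_on UNIV u" "\<gamma> 0 = x" "\<gamma> 1 = 0"
proof -
  define T where "T = (\<lambda>q :: real^'d. q v* A)"
  \<comment> \<open>State and adjoint form one linear system, in reversed time. Its flow from
    \<open>(0, e)\<close> provides existence of the solution and linearity of the endpoint in
    \<open>e\<close> together.\<close>
  define F where "F = (\<lambda>(g :: real^'d, q :: real^'d). (- (A *v g) - B *v (q v* B), q v* A))"
  have F: "linear F"
    unfolding F_def
    by (rule linearI) (auto simp: matrix_vector_right_distrib linear_add[OF linear_vector_matrix_mult]
        linear_scale[OF linear_vector_matrix_mult] linear_scale[OF matrix_vector_mul_linear] scaleR_diff_right)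
  define g q where "g e t = fst (flow F t (0, e))" and "q e t = snd (flow F t (0, e))" for e t
  have flow_eq: "flow F t (0, e) = (g e t, q e t)" for e t by (simp add: g_def q_def)
  have g_deriv: "(g e has_vector_derivative - (A *v g e t) - B *v (q e t v* B)) (at t within S)" for e t S
    using bounded_linear.has_vector_derivative[OF bounded_linear_fst flow_has_vector_derivative[OF F, of "(0, e)" t S]]
    unfolding flow_eq by (simp add: F_def)
  have q_deriv: "(q e has_vector_derivative q e t v* A) (at t within S)" for e t S
    using bounded_linear.has_vector_derivative[OF bounded_linear_snd flow_has_vector_derivative[OF F, of "(0, e)" t S]]
    unfolding flow_eq by (simp add: F_def)
  have init: "g e 0 = 0" "q e 0 = e" for e using flow_0[OF F, of "(0, e)"] by (simp_all add: g_def q_def)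
  have q_cont: "continuous_on S (\<lambda>t. q e t v* B)" for e S
    by (intro linear_continuous_on_compose[OF _ linear_vector_matrix_mult]
        continuous_on_vector_derivative[OF q_deriv])
  have inj: "e = 0" if zero: "g e 1 = 0" for e
  proof -
    let ?n = "\<lambda>t. (q e t v* B) \<bullet> (q e t v* B)"
    have "((\<lambda>t. - ?n t) has_integral (q e 1 \<bullet> g e 1 - q e 0 \<bullet> g e 0)) {0..1}"
    proof (rule fundamental_theorem_of_calculus)
      fix t :: real
      have "((\<lambda>t. q e t \<bullet> g e t) has_vector_derivative
          (q e t \<bullet> (- (A *v g e t) - B *v (q e t v* B)) + (q e t v* A) \<bullet> g e t)) (at t within {0..1})"
        by (rule bounded_bilinear.has_vector_derivative[OF bounded_bilinear_inner q_deriv g_deriv])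
      then show "((\<lambda>t. q e t \<bullet> g e t) has_vector_derivative - ?n t) (at t within {0..1})"
        by (simp add: inner_diff_right dot_lmul_matrix)
    qed simp
    then have "((\<lambda>t. - ?n t) has_integral 0) {0..1}" using zero init by simp
    then have "(?n has_integral 0) {0..1}" using has_integral_neg[of "\<lambda>t. - ?n t" 0] by simp
    then have "integral {0..1} ?n = 0" by (rule integral_unique)
    moreover have "continuous_on {0..1} ?n" using q_cont by (intro continuous_intros)
    ultimately have n0: "\<forall>t\<in>{0..1}. ?n t = 0" using integral_eq_0_iff[of 0 1 ?n] by simp
    \<comment> \<open>Differentiating the identity \<open>q e t v* B = 0\<close> repeatedly brings
      down one power of \<open>T\<close> each time; at \<open>t = 0\<close> this is the hypothesis
      of observability for \<open>e\<close>.\<close>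
    have "\<forall>t\<in>{0..1}. ((T ^^ k) (q e t)) v* B = 0" for k
    proof (induction k)
      case 0 show ?case using n0 by simp
    next
      case (Suc k)
      have T: "linear T" unfolding T_def by (rule linear_vector_matrix_mult)
      have "linear (\<lambda>x. ((T ^^ k) x) v* B)"
        using linear_compose[OF linear_funpow[OF T] linear_vector_matrix_mult] by (simp add: o_def)
      then have lin: "bounded_linear (\<lambda>x. ((T ^^ k) x) v* B)" by (simp add: linear_conv_bounded_linear)
      show ?case
      proof
        fix t :: real assume t: "t \<in> {0..1}"
        have "((\<lambda>t. ((T ^^ k) (q e t)) v* B) has_vector_derivative ((T ^^ k) (T (q e t))) v* B) (at t within {0..1})"
          using bounded_linear.has_vector_derivative[OF lin q_deriv] by (simp add: T_def)
        then have "((\<lambda>t. 0) has_vector_derivative ((T ^^ k) (T (q e t))) v* B) (at t within {0..1})"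
          by (rule has_vector_derivative_transform_within[where d=1]) (use Suc t in auto)
        moreover have "((\<lambda>t. 0 :: real^'m) has_vector_derivative 0) (at t within {0..1})" by simp
        ultimately have "((T ^^ k) (T (q e t))) v* B = 0"
          using t by (intro vector_derivative_unique_within_closed_interval[of 0 1 t, unfolded box_real]) auto
        then show "((T ^^ Suc k) (q e t)) v* B = 0" by (simp add: funpow_swap1)
      qed
    qed
    then have "((T ^^ k) (q e 0)) v* B = 0" for k by simp
    then have "((T ^^ k) e) v* B = 0" for k unfolding init(2) .
    then show "e = 0" using observable_if_controllable[OF assms] by (simp add: T_def)
  qed
  have lin: "linear (\<lambda>e. g e 1)"
  proof -
    have "linear (\<lambda>e. (0 :: real^'d, e))" by (rule linearI) auto
    then have "linear (fst \<circ> (flow F 1 \<circ> (\<lambda>e. (0, e))))"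
      by (intro linear_compose linear_flow[OF F] linear_fst)
    then show ?thesis by (simp add: o_def g_def)
  qed
  have "inj (\<lambda>e. g e 1)" using linear_injective_0[OF lin] inj by blast
  then have "surj (\<lambda>e. g e 1)" by (rule linear_inj_imp_surj[OF lin])
  then obtain e where e: "g e 1 = x" by (metis surjD)
  \<comment> \<open>Reversing time again turns the curve from 0 to \<open>x\<close> into one from
    \<open>x\<close> to 0 and restores the sign of the equation.\<close>
  show ?thesis
  proof (rule that[of "\<lambda>t. g e (1 - t)" "\<lambda>t. q e (1 - t) v* B"])
    fix t :: real
    have "((\<lambda>t. 1 - t) has_vector_derivative (- 1)) (at t)"
      by (auto intro!: derivative_eq_intros)
    from vector_diff_chain_at[OF this g_deriv[of e "1 - t" UNIV]]
    show "((\<lambda>t. g e (1 - t)) has_vector_derivative A *v g e (1 - t) + B *v (q e (1 - t) v* B)) (at t)"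
      by (simp add: o_def add.commute)
    show "continuous_on UNIV (\<lambda>t. q e (1 - t) v* B)"
      by (rule continuous_on_compose2[OF q_cont[of UNIV]]) (auto intro!: continuous_intros)
  qed (use e init in auto)
qed

section \<open>Superposition of admissible pairs and the endpoint bound\<close>

lemma square_integrable_continuous:
  assumes "continuous_on {a..b} u"
  shows "square_integrable a b u"
  unfolding square_integrable_def
  using assms by (auto intro!: continuous_imp_measurable_on_sets_lebesgue continuous_imp_integrable_real continuous_intros)

lemma square_integrable_lincomb:
  assumes u: "square_integrable a b u" and v: "square_integrable a b v"
  shows "square_integrable a b (\<lambda>t. c *\<^sub>R u t + d *\<^sub>R v t)"
  unfolding square_integrable_def
proof
  have [measurable]: "u \<in> borel_measurable (lebesgue_on {a..b})" "v \<in> borel_measurable (lebesgue_on {a..b})"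
    using u v by (auto simp: square_integrable_def)
  show "(\<lambda>t. c *\<^sub>R u t + d *\<^sub>R v t) \<in> borel_measurable (lebesgue_on {a..b})" by measurable
  have int: "integrable (lebesgue_on {a..b}) (\<lambda>t. 2 * c\<^sup>2 * (norm (u t))\<^sup>2 + 2 * d\<^sup>2 * (norm (v t))\<^sup>2)"
    using u v by (auto simp: square_integrable_def)
  show "integrable (lebesgue_on {a..b}) (\<lambda>t. (norm (c *\<^sub>R u t + d *\<^sub>R v t))\<^sup>2)"
  proof (rule Bochner_Integration.integrable_bound[OF int])
    show "AE t in lebesgue_on {a..b}. norm ((norm (c *\<^sub>R u t + d *\<^sub>R v t))\<^sup>2)
      \<le> norm (2 * c\<^sup>2 * (norm (u t))\<^sup>2 + 2 * d\<^sup>2 * (norm (v t))\<^sup>2)"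
    proof (rule AE_I2)
      fix t
      have "(norm (c *\<^sub>R u t + d *\<^sub>R v t))\<^sup>2 \<le> (norm (c *\<^sub>R u t) + norm (d *\<^sub>R v t))\<^sup>2"
        by (intro power_mono norm_triangle_ineq) auto
      also have "\<dots> \<le> 2 * (norm (c *\<^sub>R u t))\<^sup>2 + 2 * (norm (d *\<^sub>R v t))\<^sup>2"
        using sum_squares_bound[of "norm (c *\<^sub>R u t)" "norm (d *\<^sub>R v t)"] by (simp add: power2_sum)
      also have "\<dots> = 2 * c\<^sup>2 * (norm (u t))\<^sup>2 + 2 * d\<^sup>2 * (norm (v t))\<^sup>2"
        by (simp add: power_mult_distrib)
      finally show "norm ((norm (c *\<^sub>R u t + d *\<^sub>R v t))\<^sup>2)
        \<le> norm (2 * c\<^sup>2 * (norm (u t))\<^sup>2 + 2 * d\<^sup>2 * (norm (v t))\<^sup>2)" by simp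
    qed
  qed measurable
qed

text \<open>Used with coefficients \<open>\<alpha>\<close> and \<open>1 - \<alpha>\<close> for
  convexity of the cost, and with \<open>1\<close> and \<open>- 1\<close> for the difference of two
  trajectories, which starts at 0.\<close>

lemma admissible_lincomb:
  assumes "admissible A B \<tau> x y \<gamma> u" "admissible A B \<tau> x' y' \<gamma>' u'"
  shows "admissible A B \<tau> (c *\<^sub>R x + d *\<^sub>R x') (c *\<^sub>R y + d *\<^sub>R y')
    (\<lambda>t. c *\<^sub>R \<gamma> t + d *\<^sub>R \<gamma>' t) (\<lambda>t. c *\<^sub>R u t + d *\<^sub>R u' t)"
proof -
  have "AE t in lebesgue_on {0..\<tau>}. ((\<lambda>t. c *\<^sub>R \<gamma> t + d *\<^sub>R \<gamma>' t) has_vector_derivative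
      (A *v (c *\<^sub>R \<gamma> t + d *\<^sub>R \<gamma>' t) + B *v (c *\<^sub>R u t + d *\<^sub>R u' t))) (at t within {0..\<tau>})"
    using assms[unfolded admissible_def, THEN conjunct2, THEN conjunct2, THEN conjunct1]
  proof eventually_elim
    case (elim t)
    have "((\<lambda>t. c *\<^sub>R \<gamma> t + d *\<^sub>R \<gamma>' t) has_vector_derivative
      (c *\<^sub>R (A *v \<gamma> t + B *v u t) + d *\<^sub>R (A *v \<gamma>' t + B *v u' t))) (at t within {0..\<tau>})"
      using elim by (intro has_vector_derivative_add
          bounded_linear.has_vector_derivative[OF bounded_linear_scaleR_right])
    moreover have "c *\<^sub>R (A *v \<gamma> t + B *v u t) + d *\<^sub>R (A *v \<gamma>' t + B *v u' t)
      = A *v (c *\<^sub>R \<gamma> t + d *\<^sub>R \<gamma>' t) + B *v (c *\<^sub>R u t + d *\<^sub>R u' t)"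
      unfolding matrix_vector_right_distrib linear_scale[OF matrix_vector_mul_linear] scaleR_add_right
      by (simp add: add_ac)
    ultimately show ?case by simp
  qed
  then show ?thesis
    using assms by (auto simp: admissible_def intro: abs_continuous_curve_lincomb square_integrable_lincomb)
qed

lemma admissible_C1:
  fixes A :: "real^'d^'d" and B :: "real^'m^'d"
  assumes deriv: "\<And>t. (\<gamma> has_vector_derivative (A *v \<gamma> t + B *v u t)) (at t)"
    and u: "continuous_on UNIV u"
  shows "admissible A B \<tau> (\<gamma> 0) (\<gamma> \<tau>) \<gamma> u"
proof -
  have \<gamma>: "continuous_on S \<gamma>" for S
    by (rule continuous_on_vector_derivative[OF has_vector_derivative_at_within[OF deriv]])
  have u': "continuous_on S u" for S using u continuous_on_subset by blast
  have "continuous_on {0..\<tau>} (\<lambda>t. A *v \<gamma> t + B *v u t)"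
    by (intro continuous_intros linear_continuous_on_compose[OF _ matrix_vector_mul_linear] \<gamma> u')
  then obtain C where "\<And>s t. 0 \<le> s \<Longrightarrow> s \<le> t \<Longrightarrow> t \<le> \<tau> \<Longrightarrow> norm (\<gamma> t - \<gamma> s) \<le> C * (t - s)"
    using C1_lipschitz[OF deriv] by blast
  then have "abs_continuous_curve 0 \<tau> \<gamma>" by (rule lipschitz_abs_continuous_curve)
  then show ?thesis
    using square_integrable_continuous[OF u'] has_vector_derivative_at_within[OF deriv]
    by (simp add: admissible_def)
qed

text \<open>Pairing with the adjoint trajectory that ends in \<open>z\<close> bounds \<open>\<bar>z\<bar>\<^sup>2\<close> by \<open>\<integral> C \<bar>z\<bar> \<bar>u\<bar>\<close>, which
  is absorbed by Young's inequality.\<close>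
lemma endpoint_bound:
  fixes A :: "real^'d^'d" and B :: "real^'m^'d"
  obtains C where "0 < C" "\<And>z \<gamma> u. admissible A B 1 0 z \<gamma> u \<Longrightarrow>
    (norm z)\<^sup>2 \<le> C * (\<integral>t. (norm (u t))\<^sup>2 \<partial>lebesgue_on {0..1})"
proof -
  define T where "T = (\<lambda>q :: real^'d. q v* A)"
  have T: "linear T" unfolding T_def by (rule linear_vector_matrix_mult)
  obtain b where b: "0 < b" "\<And>x. norm (x v* B) \<le> b * norm x"
    using linear_bounded_pos[OF linear_vector_matrix_mult[of B]] by blast
  obtain c where c: "0 < c" "\<And>t x. norm (flow T t x) \<le> exp (c * \<bar>t\<bar>) * norm x"
    using flow_bound[OF T] by blast
  \<comment> \<open>\<open>b\<close> bounds multiplication by \<open>B\<close>, and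
    \<open>exp c\<close> bounds the adjoint flow over times in \<open>[0, 1]\<close>.\<close>
  define C where "C = b * exp c"
  have C: "0 < C" using b by (simp add: C_def)
  show ?thesis
  proof (rule that[of "C\<^sup>2"])
    fix z \<gamma> u assume adm: "admissible A B 1 0 z \<gamma> u"
    define p where "p = (\<lambda>t. flow T (1 - t) z)"
    have "((\<lambda>t. (p t v* B) \<bullet> u t) has_integral (p 1 \<bullet> z - p 0 \<bullet> 0)) {0..1}"
      unfolding p_def T_def by (rule admissible_pairing[OF adm _ adjoint_flow]) simp
    then have int: "((\<lambda>t. (p t v* B) \<bullet> u t) has_integral (norm z)\<^sup>2) {0..1}"
      by (simp add: p_def flow_0[OF T] power2_norm_eq_inner)
    let ?I = "\<integral>t. (norm (u t))\<^sup>2 \<partial>lebesgue_on {0..1}"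
    have "integrable (lebesgue_on {0..1}) (\<lambda>t. (norm (u t))\<^sup>2)"
      using adm by (simp add: admissible_def square_integrable_def)
    then have "((\<lambda>t. (norm (u t))\<^sup>2) has_integral ?I) {0..1}"
      by (rule has_integral_integral_lebesgue_on) simp
    moreover have "((\<lambda>t. (norm z)\<^sup>2 / 2) has_integral ((norm z)\<^sup>2 / 2)) {0..1::real}"
      using has_integral_const_real[of "(norm z)\<^sup>2 / 2" 0 1] by simp
    ultimately have "((\<lambda>t. (norm z)\<^sup>2 / 2 + C\<^sup>2 / 2 * (norm (u t))\<^sup>2) has_integral ((norm z)\<^sup>2 / 2 + C\<^sup>2 / 2 * ?I)) {0..1}"
      by (intro has_integral_add has_integral_mult_right)
    from int this have "(norm z)\<^sup>2 \<le> (norm z)\<^sup>2 / 2 + C\<^sup>2 / 2 * ?I"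
    proof (rule has_integral_le)
      show "(p t v* B) \<bullet> u t \<le> (norm z)\<^sup>2 / 2 + C\<^sup>2 / 2 * (norm (u t))\<^sup>2" if t: "t \<in> {0..1}" for t
      proof -
        have "norm (p t v* B) \<le> b * norm (p t)" by (rule b(2))
        also have "\<dots> \<le> b * (exp (c * \<bar>1 - t\<bar>) * norm z)"
          unfolding p_def using b(1) c(2) by (intro mult_left_mono) auto
        also have "\<dots> \<le> b * (exp c * norm z)"
          using b(1) c(1) t by (intro mult_left_mono mult_right_mono) (auto simp: mult_left_le)
        finally have "norm (p t v* B) \<le> C * norm z" by (simp add: C_def)
        have "(p t v* B) \<bullet> u t \<le> norm (p t v* B) * norm (u t)" by (rule norm_cauchy_schwarz)
        also have "\<dots> \<le> C * norm z * norm (u t)"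
          using \<open>norm (p t v* B) \<le> C * norm z\<close> by (intro mult_right_mono) auto
        also have "\<dots> \<le> (norm z)\<^sup>2 / 2 + C\<^sup>2 / 2 * (norm (u t))\<^sup>2"
          using sum_squares_bound[of "norm z" "C * norm (u t)"] by (simp add: power_mult_distrib field_simps)
        finally show ?thesis .
      qed
    qed
    then show "(norm z)\<^sup>2 \<le> C\<^sup>2 * ?I" by simp
  qed (use C in simp)
qed

section \<open>Dual transport problem\<close>

text \<open>The c-transform of optimal transport. The infimum runs over \<open>K\<close>, but
  \<open>x\<close> is arbitrary, so that transforms become continuous functions on the whole
  space.\<close>

definition ctrans :: "('a \<Rightarrow> 'b \<Rightarrow> real) \<Rightarrow> 'b set \<Rightarrow> ('b \<Rightarrow> real) \<Rightarrow> 'a \<Rightarrow> real" where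
  "ctrans c K \<psi> x = (INF y\<in>K. c x y - \<psi> y)"

lemma ctrans_attained:
  fixes c :: "'a \<Rightarrow> 'b::topological_space \<Rightarrow> real"
  assumes "compact K" "K \<noteq> {}" "continuous_on K (c x)" "continuous_on K \<psi>"
  obtains y where "y \<in> K" "ctrans c K \<psi> x = c x y - \<psi> y"
    "\<And>z. z \<in> K \<Longrightarrow> ctrans c K \<psi> x \<le> c x z - \<psi> z"
proof -
  have "continuous_on K (\<lambda>y. c x y - \<psi> y)"
    using assms by (intro continuous_intros) auto
  from continuous_attains_inf[OF assms(1,2) this]
  obtain y where y: "y \<in> K" "\<forall>z\<in>K. c x y - \<psi> y \<le> c x z - \<psi> z" by auto
  have "ctrans c K \<psi> x = c x y - \<psi> y"
    unfolding ctrans_def using y by (intro cInf_eq_minimum) auto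
  with y that show ?thesis by auto
qed

lemma ctrans_le:
  fixes c :: "'a \<Rightarrow> 'b::topological_space \<Rightarrow> real"
  assumes "compact K" "continuous_on K (c x)" "continuous_on K \<psi>" "y \<in> K"
  shows "ctrans c K \<psi> x \<le> c x y - \<psi> y"
  using ctrans_attained[of K c x \<psi>] assms by (metis empty_iff)

lemma ctrans_greatest:
  assumes "K \<noteq> {}" "\<And>y. y \<in> K \<Longrightarrow> m \<le> c x y - \<psi> y"
  shows "m \<le> ctrans c K \<psi> x"
  unfolding ctrans_def using assms by (intro cINF_greatest) auto

text \<open>An infimum moves by no more than its family does. Point and potential may both change: a
  change of \<open>x\<close> yields equicontinuity, a change of \<open>\<psi>\<close> yields uniform
  convergence of transforms.\<close>

lemma abs_ctrans_diff_le:
  fixes c :: "'a \<Rightarrow> 'b::topological_space \<Rightarrow> real"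
  assumes K: "compact K" "K \<noteq> {}"
    and "continuous_on K (c x)" "continuous_on K \<psi>"
    and "continuous_on K (c x')" "continuous_on K \<psi>'"
    and e: "\<And>y. y \<in> K \<Longrightarrow> \<bar>(c x y - \<psi> y) - (c x' y - \<psi>' y)\<bar> \<le> e"
  shows "\<bar>ctrans c K \<psi> x - ctrans c K \<psi>' x'\<bar> \<le> e"
proof -
  obtain y where y: "y \<in> K" "ctrans c K \<psi> x = c x y - \<psi> y"
    using ctrans_attained[of K c x \<psi>] assms(1-4) by metis
  obtain z where z: "z \<in> K" "ctrans c K \<psi>' x' = c x' z - \<psi>' z"
    using ctrans_attained[of K c x' \<psi>'] assms(1,2,5,6) by metis
  have "ctrans c K \<psi> x \<le> c x z - \<psi> z" "ctrans c K \<psi>' x' \<le> c x' y - \<psi>' y"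
    using ctrans_le[of K c x \<psi> z] ctrans_le[of K c x' \<psi>' y] assms(1,3-6) y(1) z(1) by blast+
  with y z e[of y] e[of z] show ?thesis by auto
qed

lemma continuous_on_slice:
  assumes "continuous_on UNIV (\<lambda>(x, y). c x y)"
  shows "continuous_on S (c x)" "continuous_on T (\<lambda>x. c x y)"
proof -
  have "continuous_on S (\<lambda>y. (x, y))" "continuous_on T (\<lambda>x. (x, y))"
    by (intro continuous_intros)+
  from this[THEN continuous_on_compose2[OF assms]]
  show "continuous_on S (c x)" "continuous_on T (\<lambda>x. c x y)" by auto
qed

text \<open>The potential cancels when two points are compared, so \<open>d\<close> comes from
  uniform continuity of \<open>c\<close> on a compact product and is the same for all
  \<open>\<psi>\<close>, as Arzela-Ascoli requires.\<close>

lemma ctrans_equicontinuous: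
  fixes c :: "'a::heine_borel \<Rightarrow> 'b::metric_space \<Rightarrow> real"
  assumes c: "continuous_on UNIV (\<lambda>(x, y). c x y)" and K: "compact K" "K \<noteq> {}" and "0 < e"
  obtains d where "0 < d"
    "\<And>\<psi> x. continuous_on K \<psi> \<Longrightarrow> dist x x0 < d \<Longrightarrow> \<bar>ctrans c K \<psi> x - ctrans c K \<psi> x0\<bar> \<le> e"
proof -
  have "compact (cball x0 1 \<times> K)" using K by (intro compact_Times) auto
  moreover have "continuous_on (cball x0 1 \<times> K) (\<lambda>(x, y). c x y)"
    using c continuous_on_subset by blast
  ultimately have "uniformly_continuous_on (cball x0 1 \<times> K) (\<lambda>(x, y). c x y)"
    by (intro compact_uniformly_continuous)
  from this[unfolded uniformly_continuous_on_def, rule_format, OF \<open>0 < e\<close>]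
  obtain d where d: "d > 0" "\<And>x y x' y'. (x,y) \<in> cball x0 1 \<times> K \<Longrightarrow> (x',y') \<in> cball x0 1 \<times> K \<Longrightarrow>
     dist (x', y') (x, y) < d \<Longrightarrow> dist (c x' y') (c x y) < e" by fastforce
  show ?thesis
  proof (rule that[of "min d 1"])
    fix \<psi> :: "'b \<Rightarrow> real" and x assume \<psi>: "continuous_on K \<psi>" and x: "dist x x0 < min d 1"
    have "\<bar>(c x y - \<psi> y) - (c x0 y - \<psi> y)\<bar> \<le> e" if "y \<in> K" for y
      using d(2)[of x0 y x y] x that by (auto simp: dist_commute dist_Pair_Pair dist_real_def)
    then show "\<bar>ctrans c K \<psi> x - ctrans c K \<psi> x0\<bar> \<le> e"
      using K \<psi> continuous_on_slice[OF c] by (intro abs_ctrans_diff_le) auto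
  qed (use d in auto)
qed

lemma continuous_on_ctrans:
  fixes c :: "'a::heine_borel \<Rightarrow> 'b::metric_space \<Rightarrow> real"
  assumes c: "continuous_on UNIV (\<lambda>(x, y). c x y)" and K: "compact K" "K \<noteq> {}"
    and \<psi>: "continuous_on K \<psi>"
  shows "continuous_on S (ctrans c K \<psi>)"
  unfolding continuous_on_iff
proof safe
  fix x0 e assume "x0 \<in> S" "(e::real) > 0"
  then have "e/2 > 0" by simp
  then obtain d where "0 < d"
    "\<And>x. dist x x0 < d \<Longrightarrow> \<bar>ctrans c K \<psi> x - ctrans c K \<psi> x0\<bar> \<le> e/2"
    using ctrans_equicontinuous[OF c K] \<psi> by metis
  then show "\<exists>d>0. \<forall>x'\<in>S. dist x' x0 < d \<longrightarrow> dist (ctrans c K \<psi> x') (ctrans c K \<psi> x0) < e"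
    using \<open>e > 0\<close> by (intro exI[of _ d]) (force simp: dist_real_def)
qed

lemma continuous_on_swap:
  assumes "continuous_on UNIV (\<lambda>(x, y). c x y)"
  shows "continuous_on UNIV (\<lambda>(y, x). c x y)"
proof -
  have "continuous_on UNIV (\<lambda>p. (snd p, fst p))" by (intro continuous_intros)
  from continuous_on_compose2[OF assms this] show ?thesis by (auto simp: case_prod_unfold)
qed

lemma integrable_continuous_on_compact:
  fixes f :: "'a::metric_space \<Rightarrow> real"
  assumes "finite_measure M" "sets M = sets borel" "compact X" "AE x in M. x \<in> X" "continuous_on UNIV f"
  shows "integrable M f"
proof -
  interpret finite_measure M by fact
  have "compact (f ` X)"
    using assms by (meson compact_continuous_image continuous_on_subset subset_UNIV)
  then obtain B where "\<And>x. x \<in> X \<Longrightarrow> norm (f x) \<le> B"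
    by (meson bounded_iff compact_imp_bounded imageI)
  with assms(4) have "AE x in M. norm (f x) \<le> B" by auto
  moreover have "f \<in> borel_measurable M"
    using borel_measurable_continuous_onI[OF assms(5)] assms(2) by (simp cong: measurable_cong_sets)
  ultimately show ?thesis by (rule integrable_const_bound)
qed

text \<open>Closed sets are an intersection-stable generator of the Borel sets, and their indicators
  are limits of the continuous functions \<open>max 0 (1 - n * infdist x C)\<close>, which stay
  between 0 and 1.\<close>

lemma prob_eqI_bounded_continuous:
  fixes M N :: "'a::metric_space measure"
  assumes "prob_space M" "prob_space N" and sets: "sets M = sets borel" "sets N = sets borel"
    and eq: "\<And>f::'a \<Rightarrow> real. continuous_on UNIV f \<Longrightarrow> (\<And>x. \<bar>f x\<bar> \<le> 1) \<Longrightarrow> (\<integral>x. f x \<partial>M) = (\<integral>x. f x \<partial>N)"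
  shows "M = N"
proof -
  interpret M: prob_space M by fact
  interpret N: prob_space N by fact
  note [measurable_cong] = sets
  have closed: "measure M C = measure N C" if C: "closed C" for C
  \<comment> \<open>By convention \<open>infdist\<close> to the empty set is 0, so the approximation
    would fail for it.\<close>
  proof (cases "C = {}")
    case False
    define f where "f n x = max 0 (1 - real n * infdist x C)" for n x
    have cont: "continuous_on UNIV (f n)" for n
      unfolding f_def by (intro continuous_intros)
    then have [measurable]: "f n \<in> borel_measurable borel" for n
      by (rule borel_measurable_continuous_onI)
    have C': "C \<in> sets borel" using C by simp
    have bd: "\<bar>f n x\<bar> \<le> 1" for n x by (auto simp: f_def infdist_nonneg)
    have lim: "(\<lambda>n. f n x) \<longlonglongrightarrow> indicator C x" for x
    proof (cases "x \<in> C")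
      case True then show ?thesis by (simp add: f_def)
    next
      case nin: False
      then have pos: "infdist x C > 0"
        using C False by (metis in_closed_iff_infdist_zero infdist_nonneg less_eq_real_def)
      obtain m where m: "real m * infdist x C \<ge> 1"
        using reals_Archimedean3[OF pos] by (metis less_imp_le)
      have "f n x = 0" if "n \<ge> m" for n
      proof -
        have "real m * infdist x C \<le> real n * infdist x C"
          using that pos by (intro mult_right_mono) auto
        with m show ?thesis by (simp add: f_def)
      qed
      then have "eventually (\<lambda>n. f n x = 0) sequentially" by (auto simp: eventually_sequentially)
      then show ?thesis using nin by (simp add: tendsto_eventually)
    qed
    have "(\<lambda>n. \<integral>x. f n x \<partial>M) \<longlonglongrightarrow> (\<integral>x. indicator C x \<partial>M)"
      using lim bd C' by (intro integral_dominated_convergence[where w="\<lambda>_. 1"]) auto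
    moreover have "(\<lambda>n. \<integral>x. f n x \<partial>N) \<longlonglongrightarrow> (\<integral>x. indicator C x \<partial>N)"
      using lim bd C' by (intro integral_dominated_convergence[where w="\<lambda>_. 1"]) auto
    moreover have "(\<integral>x. f n x \<partial>M) = (\<integral>x. f n x \<partial>N)" for n
      using cont bd by (intro eq)
    ultimately have "(\<integral>x. indicator C x \<partial>M) = (\<integral>x. indicator C x \<partial>N :: real)"
      by (metis (no_types, lifting) LIMSEQ_unique ext)
    then show ?thesis using C' sets by simp
  qed auto
  show ?thesis
  proof (rule measure_eqI_generator_eq[where E="Collect closed" and \<Omega>=UNIV and A="\<lambda>_. UNIV"])
    show "Int_stable (Collect closed)" by (auto simp: Int_stable_def)
    show "emeasure M X = emeasure N X" if "X \<in> Collect closed" for X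
      using closed[of X] that by (simp add: M.emeasure_eq_measure N.emeasure_eq_measure)
    show "sets M = sigma_sets UNIV (Collect closed)" "sets N = sigma_sets UNIV (Collect closed)"
      using sets by (simp_all add: borel_eq_closed)
  qed auto
qed

text \<open>Envelope principle: with a unique minimiser \<open>y\<close>, the transform is
  differentiable in the potential along \<open>\<eta>\<close>, with derivative
  \<open>- \<eta> y\<close>. The competitor \<open>y\<close> gives the upper bound for every
  \<open>n\<close>. For the lower bound, the points where \<open>\<eta>\<close> is at least
  \<open>\<eta> y + e\<close> form a compact set that misses the minimum by a fixed margin, so a
  small perturbation cannot move the minimiser there.\<close>

lemma ctrans_variation:
  fixes c :: "'a \<Rightarrow> 'b::t2_space \<Rightarrow> real"
  assumes K: "compact K" and c: "continuous_on K (c x)"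
    and \<psi>: "continuous_on K \<psi>" and \<eta>: "continuous_on K \<eta>" and y: "y \<in> K"
    and uniq: "\<And>z. z \<in> K \<Longrightarrow> c x z - \<psi> z \<le> ctrans c K \<psi> x \<Longrightarrow> z = y"
  shows "(\<lambda>n. (ctrans c K (\<lambda>z. \<psi> z + \<eta> z / real (Suc n)) x - ctrans c K \<psi> x) * real (Suc n)) \<longlonglongrightarrow> - \<eta> y"
proof -
  have ne: "K \<noteq> {}" using y by auto
  let ?\<phi> = "ctrans c K \<psi> x"
  have y_min: "c x y - \<psi> y = ?\<phi>"
    using ctrans_attained[of K c x \<psi>, OF K ne c \<psi>] uniq by (metis order_refl)
  have cn: "continuous_on K (\<lambda>z. \<psi> z + \<eta> z / real (Suc n))" for n
    using \<psi> \<eta> by (intro continuous_intros) auto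
  have "bounded (\<eta> ` K)" using K \<eta> by (intro compact_imp_bounded compact_continuous_image)
  then obtain B where B: "B > 0" "\<And>z. z \<in> K \<Longrightarrow> \<bar>\<eta> z\<bar> \<le> B"
    by (force simp: bounded_pos)
  have scale: "a \<le> b / real (Suc n) \<longleftrightarrow> a * real (Suc n) \<le> b"
    and scale': "b / real (Suc n) \<le> a \<longleftrightarrow> b \<le> a * real (Suc n)" for a b :: real and n
    by (rule pos_le_divide_eq pos_divide_le_eq, simp)+
  have upper: "(ctrans c K (\<lambda>z. \<psi> z + \<eta> z / real (Suc n)) x - ?\<phi>) * real (Suc n) \<le> - \<eta> y" for n
  proof -
    have "ctrans c K (\<lambda>z. \<psi> z + \<eta> z / real (Suc n)) x \<le> c x y - (\<psi> y + \<eta> y / real (Suc n))"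
      using ctrans_le[of K c x, OF K c cn y] .
    then have "ctrans c K (\<lambda>z. \<psi> z + \<eta> z / real (Suc n)) x - ?\<phi> \<le> - \<eta> y / real (Suc n)"
      using y_min by simp
    then show ?thesis unfolding scale .
  qed
  have lower: "\<exists>N. \<forall>n\<ge>N. - \<eta> y - e < (ctrans c K (\<lambda>z. \<psi> z + \<eta> z / real (Suc n)) x - ?\<phi>) * real (Suc n)"
    if e: "e > 0" for e
  proof -
    define C where "C = {z \<in> K. \<eta> z \<in> {\<eta> y + e..}}"
    have "closedin (top_of_set K) C" unfolding C_def
      using continuous_closedin_preimage[OF \<eta>, of "{\<eta> y + e..}"]
      by (simp add: vimage_def Int_def)
    then have C: "compact C" "C \<subseteq> K" using K closedin_compact closedin_subset by (auto simp: C_def)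
    have "\<exists>\<delta>>0. \<forall>z\<in>C. c x z - \<psi> z \<ge> ?\<phi> + \<delta>"
    proof (cases "C = {}")
      case True then show ?thesis by (auto intro: exI[of _ 1])
    next
      case False
      obtain z where z: "z \<in> C" "\<And>w. w \<in> C \<Longrightarrow> c x z - \<psi> z \<le> c x w - \<psi> w"
        using ctrans_attained[of C c x \<psi>] C False c \<psi> continuous_on_subset by (metis (no_types, lifting))
      have "z \<noteq> y" using z(1) e by (auto simp: C_def)
      then have "c x z - \<psi> z > ?\<phi>" using uniq[of z] z C by force
      then show ?thesis using z by (intro exI[of _ "c x z - \<psi> z - ?\<phi>"]) auto
    qed
    then obtain \<delta> where \<delta>: "\<delta> > 0" "\<And>z. z \<in> C \<Longrightarrow> c x z - \<psi> z \<ge> ?\<phi> + \<delta>" by blast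
    \<comment> \<open>The perturbation shifts the values at \<open>y\<close> and at the new
      minimiser by at most \<open>B / Suc n\<close> each; together they must stay below the margin
      \<open>\<delta>\<close>.\<close>
    obtain N where N: "2 * B / \<delta> < real N" using reals_Archimedean2 by blast
    show ?thesis
    proof (intro exI allI impI)
      fix n assume "N \<le> n"
      then have n: "2 * B / real (Suc n) < \<delta>"
        using N \<delta>(1) by (simp add: field_simps) (smt (verit) mult_left_mono of_nat_mono)
      obtain z where z: "z \<in> K" "ctrans c K (\<lambda>z. \<psi> z + \<eta> z / real (Suc n)) x = c x z - (\<psi> z + \<eta> z / real (Suc n))"
        using ctrans_attained[of K c x, OF K ne c cn[of n]] by metis
      have 1: "ctrans c K (\<lambda>z. \<psi> z + \<eta> z / real (Suc n)) x - ?\<phi> \<le> - \<eta> y / real (Suc n)"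
        using upper[of n] unfolding scale .
      have 2: "- \<eta> y / real (Suc n) \<le> B / real (Suc n)" "\<eta> z / real (Suc n) \<le> B / real (Suc n)"
        using B(2)[OF y] B(2)[OF z(1)] by (rule_tac divide_right_mono, linarith, simp)+
      have "c x z - \<psi> z < ?\<phi> + \<delta>"
        using 1 2 n z(2) by simp
      then have "z \<notin> C" using \<delta>(2) by force
      then have zy: "\<eta> z < \<eta> y + e" using z(1) by (auto simp: C_def)
      have "?\<phi> \<le> c x z - \<psi> z" using ctrans_le[of K c x, OF K c \<psi> z(1)] .
      then have "- \<eta> z / real (Suc n) \<le> ctrans c K (\<lambda>z. \<psi> z + \<eta> z / real (Suc n)) x - ?\<phi>"
        using z(2) by simp
      then have "- \<eta> z \<le> (ctrans c K (\<lambda>z. \<psi> z + \<eta> z / real (Suc n)) x - ?\<phi>) * real (Suc n)"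
        unfolding scale' .
      with zy show "- \<eta> y - e < (ctrans c K (\<lambda>z. \<psi> z + \<eta> z / real (Suc n)) x - ?\<phi>) * real (Suc n)"
        by linarith
    qed
  qed
  show ?thesis
    unfolding LIMSEQ_def dist_real_def
  proof safe
    fix e :: real assume "e > 0"
    from lower[OF this] obtain N where
      "\<forall>n\<ge>N. - \<eta> y - e < (ctrans c K (\<lambda>z. \<psi> z + \<eta> z / real (Suc n)) x - ?\<phi>) * real (Suc n)" by blast
    with upper show "\<exists>no. \<forall>n\<ge>no. \<bar>(ctrans c K (\<lambda>z. \<psi> z + \<eta> z / real (Suc n)) x - ?\<phi>) * real (Suc n) - - \<eta> y\<bar> < e"
      using \<open>e > 0\<close> by (intro exI[of _ N]) (smt (verit))
  qed
qed

section \<open>Maximisers of the dual problem and the transport map they induce\<close>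

locale dual_transport =
  fixes c :: "'a::euclidean_space \<Rightarrow> 'a \<Rightarrow> real" and X K :: "'a set" and M N :: "'a measure"
  assumes cost_continuous: "continuous_on UNIV (\<lambda>(x, y). c x y)"
    and compact_X: "compact X" and compact_K: "compact K"
    and prob_M: "prob_space M" and prob_N: "prob_space N"
    and sets_M [measurable_cong]: "sets M = sets borel"
    and sets_N [measurable_cong]: "sets N = sets borel"
    and AE_X: "AE x in M. x \<in> X" and AE_K: "AE y in N. y \<in> K"
begin

sublocale M: prob_space M by (rule prob_M)
sublocale N: prob_space N by (rule prob_N)

lemma X_nonempty: "X \<noteq> {}"
  using AE_X M.AE_False by auto

lemma K_nonempty: "K \<noteq> {}"
  using AE_K N.AE_False by auto

lemma integrable_M: "continuous_on UNIV f \<Longrightarrow> integrable M (f :: 'a \<Rightarrow> real)"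
  by (intro integrable_continuous_on_compact[OF _ sets_M compact_X AE_X] M.finite_measure_axioms)

lemma integrable_N: "continuous_on UNIV f \<Longrightarrow> integrable N (f :: 'a \<Rightarrow> real)"
  by (intro integrable_continuous_on_compact[OF _ sets_N compact_K AE_K] N.finite_measure_axioms)

lemma cost_slices: "continuous_on S (c x)" "continuous_on S (\<lambda>x. c x y)"
  using continuous_on_slice[OF cost_continuous] by auto

lemma continuous_ctrans: "continuous_on K \<psi> \<Longrightarrow> continuous_on S (ctrans c K \<psi>)"
  by (rule continuous_on_ctrans[OF cost_continuous compact_K K_nonempty])

lemma continuous_ctrans': "continuous_on X \<phi> \<Longrightarrow> continuous_on S (ctrans (\<lambda>y x. c x y) X \<phi>)"
  by (rule continuous_on_ctrans[OF continuous_on_swap[OF cost_continuous] compact_X X_nonempty])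

text \<open>The constraint is imposed on the compact carriers, continuity on the whole space: this
  gives Borel measurability directly and boundedness where the measures live.\<close>

definition feasible :: "('a \<Rightarrow> real) \<Rightarrow> ('a \<Rightarrow> real) \<Rightarrow> bool" where
  "feasible \<phi> \<psi> \<longleftrightarrow> continuous_on UNIV \<phi> \<and> continuous_on UNIV \<psi> \<and> (\<forall>x\<in>X. \<forall>y\<in>K. \<phi> x + \<psi> y \<le> c x y)"

definition dual_value :: "('a \<Rightarrow> real) \<Rightarrow> ('a \<Rightarrow> real) \<Rightarrow> real" where
  "dual_value \<phi> \<psi> = (\<integral>x. \<phi> x \<partial>M) + (\<integral>y. \<psi> y \<partial>N)"

lemma feasible_ctrans:
  assumes "continuous_on UNIV \<psi>"
  shows "feasible (ctrans c K \<psi>) \<psi>"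
proof -
  have "continuous_on K \<psi>" using assms continuous_on_subset by blast
  then have le: "ctrans c K \<psi> x + \<psi> y \<le> c x y" if "y \<in> K" for x y
    using ctrans_le[of K c x \<psi> y] compact_K cost_slices that by simp
  have "continuous_on UNIV (ctrans c K \<psi>)"
    by (rule continuous_ctrans) fact
  with assms le show ?thesis by (simp add: feasible_def)
qed

text \<open>The additive constants occur in two ways: as \<open>- a n\<close> and
  \<open>a n\<close>, which cancel because both measures have mass 1, when a pair is normalised, and
  as equal errors in the passage to the limit.\<close>

lemma dual_value_mono:
  assumes "continuous_on UNIV \<phi>" "continuous_on UNIV \<psi>" "continuous_on UNIV \<phi>'" "continuous_on UNIV \<psi>'"
    and "\<And>x. x \<in> X \<Longrightarrow> \<phi> x \<le> \<phi>' x + a" "\<And>y. y \<in> K \<Longrightarrow> \<psi> y \<le> \<psi>' y + b"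
  shows "dual_value \<phi> \<psi> \<le> dual_value \<phi>' \<psi>' + a + b"
proof -
  have "(\<integral>x. \<phi> x \<partial>M) \<le> (\<integral>x. \<phi>' x + a \<partial>M)"
    using AE_X assms by (intro integral_mono_AE integrable_M continuous_intros) auto
  moreover have "(\<integral>x. \<psi> x \<partial>N) \<le> (\<integral>x. \<psi>' x + b \<partial>N)"
    using AE_K assms by (intro integral_mono_AE integrable_N continuous_intros) auto
  ultimately show ?thesis
    using integrable_M[OF assms(3)] integrable_N[OF assms(4)]
    by (simp add: dual_value_def M.prob_space N.prob_space)
qed

lemma cost_bounded: "\<exists>B>0. \<forall>x\<in>X. \<forall>y\<in>K. \<bar>c x y\<bar> \<le> B"
proof -
  have "compact ((\<lambda>(x, y). c x y) ` (X \<times> K))"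
    using continuous_on_subset[OF cost_continuous] compact_X compact_K
    by (intro compact_continuous_image compact_Times) auto
  then obtain B where "0 < B" "\<And>z. z \<in> (\<lambda>(x, y). c x y) ` (X \<times> K) \<Longrightarrow> norm z \<le> B"
    by (meson compact_imp_bounded bounded_pos)
  then show ?thesis by (intro exI[of _ B]) auto
qed

text \<open>\<open>\<phi> x + \<psi> y \<le> B\<close> is integrated first in \<open>x\<close>, then
  in \<open>y\<close>, so no measure on the product is involved.\<close>

lemma dual_value_bounded: "\<exists>B. \<forall>\<phi> \<psi>. feasible \<phi> \<psi> \<longrightarrow> dual_value \<phi> \<psi> \<le> B"
proof -
  obtain B where B: "0 < B" "\<And>x y. x \<in> X \<Longrightarrow> y \<in> K \<Longrightarrow> \<bar>c x y\<bar> \<le> B" using cost_bounded by blast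
  show ?thesis
  proof (intro exI[of _ B] allI impI)
    fix \<phi> \<psi> assume f: "feasible \<phi> \<psi>"
    then have cont: "continuous_on UNIV \<phi>" "continuous_on UNIV \<psi>" by (auto simp: feasible_def)
    have le: "\<phi> x + \<psi> y \<le> B" if "x \<in> X" "y \<in> K" for x y
      using f B(2)[OF that] that by (fastforce simp: feasible_def)
    have "(\<integral>x. \<phi> x \<partial>M) \<le> B - \<psi> y" if "y \<in> K" for y
    proof -
      have "(\<integral>x. \<phi> x \<partial>M) \<le> (\<integral>x. B - \<psi> y \<partial>M)"
        using AE_X cont le that by (intro integral_mono_AE integrable_M) (auto simp: algebra_simps)
      then show ?thesis by (simp add: M.prob_space)
    qed
    then have "(\<integral>y. \<psi> y \<partial>N) \<le> (\<integral>y. B - (\<integral>x. \<phi> x \<partial>M) \<partial>N)"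
      using AE_K cont by (intro integral_mono_AE integrable_N) (auto simp: algebra_simps)
    then show "dual_value \<phi> \<psi> \<le> B" by (simp add: dual_value_def N.prob_space)
  qed
qed

text \<open>Replacing a feasible pair by its double transform, normalised at a point, does not decrease the
  dual value and gives an equicontinuous family, so a maximising sequence has a uniform limit.\<close>
lemma dual_attained:
  "\<exists>\<psi>. continuous_on UNIV \<psi> \<and>
    (\<forall>\<phi>' \<psi>'. feasible \<phi>' \<psi>' \<longrightarrow> dual_value \<phi>' \<psi>' \<le> dual_value (ctrans c K \<psi>) \<psi>)"
proof -
  define V where "V = {dual_value \<phi> \<psi> | \<phi> \<psi>. feasible \<phi> \<psi>}"
  obtain B0 where "\<And>\<phi> \<psi>. feasible \<phi> \<psi> \<Longrightarrow> dual_value \<phi> \<psi> \<le> B0" using dual_value_bounded by blast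
  then have bdd: "bdd_above V" by (auto simp: V_def bdd_above_def)
  have "V \<noteq> {}" using feasible_ctrans[of "\<lambda>_. 0"] by (auto simp: V_def)
  have "\<exists>\<phi> \<psi>. feasible \<phi> \<psi> \<and> Sup V - 1 / real (Suc n) < dual_value \<phi> \<psi>" for n
  proof -
    have "Sup V - 1 / real (Suc n) < Sup V" by simp
    from less_cSupD[OF \<open>V \<noteq> {}\<close> this] show ?thesis by (auto simp: V_def)
  qed
  then obtain \<phi> \<psi> where feas: "\<And>n. feasible (\<phi> n) (\<psi> n)"
    and near: "\<And>n. Sup V - 1 / real (Suc n) < dual_value (\<phi> n) (\<psi> n)" by metis
  have cont: "continuous_on S (\<phi> n)" "continuous_on S (\<psi> n)" for n S
    using feas by (auto simp: feasible_def intro: continuous_on_subset)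
  obtain y0 where y0: "y0 \<in> K" using K_nonempty by auto
  define c' where "c' = (\<lambda>y x. c x y)"
  have c': "continuous_on UNIV (\<lambda>(y, x). c' y x)"
    unfolding c'_def by (rule continuous_on_swap[OF cost_continuous])
  define a where "a n = ctrans c' X (\<phi> n) y0" for n
  define \<psi>' where "\<psi>' n y = ctrans c' X (\<phi> n) y - a n" for n y
  define \<phi>' where "\<phi>' n = ctrans c K (\<psi>' n)" for n
  have cont': "continuous_on S (\<psi>' n)" for n S
    unfolding \<psi>'_def c'_def by (intro continuous_intros continuous_ctrans' cont)
  have cont'': "continuous_on S (\<phi>' n)" for n S
    unfolding \<phi>'_def by (intro continuous_ctrans cont')
  obtain B where B: "0 < B" "\<And>x y. x \<in> X \<Longrightarrow> y \<in> K \<Longrightarrow> \<bar>c x y\<bar> \<le> B" using cost_bounded by blast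
  have bound: "norm (\<psi>' n y) \<le> 2 * B" if "y \<in> K" for n y
  proof -
    have "\<bar>(c' y x - \<phi> n x) - (c' y0 x - \<phi> n x)\<bar> \<le> 2 * B" if "x \<in> X" for x
      using B(2)[OF that \<open>y \<in> K\<close>] B(2)[OF that y0] by (simp add: c'_def)
    then show ?thesis
      unfolding \<psi>'_def a_def real_norm_def using compact_X X_nonempty cont continuous_on_slice[OF c']
      by (intro abs_ctrans_diff_le) auto
  qed
  have equi: "\<exists>d>0. \<forall>n z. z \<in> K \<and> norm (y - z) < d \<longrightarrow> norm (\<psi>' n y - \<psi>' n z) < e" if "0 < e" for y e
  proof -
    have "0 < e / 2" using that by simp
    from ctrans_equicontinuous[OF c' compact_X X_nonempty this, of y] obtain d where d: "0 < d"
      "\<And>\<phi> z. continuous_on X \<phi> \<Longrightarrow> dist z y < d \<Longrightarrow> \<bar>ctrans c' X \<phi> z - ctrans c' X \<phi> y\<bar> \<le> e / 2" by metis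
    have "norm (\<psi>' n y - \<psi>' n z) < e" if "norm (y - z) < d" for n z
    proof -
      have "\<bar>ctrans c' X (\<phi> n) z - ctrans c' X (\<phi> n) y\<bar> \<le> e / 2"
        using that by (intro d(2) cont) (simp add: dist_norm norm_minus_commute)
      then show ?thesis unfolding \<psi>'_def real_norm_def using \<open>0 < e\<close> by linarith
    qed
    with d(1) show ?thesis by blast
  qed
  obtain g k where g: "continuous_on K g" "strict_mono (k :: nat \<Rightarrow> nat)"
    and conv: "\<And>e. 0 < e \<Longrightarrow> \<exists>n0. \<forall>n x. n \<ge> n0 \<and> x \<in> K \<longrightarrow> norm (\<psi>' (k n) x - g x) < e"
    using Arzela_Ascoli[of K \<psi>' "2 * B"] compact_K bound equi by blast
  \<comment> \<open>The uniform limit \<open>g\<close> is only known to be continuous on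
    \<open>K\<close>. Its double transform \<open>\<psi>g\<close> is continuous everywhere, is at
    least \<open>g\<close> on \<open>K\<close>, and loses nothing in the first potential by
    \<open>\<phi>g_le\<close>.\<close>
  define \<phi>g where "\<phi>g = ctrans c K g"
  define \<psi>g where "\<psi>g = ctrans c' X \<phi>g"
  have cont_g: "continuous_on S \<phi>g" for S
    unfolding \<phi>g_def by (intro continuous_ctrans g)
  have cont_g': "continuous_on S \<psi>g" for S
    unfolding \<psi>g_def c'_def by (intro continuous_ctrans' cont_g)
  have g_le: "g y \<le> \<psi>g y" if "y \<in> K" for y
    unfolding \<psi>g_def
  proof (rule ctrans_greatest[OF X_nonempty])
    fix x assume "x \<in> X"
    have "\<phi>g x \<le> c x y - g y" unfolding \<phi>g_def
      using ctrans_le[of K c x g y] compact_K cost_slices g that by auto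
    then show "g y \<le> c' y x - \<phi>g x" by (simp add: c'_def)
  qed
  have \<phi>g_le: "\<phi>g x \<le> ctrans c K \<psi>g x" if "x \<in> X" for x
  proof (rule ctrans_greatest[OF K_nonempty])
    fix y assume "y \<in> K"
    have "\<psi>g y \<le> c' y x - \<phi>g x" unfolding \<psi>g_def
      using ctrans_le[of X c' y \<phi>g x] compact_X cont_g that continuous_on_slice[OF c'] by auto
    then show "\<phi>g x \<le> c x y - \<psi>g y" by (simp add: c'_def)
  qed
  have improve: "dual_value (\<phi> n) (\<psi> n) \<le> dual_value (\<phi>' n) (\<psi>' n)" for n
  proof -
    have "\<phi> n x \<le> \<phi>' n x + (- a n)" if "x \<in> X" for x
    proof -
      have "\<phi> n x + a n \<le> \<phi>' n x" unfolding \<phi>'_def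
      proof (rule ctrans_greatest[OF K_nonempty])
        fix y assume "y \<in> K"
        have "ctrans c' X (\<phi> n) y \<le> c' y x - \<phi> n x"
          using ctrans_le[of X c' y "\<phi> n" x] compact_X cont that continuous_on_slice[OF c'] by auto
        then show "\<phi> n x + a n \<le> c x y - \<psi>' n y" by (simp add: c'_def \<psi>'_def)
      qed
      then show ?thesis by simp
    qed
    moreover have "\<psi> n y \<le> \<psi>' n y + a n" if "y \<in> K" for y
    proof -
      have "\<psi> n y \<le> ctrans c' X (\<phi> n) y"
        using feas[of n] that unfolding feasible_def
        by (intro ctrans_greatest[OF X_nonempty]) (force simp: c'_def)
      then show ?thesis by (simp add: \<psi>'_def)
    qed
    ultimately have "dual_value (\<phi> n) (\<psi> n) \<le> dual_value (\<phi>' n) (\<psi>' n) + (- a n) + a n"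
      by (intro dual_value_mono cont cont' cont'')
    then show ?thesis by simp
  qed
  have "Sup V \<le> dual_value (ctrans c K \<psi>g) \<psi>g"
  proof (rule field_le_epsilon)
    fix e :: real assume "e > 0"
    \<comment> \<open>One third for near-maximality of the pair, one for each of the two
      potentials.\<close>
    then have "e / 3 > 0" by simp
    from conv[OF this] obtain n0 where n0: "\<And>n x. n \<ge> n0 \<Longrightarrow> x \<in> K \<Longrightarrow> norm (\<psi>' (k n) x - g x) < e / 3" by blast
    obtain n1 where n1: "1 / real (Suc n1) < e / 3" using \<open>e / 3 > 0\<close> by (rule nat_approx_posE)
    define n where "n = max n0 n1"
    define m where "m = k n"
    have close: "\<bar>\<psi>' m x - g x\<bar> \<le> e / 3" if "x \<in> K" for x
      using n0[of n x] that by (simp add: n_def m_def)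
    have "m \<ge> n1" using seq_suble[OF g(2), of n] by (simp add: n_def m_def)
    then have "1 / real (Suc m) \<le> 1 / real (Suc n1)" by (simp add: frac_le)
    then have "Sup V - e / 3 \<le> dual_value (\<phi> m) (\<psi> m)" using near[of m] n1 by linarith
    also have "\<dots> \<le> dual_value (\<phi>' m) (\<psi>' m)" by (rule improve)
    also have "\<dots> \<le> dual_value (ctrans c K \<psi>g) \<psi>g + e / 3 + e / 3"
    proof (intro dual_value_mono cont' cont'' continuous_ctrans cont_g')
      fix x assume "x \<in> X"
      have "\<bar>\<phi>' m x - \<phi>g x\<bar> \<le> e / 3"
        unfolding \<phi>'_def \<phi>g_def using compact_K K_nonempty cost_slices cont' g close
        by (intro abs_ctrans_diff_le) (auto simp: abs_minus_commute)
      with \<phi>g_le[OF \<open>x \<in> X\<close>] show "\<phi>' m x \<le> ctrans c K \<psi>g x + e / 3" by linarith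
    next
      fix y assume "y \<in> K"
      with close[of y] g_le[of y] show "\<psi>' m y \<le> \<psi>g y + e / 3" by linarith
    qed
    finally show "Sup V \<le> dual_value (ctrans c K \<psi>g) \<psi>g + e" by simp
  qed
  moreover have "dual_value \<phi>' \<psi>' \<le> Sup V" if "feasible \<phi>' \<psi>'" for \<phi>' \<psi>'
    using that bdd by (intro cSup_upper) (auto simp: V_def)
  ultimately show ?thesis using cont_g' by (intro exI[of _ \<psi>g]) (auto intro: order_trans)
qed

text \<open>The extended cost \<open>C\<close> is tied to \<open>c\<close> on \<open>X\<close> times
  \<open>K\<close> only. This controls every competitor, since a transport map sends almost every
  point into \<open>K\<close>.\<close>

lemma monge_of_unique_minimizer:
  fixes C :: "'a \<Rightarrow> 'a \<Rightarrow> ennreal"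
  assumes cost: "\<And>x y. x \<in> X \<Longrightarrow> y \<in> K \<Longrightarrow> C x y = ennreal (c x y)"
    and nonneg: "\<And>x y. x \<in> X \<Longrightarrow> y \<in> K \<Longrightarrow> 0 \<le> c x y"
    and \<psi>: "continuous_on UNIV \<psi>"
    and opt: "\<And>\<phi>' \<psi>'. feasible \<phi>' \<psi>' \<Longrightarrow> dual_value \<phi>' \<psi>' \<le> dual_value (ctrans c K \<psi>) \<psi>"
    and uniq: "AE x in M. \<forall>y\<in>K. \<forall>z\<in>K. c x y - \<psi> y \<le> ctrans c K \<psi> x \<longrightarrow> c x z - \<psi> z \<le> ctrans c K \<psi> x \<longrightarrow> y = z"
  shows "\<exists>T. monge_solution C M N T"
    and "monge_solution C M N T1 \<Longrightarrow> monge_solution C M N T2 \<Longrightarrow> AE x in M. T1 x = T2 x"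
proof -
  have \<psi>K: "continuous_on K \<psi>" using \<psi> continuous_on_subset by blast
  define \<phi> where "\<phi> = ctrans c K \<psi>"
  have \<phi>: "continuous_on UNIV \<phi>" unfolding \<phi>_def by (rule continuous_ctrans[OF \<psi>K])
  have \<phi>_le: "\<phi> x \<le> c x y - \<psi> y" if "y \<in> K" for x y
    unfolding \<phi>_def using ctrans_le[of K c x \<psi> y] compact_K cost_slices \<psi>K that by auto
  define unique where "unique x \<longleftrightarrow>
    (\<forall>y\<in>K. \<forall>z\<in>K. c x y - \<psi> y \<le> \<phi> x \<longrightarrow> c x z - \<psi> z \<le> \<phi> x \<longrightarrow> y = z)" for x
  have "AE x in M. unique x" using uniq by (simp add: unique_def \<phi>_def)
  then obtain Z where Z0: "{x \<in> space M. \<not> unique x} \<subseteq> Z" "emeasure M Z = 0" "Z \<in> sets M"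
    by (rule AE_E)
  then have Z: "Z \<in> null_sets M" by auto
  have uniq': "y = z" if "x \<notin> Z" "y \<in> K" "z \<in> K" "c x y - \<psi> y \<le> \<phi> x" "c x z - \<psi> z \<le> \<phi> x" for x y z
  proof -
    have "unique x" using Z0(1) that(1) sets_eq_imp_space_eq[OF sets_M] by auto
    with that show ?thesis by (simp add: unique_def)
  qed
  have Z_sets [measurable]: "Z \<in> sets borel" using Z sets_M by auto
  have AE_Z: "AE x in M. x \<notin> Z" using Z by (rule AE_not_in)
  obtain y0 where y0: "y0 \<in> K" using K_nonempty by auto
  \<comment> \<open>The default \<open>y0\<close> keeps \<open>T\<close> inside \<open>K\<close>
    also on the null set \<open>Z\<close>.\<close>
  define T where "T x = (if x \<in> Z then y0 else (SOME y. y \<in> K \<and> c x y - \<psi> y \<le> \<phi> x))" for x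
  have T: "T x \<in> K \<and> c x (T x) - \<psi> (T x) \<le> \<phi> x" if "x \<notin> Z" for x
  proof -
    obtain y where "y \<in> K" "\<phi> x = c x y - \<psi> y"
      unfolding \<phi>_def using ctrans_attained[of K c x \<psi>, OF compact_K K_nonempty cost_slices(1) \<psi>K] by blast
    then have "\<exists>y. y \<in> K \<and> c x y - \<psi> y \<le> \<phi> x" by auto
    from someI_ex[OF this] that show ?thesis by (simp add: T_def)
  qed
  have T_K: "T x \<in> K" for x using T[of x] y0 by (cases "x \<in> Z") (auto simp: T_def)
  \<comment> \<open>Difference quotients of the first variation. They serve twice: for coordinate
    functions \<open>\<eta>\<close> they show that \<open>T\<close> is measurable, for bounded
    \<open>\<eta>\<close> they identify its image measure.\<close>
  define D where "D \<eta> n x = (ctrans c K (\<lambda>z. \<psi> z + \<eta> z / real (Suc n)) x - \<phi> x) * real (Suc n)"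
    for \<eta> :: "'a \<Rightarrow> real" and n x
  have D_lim: "(\<lambda>n. D \<eta> n x) \<longlonglongrightarrow> - \<eta> (T x)" if "continuous_on UNIV \<eta>" "x \<notin> Z" for \<eta> :: "'a \<Rightarrow> real" and x
    unfolding D_def \<phi>_def
  proof (rule ctrans_variation[OF compact_K])
    show "continuous_on K \<eta>" using that continuous_on_subset by blast
    show "z = T x" if "z \<in> K" "c x z - \<psi> z \<le> ctrans c K \<psi> x" for z
      using uniq'[OF \<open>x \<notin> Z\<close> that(1) T_K] that T[OF \<open>x \<notin> Z\<close>] by (simp add: \<phi>_def)
  qed (use cost_slices \<psi>K T_K in auto)
  have cont_\<eta>: "continuous_on S (\<lambda>z. \<psi> z + \<eta> z / real (Suc n))" if "continuous_on UNIV \<eta>" for \<eta> :: "'a \<Rightarrow> real" and n S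
    using that \<psi> by (intro continuous_intros) (auto intro: continuous_on_subset)
  have D_cont: "continuous_on UNIV (D \<eta> n)" if "continuous_on UNIV \<eta>" for \<eta> :: "'a \<Rightarrow> real" and n
    unfolding D_def using that by (intro continuous_intros continuous_ctrans \<phi> cont_\<eta>)
  \<comment> \<open>\<open>T\<close> is picked by \<open>SOME\<close>, so its measurability is not
    evident. Off \<open>Z\<close>, however, \<open>T x \<bullet> b\<close> is the limit of the
    continuous functions \<open>- D (\<lambda>y. y \<bullet> b) n\<close>.\<close>
  have T_meas: "T \<in> borel_measurable borel"
    unfolding borel_measurable_euclidean_space[of T]
  proof
    fix b :: 'a assume "b \<in> Basis"
    have cont_b: "continuous_on UNIV (\<lambda>y. y \<bullet> b)" by (intro continuous_intros)
    note [measurable] = borel_measurable_continuous_onI[OF D_cont[OF cont_b]]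
    show "(\<lambda>x. T x \<bullet> b) \<in> borel_measurable borel"
    proof (rule borel_measurable_LIMSEQ_real)
      show "(\<lambda>n. if x \<in> Z then y0 \<bullet> b else - D (\<lambda>y. y \<bullet> b) n x) \<longlonglongrightarrow> T x \<bullet> b" for x
        using tendsto_minus[OF D_lim[OF cont_b, of x]] by (cases "x \<in> Z") (auto simp: T_def)
    qed measurable
  qed
  note [measurable] = T_meas
  \<comment> \<open>Maximality of \<open>\<psi>\<close> bounds the integrated difference quotients
    for every \<open>n\<close>, and dominated convergence keeps the inequality. Applied to
    \<open>\<eta>\<close> and to \<open>- \<eta>\<close>, it becomes equality.\<close>
  have half: "(\<integral>y. \<eta> y \<partial>N) \<le> (\<integral>x. \<eta> (T x) \<partial>M)"
    if \<eta>: "continuous_on UNIV \<eta>" and bd: "\<And>y. \<bar>\<eta> y\<bar> \<le> 1" for \<eta> :: "'a \<Rightarrow> real"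
  proof -
    have \<eta>_meas [measurable]: "\<eta> \<in> borel_measurable borel" using \<eta> by (rule borel_measurable_continuous_onI)
    have D_bd: "\<bar>D \<eta> n x\<bar> \<le> 1" for n x
    proof -
      have "\<bar>ctrans c K (\<lambda>z. \<psi> z + \<eta> z / real (Suc n)) x - \<phi> x\<bar> \<le> 1 / real (Suc n)"
        unfolding \<phi>_def using compact_K K_nonempty cost_slices \<psi>K cont_\<eta>[OF \<eta>] bd
        by (intro abs_ctrans_diff_le) (auto intro!: divide_right_mono)
      then have "\<bar>ctrans c K (\<lambda>z. \<psi> z + \<eta> z / real (Suc n)) x - \<phi> x\<bar> * real (Suc n) \<le> 1"
        by (subst (asm) pos_le_divide_eq) simp_all
      then show ?thesis unfolding D_def abs_mult abs_of_nat .
    qed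
    note [measurable] = borel_measurable_continuous_onI[OF D_cont[OF \<eta>]]
    have "(\<lambda>n. \<integral>x. D \<eta> n x \<partial>M) \<longlonglongrightarrow> (\<integral>x. - \<eta> (T x) \<partial>M)"
      using AE_Z D_lim[OF \<eta>] D_bd
      by (intro integral_dominated_convergence[where w="\<lambda>_. 1"]) auto
    moreover have "(\<integral>x. D \<eta> n x \<partial>M) \<le> - (\<integral>y. \<eta> y \<partial>N)" for n
    proof -
      let ?\<psi> = "\<lambda>z. \<psi> z + \<eta> z / real (Suc n)"
      have int: "integrable M (ctrans c K ?\<psi>)" "integrable M \<phi>" "integrable N \<psi>" "integrable N \<eta>"
        by (intro integrable_M integrable_N continuous_ctrans cont_\<eta> \<eta> \<phi> \<psi>)+
      have "dual_value (ctrans c K ?\<psi>) ?\<psi> \<le> dual_value \<phi> \<psi>"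
        unfolding \<phi>_def by (intro opt feasible_ctrans cont_\<eta> \<eta>)
      then have "(\<integral>x. ctrans c K ?\<psi> x \<partial>M) - (\<integral>x. \<phi> x \<partial>M) \<le> - (\<integral>y. \<eta> y \<partial>N) / real (Suc n)"
        using int by (simp add: dual_value_def)
      then have "((\<integral>x. ctrans c K ?\<psi> x \<partial>M) - (\<integral>x. \<phi> x \<partial>M)) * real (Suc n) \<le> - (\<integral>y. \<eta> y \<partial>N)"
        by (subst (asm) pos_le_divide_eq) simp_all
      then show ?thesis unfolding D_def using int by simp
    qed
    ultimately have "(\<integral>x. - \<eta> (T x) \<partial>M) \<le> - (\<integral>y. \<eta> y \<partial>N)"
      by (intro LIMSEQ_le_const2) auto
    then show ?thesis by simp
  qed
  have push: "distr M borel T = N"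
  proof (rule prob_eqI_bounded_continuous)
    fix f :: "'a \<Rightarrow> real" assume f: "continuous_on UNIV f" "\<And>x. \<bar>f x\<bar> \<le> 1"
    have [measurable]: "f \<in> borel_measurable borel" using f(1) by (rule borel_measurable_continuous_onI)
    have "(\<integral>x. f (T x) \<partial>M) = (\<integral>y. f y \<partial>N)"
      using half[OF f] half[OF continuous_on_minus[OF f(1)]] f(2) by simp
    then show "(\<integral>x. f x \<partial>distr M borel T) = (\<integral>x. f x \<partial>N)"
      by (subst integral_distr) auto
  qed (use prob_N sets_N in \<open>auto intro!: M.prob_space_distr\<close>)
  have T_map: "T \<in> transport_maps M N" using push by (simp add: transport_maps_def)
  define V where "V = dual_value \<phi> \<psi>"
  have AE_S: "AE x in M. S x \<in> K" if "S \<in> transport_maps M N" for S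
  proof -
    have S [measurable]: "S \<in> borel_measurable borel" "distr M borel S = N"
      using that by (auto simp: transport_maps_def)
    have "closed K" using compact_K compact_imp_closed by blast
    then show ?thesis using AE_K unfolding S(2)[symmetric] by (subst (asm) AE_distr_iff) auto
  qed
  have cost_int: "monge_cost C M S = ennreal (\<integral>x. c x (S x) \<partial>M)"
    and value_ge: "V \<le> (\<integral>x. c x (S x) \<partial>M)"
    and value_eq: "(\<integral>x. c x (S x) \<partial>M) = V \<Longrightarrow> AE x in M. S x = T x"
    and value_T: "(AE x in M. S x = T x) \<Longrightarrow> (\<integral>x. c x (S x) \<partial>M) = V"
    if S_map: "S \<in> transport_maps M N" for S
  proof -
    have S [measurable]: "S \<in> borel_measurable borel" and pushS: "distr M borel S = N"
      using S_map by (auto simp: transport_maps_def)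
    note AE_SK = AE_S[OF S_map]
    have [measurable]: "(\<lambda>x. c x (S x)) \<in> borel_measurable borel"
      using borel_measurable_continuous_Pair[of "\<lambda>x. x" borel S c] cost_continuous by (simp add: case_prod_unfold)
    obtain B where B: "0 < B" "\<And>x y. x \<in> X \<Longrightarrow> y \<in> K \<Longrightarrow> \<bar>c x y\<bar> \<le> B" using cost_bounded by blast
    have int: "integrable M (\<lambda>x. c x (S x))"
      using AE_X AE_SK B by (intro M.integrable_const_bound[where B=B]) auto
    have "monge_cost C M S = (\<integral>\<^sup>+x. ennreal (c x (S x)) \<partial>M)"
      unfolding monge_cost_def using AE_X AE_SK cost by (intro nn_integral_cong_AE) auto
    also have "\<dots> = ennreal (\<integral>x. c x (S x) \<partial>M)"
      using AE_X AE_SK nonneg int by (intro nn_integral_eq_integral) auto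
    finally show "monge_cost C M S = ennreal (\<integral>x. c x (S x) \<partial>M)" .
    have [measurable]: "\<psi> \<in> borel_measurable borel" "\<phi> \<in> borel_measurable borel"
      using \<psi> \<phi> by (auto intro: borel_measurable_continuous_onI)
    have int\<psi>: "integrable M (\<lambda>x. \<psi> (S x))"
      using integrable_N[OF \<psi>] unfolding pushS[symmetric] by (subst (asm) integrable_distr_eq) auto
    have int\<phi>: "integrable M \<phi>" using \<phi> by (rule integrable_M)
    have V: "V = (\<integral>x. \<phi> x + \<psi> (S x) \<partial>M)"
    proof -
      have "(\<integral>y. \<psi> y \<partial>N) = (\<integral>x. \<psi> (S x) \<partial>M)"
        unfolding pushS[symmetric] by (rule integral_distr) auto
      then show ?thesis using int\<phi> int\<psi> by (simp add: V_def dual_value_def)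
    qed
    have gap: "AE x in M. 0 \<le> c x (S x) - (\<phi> x + \<psi> (S x))"
      using AE_SK
    proof eventually_elim
      case (elim x)
      from \<phi>_le[OF elim, of x] show ?case by simp
    qed
    \<comment> \<open>For every transport map the integral of the nonnegative gap is its cost minus
      \<open>V\<close>, so cost \<open>V\<close> means that the gap vanishes almost
      everywhere.\<close>
    have gap_int: "(\<integral>x. c x (S x) - (\<phi> x + \<psi> (S x)) \<partial>M) = (\<integral>x. c x (S x) \<partial>M) - V"
      using int int\<phi> int\<psi> by (simp add: V)
    show "V \<le> (\<integral>x. c x (S x) \<partial>M)"
      using integral_nonneg_AE[OF gap] gap_int by simp
    show "AE x in M. S x = T x" if "(\<integral>x. c x (S x) \<partial>M) = V"
    proof -
      have "AE x in M. c x (S x) - (\<phi> x + \<psi> (S x)) = 0"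
        using integral_nonneg_eq_0_iff_AE[OF _ gap] gap_int that int int\<phi> int\<psi> by auto
      then show ?thesis using AE_SK AE_Z
      proof eventually_elim
        case (elim x)
        then show ?case using uniq'[of x "S x" "T x"] T[of x] by auto
      qed
    qed
    show "(\<integral>x. c x (S x) \<partial>M) = V" if eq: "AE x in M. S x = T x"
    proof -
      have "AE x in M. c x (S x) = \<phi> x + \<psi> (S x)"
        using eq AE_Z
      proof eventually_elim
        case (elim x)
        with T[of x] \<phi>_le[OF T_K, of x x] show ?case by auto
      qed
      then show ?thesis unfolding V by (intro integral_cong_AE) auto
    qed
  qed
  have cost_T: "monge_cost C M T = ennreal V" using cost_int[OF T_map] value_T[OF T_map] by simp
  have inf: "(INF S\<in>transport_maps M N. monge_cost C M S) = ennreal V"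
  proof (rule antisym)
    show "(INF S\<in>transport_maps M N. monge_cost C M S) \<le> ennreal V"
      using cost_T T_map by (metis INF_lower)
    show "ennreal V \<le> (INF S\<in>transport_maps M N. monge_cost C M S)"
      using cost_int value_ge by (auto intro!: INF_greatest ennreal_leI)
  qed
  show "\<exists>T. monge_solution C M N T"
    using T_map cost_T inf by (auto simp: monge_solution_def)
  \<comment> \<open>\<open>ennreal\<close> sends all negative reals to 0; equal values determine
    equal reals only when both are nonnegative.\<close>
  have V_nonneg: "0 \<le> V"
  proof -
    have "0 \<le> (\<integral>x. c x (T x) \<partial>M)"
      using AE_X T_K nonneg by (intro integral_nonneg_AE) auto
    then show ?thesis using value_T[OF T_map] by simp
  qed
  have sol_eq: "AE x in M. S x = T x" if "monge_solution C M N S" for S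
  proof -
    have S: "S \<in> transport_maps M N" "monge_cost C M S = ennreal V"
      using that inf by (auto simp: monge_solution_def)
    have "(\<integral>x. c x (S x) \<partial>M) = V"
      using S(2) cost_int[OF S(1)] value_ge[OF S(1)] V_nonneg by (simp add: ennreal_inj)
    then show ?thesis by (rule value_eq[OF S(1)])
  qed
  show "AE x in M. T1 x = T2 x" if "monge_solution C M N T1" "monge_solution C M N T2"
    using sol_eq[OF that(1)] sol_eq[OF that(2)] by eventually_elim simp
qed

end

section \<open>Uniqueness of minimizers\<close>

text \<open>The translates of a bounded part of \<open>S\<close> by \<open>1 / Suc k\<close> are
  disjoint, have equal mass and lie in one ball of finite mass, so this mass is 0. The differences
  of these shifts are rational; asking disjointness only for rational shifts allows \<open>S\<close>
  to be a countable intersection, hence Borel.\<close>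

lemma null_of_disjoint_translates:
  fixes \<kappa> :: "'a::real_normed_vector measure"
  assumes sets: "sets \<kappa> = sets borel"
    and fin: "\<And>r. emeasure \<kappa> (cball 0 r) < \<infinity>"
    and trans: "\<And>s A. A \<in> sets borel \<Longrightarrow> emeasure \<kappa> ((\<lambda>x. x + s *\<^sub>R v) -` A) = emeasure \<kappa> A"
    and S: "S \<in> sets borel"
    and disj: "\<And>x s. x \<in> S \<Longrightarrow> s \<in> \<rat> \<Longrightarrow> 0 < s \<Longrightarrow> s \<le> 1 \<Longrightarrow> x + s *\<^sub>R v \<notin> S"
  shows "S \<in> null_sets \<kappa>"
proof -
  have "S \<inter> cball 0 (real n) \<in> null_sets \<kappa>" for n
  proof -
    define A where "A = S \<inter> cball 0 (real n)"
    have A: "A \<in> sets borel" using S by (simp add: A_def)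
    define s where "s k = 1 / real (Suc k)" for k
    have s: "s k \<in> \<rat>" "0 < s k" "s k \<le> 1" "inj s" for k
      by (auto simp: s_def inj_def)
    define D where "D k = (\<lambda>x. x + s k *\<^sub>R v) -` A" for k
    have [measurable]: "(\<lambda>x::'a. x + a) \<in> borel_measurable borel" for a
      by (intro borel_measurable_continuous_onI continuous_intros)
    have D: "D k \<in> sets borel" for k
      using measurable_sets_borel[OF _ A, of "\<lambda>x. x + s k *\<^sub>R v"] by (simp add: D_def)
    have "disjoint_family D"
    proof -
      have "False" if "x \<in> D j" "x \<in> D k" "s j < s k" for x j k
      proof -
        have eq: "x + s j *\<^sub>R v + (s k - s j) *\<^sub>R v = x + s k *\<^sub>R v" by (simp add: algebra_simps)
        have mem: "x + s j *\<^sub>R v \<in> S" "x + s k *\<^sub>R v \<in> S" using that by (auto simp: D_def A_def)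
        have "s k - s j \<in> \<rat>" "0 < s k - s j" "s k - s j \<le> 1"
          using s(1)[of j] s(1)[of k] s(2)[of j] s(3)[of k] that(3) by auto
        from disj[OF mem(1) this] mem(2) show False unfolding eq by contradiction
      qed
      then have "D j \<inter> D k = {}" if "j \<noteq> k" for j k
        using injD[OF s(4), of j k] that by (cases "s j" "s k" rule: linorder_cases) blast+
      then show ?thesis by (simp add: disjoint_family_on_def)
    qed
    have "emeasure \<kappa> (\<Union>k. D k) \<le> emeasure \<kappa> (cball 0 (real n + norm v))"
    proof (rule emeasure_mono)
      show "(\<Union>k. D k) \<subseteq> cball 0 (real n + norm v)"
      proof
        fix x assume "x \<in> (\<Union>k. D k)"
        then obtain k where "norm (x + s k *\<^sub>R v) \<le> real n" by (auto simp: D_def A_def)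
        moreover have "norm (s k *\<^sub>R v) \<le> norm v" using s(2,3)[of k] by (simp add: mult_left_le_one_le)
        moreover have "norm x \<le> norm (x + s k *\<^sub>R v) + norm (s k *\<^sub>R v)"
          by (metis add_diff_cancel_right' norm_triangle_ineq4)
        ultimately show "x \<in> cball 0 (real n + norm v)" by simp
      qed
    qed (simp add: sets)
    then have "(\<Sum>k. emeasure \<kappa> (D k)) < \<infinity>"
      using suminf_emeasure[of D \<kappa>] D \<open>disjoint_family D\<close> fin sets by (metis image_subsetI le_less_trans)
    then have lt: "(\<Sum>k::nat. emeasure \<kappa> A) < \<infinity>" using trans[OF A] by (simp add: D_def)
    have "emeasure \<kappa> A = 0"
    proof (rule ccontr)
      assume ne: "emeasure \<kappa> A \<noteq> 0"
      have "emeasure \<kappa> A \<le> emeasure \<kappa> (cball 0 (real n))"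
        by (rule emeasure_mono) (auto simp: A_def sets)
      then have "emeasure \<kappa> A < \<infinity>" using fin le_less_trans by blast
      then obtain a where a: "emeasure \<kappa> A = ennreal a" "a > 0"
        using ne by (cases "emeasure \<kappa> A") (auto simp: less_le)
      then have "summable (\<lambda>k::nat. a)"
        using lt by (intro summable_suminf_not_top) auto
      then have "(\<lambda>k::nat. a) \<longlonglongrightarrow> 0" by (rule summable_LIMSEQ_zero)
      then show False using a(2) by (simp add: LIMSEQ_const_iff)
    qed
    then show ?thesis using A sets by (auto simp: A_def null_sets_def)
  qed
  then have "(\<Union>n. S \<inter> cball 0 (real n)) \<in> null_sets \<kappa>" by (intro null_sets_UN) auto
  moreover have "(\<Union>n. S \<inter> cball 0 (real n)) = S" using real_arch_simple by auto
  ultimately show ?thesis by simp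
qed

text \<open>If \<open>y \<noteq> z\<close> both minimise, then along the direction \<open>(z - y) / 2\<close> the transform lies below a
  function with a strict concave kink at \<open>x\<close>. The kink is stable under perturbation of the direction and of a
  separating slope, so both may be taken from countable sets; and a set of points with such a kink for one
  fixed direction and slope is disjoint from its small translates along that direction.\<close>
lemma unique_minimizer_off_null_set:
  fixes E K :: "'a::euclidean_space set" and H \<psi> :: "'a \<Rightarrow> real"
  assumes E: "subspace E"
    and sets: "sets \<kappa> = sets borel"
    and fin: "\<And>r. emeasure \<kappa> (cball 0 r) < \<infinity>"
    and trans: "\<And>e A. e \<in> E \<Longrightarrow> A \<in> sets borel \<Longrightarrow> emeasure \<kappa> ((\<lambda>x. x + e) -` A) = emeasure \<kappa> A"
    and H: "continuous_on UNIV H" "convex_on E H"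
    and strict: "\<And>x y. x \<in> E \<Longrightarrow> y \<in> E \<Longrightarrow> x \<noteq> y \<Longrightarrow> H ((1/2) *\<^sub>R (x + y)) < (H x + H y) / 2"
    and K: "compact K" "K \<subseteq> E" and \<psi>: "continuous_on K \<psi>"
  shows "\<exists>Z\<in>null_sets \<kappa>. \<forall>x\<in>E - Z. \<forall>y\<in>K. \<forall>z\<in>K.
    H (y - x) - \<psi> y \<le> ctrans (\<lambda>x y. H (y - x)) K \<psi> x \<longrightarrow>
    H (z - x) - \<psi> z \<le> ctrans (\<lambda>x y. H (y - x)) K \<psi> x \<longrightarrow> y = z"
proof (cases "K = {}")
  case True
  then show ?thesis by (intro bexI[of _ "{}"]) auto
next
  case False
  define c where "c = (\<lambda>x y. H (y - x))"
  define \<phi> where "\<phi> = ctrans c K \<psi>"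
  have c: "continuous_on UNIV (\<lambda>(x, y). c x y)"
    unfolding c_def case_prod_unfold
    by (rule continuous_on_compose2[OF H(1)]) (auto intro!: continuous_intros)
  have \<phi>: "continuous_on S \<phi>" for S
    unfolding \<phi>_def by (rule continuous_on_ctrans[OF c K(1) False \<psi>])
  have \<phi>_le: "\<phi> x \<le> H (y - x) - \<psi> y" if "y \<in> K" for x y
    unfolding \<phi>_def using ctrans_le[of K c x \<psi> y] K \<psi> continuous_on_slice(1)[OF c] that by (simp add: c_def)
  obtain D where D: "countable D" "D \<subseteq> E" "E \<subseteq> closure D" using separable by metis
  define Q where "Q = {t::real. t \<in> \<rat> \<and> t \<noteq> 0 \<and> \<bar>t\<bar> \<le> 1}"
  have Q: "countable Q" unfolding Q_def by (rule countable_subset[OF _ countable_rat]) auto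
  \<comment> \<open>\<open>x \<in> S v r\<close> says that along \<open>v\<close>, at the parameters
    in \<open>Q\<close>, \<open>\<phi>\<close> lies strictly below the line of slope
    \<open>- r\<close> through its value at \<open>x\<close>. Rational parameters keep the
    intersection countable.\<close>
  define S where "S v r = (\<Inter>t\<in>Q. {x. \<phi> (x - t *\<^sub>R v) < \<phi> x + r * t})" for v and r :: real
  have "1 \<in> Q" by (simp add: Q_def)
  have S: "S v r \<in> sets borel" for v r
    unfolding S_def
  proof (rule sets.countable_INT'[OF Q])
    show "(\<lambda>t. {x. \<phi> (x - t *\<^sub>R v) < \<phi> x + r * t}) ` Q \<subseteq> sets borel"
      by (auto intro!: borel_open open_Collect_less continuous_intros continuous_on_compose2[OF \<phi>])
  qed (use \<open>1 \<in> Q\<close> in auto)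
  have S_null: "S v r \<in> null_sets \<kappa>" if v: "v \<in> D" for v r
  proof (rule null_of_disjoint_translates[OF sets fin _ S])
    show "emeasure \<kappa> ((\<lambda>x. x + s *\<^sub>R v) -` A) = emeasure \<kappa> A" if "A \<in> sets borel" for s A
      using v D(2) E that by (intro trans) (auto intro: subspace_mul)
    fix x s assume "x \<in> S v r" and s: "s \<in> \<rat>" "(0::real) < s" "s \<le> 1"
    show "x + s *\<^sub>R v \<notin> S v r"
    proof
      \<comment> \<open>Each of two such points would lie strictly below the line of slope
        \<open>- r\<close> through the other, which is contradictory.\<close>
      assume x': "x + s *\<^sub>R v \<in> S v r"
      have "s \<in> Q" "- s \<in> Q" using s by (auto simp: Q_def)
      with \<open>x \<in> S v r\<close> x' have "\<phi> (x - (- s) *\<^sub>R v) < \<phi> x + r * (- s)"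
        "\<phi> (x + s *\<^sub>R v - s *\<^sub>R v) < \<phi> (x + s *\<^sub>R v) + r * s"
        by (auto simp only: S_def INT_iff mem_Collect_eq)
      then show False by simp
    qed
  qed
  define Z where "Z = (\<Union>(v, r)\<in>D \<times> \<rat>. S v r)"
  have "Z \<in> null_sets \<kappa>" unfolding Z_def
    by (rule null_sets_UN') (auto intro!: D(1) countable_SIGMA countable_rat S_null)
  moreover have "y = z" if x: "x \<in> E - Z" and y: "y \<in> K" and z: "z \<in> K"
    and miny: "H (y - x) - \<psi> y \<le> \<phi> x" and minz: "H (z - x) - \<psi> z \<le> \<phi> x" for x y z
  proof (rule ccontr)
    \<comment> \<open>Wait for both displacements to meet: \<open>a + w\<close> and
      \<open>b - w\<close> are the midpoint of \<open>a\<close> and \<open>b\<close>. Strict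
      midpoint convexity then says that the increment of \<open>H\<close> from \<open>a\<close>
      along \<open>w\<close> is less than its increment along \<open>w\<close> into
      \<open>b\<close>, and \<open>r\<close> separates the two.\<close>
    assume "y \<noteq> z"
    define a b w where "a = y - x" and "b = z - x" and "w = (1/2) *\<^sub>R (z - y)"
    have E': "a \<in> E" "b \<in> E" "w \<in> E" unfolding a_def b_def w_def
      using x y z K(2) E by (auto intro!: subspace_diff subspace_mul)
    have "a + w = (1/2) *\<^sub>R (a + b)" "b - w = (1/2) *\<^sub>R (a + b)"
      by (simp_all add: a_def b_def w_def algebra_simps flip: scaleR_add_left)
    moreover have "H ((1/2) *\<^sub>R (a + b)) < (H a + H b) / 2"
      using \<open>y \<noteq> z\<close> E' by (intro strict) (auto simp: a_def b_def)
    ultimately have "w \<in> {v. H (a + v) - H a < H b - H (b - v)}" by simp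
    moreover have "open {v. H (a + v) - H a < H b - H (b - v)}"
      by (auto intro!: open_Collect_less continuous_intros continuous_on_compose2[OF H(1)])
    moreover have "w \<in> closure D" using E' D(3) by auto
    ultimately obtain v where v: "v \<in> D" "H (a + v) - H a < H b - H (b - v)"
      using closure_iff_nhds_not_empty[of w D] by blast
    obtain r where r: "r \<in> \<rat>" "H (a + v) - H a < r" "r < H b - H (b - v)"
      using Rats_dense_in_real[OF v(2)] by blast
    have "v \<in> E" using v D by auto
    have "\<phi> (x - t *\<^sub>R v) < \<phi> x + r * t" if t: "t \<in> Q" for t
    \<comment> \<open>For \<open>t > 0\<close> the competitor \<open>y\<close> bounds
      \<open>\<phi>\<close> from above, by convexity of \<open>H\<close> between \<open>a\<close>
      and \<open>a + v\<close>; for \<open>t < 0\<close> the competitor \<open>z\<close> does,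
      between \<open>b\<close> and \<open>b - v\<close>.\<close>
    proof (cases "t > 0")
      case True
      then have t1: "0 \<le> t" "t \<le> 1" using t by (auto simp: Q_def)
      have eq: "(1 - t) *\<^sub>R a + t *\<^sub>R (a + v) = y - (x - t *\<^sub>R v)" by (simp add: a_def algebra_simps)
      have "H ((1 - t) *\<^sub>R a + t *\<^sub>R (a + v)) \<le> (1 - t) * H a + t * H (a + v)"
        using E' \<open>v \<in> E\<close> t1 E by (intro convex_onD[OF H(2)]) (auto intro: subspace_add)
      also have "\<dots> = H a + t * (H (a + v) - H a)" by (simp add: algebra_simps)
      also have "\<dots> < H a + t * r" using True r by simp
      finally have "H (y - (x - t *\<^sub>R v)) < H a + t * r" unfolding eq .
      then show ?thesis using \<phi>_le[OF y, of "x - t *\<^sub>R v"] miny by (simp add: a_def mult.commute)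
    next
      case False
      define s where "s = - t"
      have s: "0 < s" "s \<le> 1" using t False by (auto simp: Q_def s_def)
      have eq: "(1 - s) *\<^sub>R b + s *\<^sub>R (b - v) = z - (x - t *\<^sub>R v)" by (simp add: b_def s_def algebra_simps)
      have "H ((1 - s) *\<^sub>R b + s *\<^sub>R (b - v)) \<le> (1 - s) * H b + s * H (b - v)"
        using E' \<open>v \<in> E\<close> s E by (intro convex_onD[OF H(2)]) (auto intro: subspace_diff)
      also have "\<dots> = H b - s * (H b - H (b - v))" by (simp add: algebra_simps)
      also have "\<dots> < H b - s * r" using s r by simp
      finally have "H (z - (x - t *\<^sub>R v)) < H b - s * r" unfolding eq .
      then show ?thesis using \<phi>_le[OF z, of "x - t *\<^sub>R v"] minz by (simp add: b_def s_def mult.commute)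
    qed
    then have "x \<in> S v r" by (simp add: S_def)
    with v r x show False by (auto simp: Z_def)
  qed
  ultimately show ?thesis unfolding \<phi>_def c_def by blast
qed

section \<open>Coordinates on a subspace\<close>

lemma emeasure_lborel_plus:
  fixes a :: "'a::euclidean_space"
  assumes "A \<in> sets borel"
  shows "emeasure lborel ((\<lambda>x. x + a) -` A) = emeasure lborel A"
proof -
  have "emeasure lborel A = emeasure (distr lborel borel ((+) a)) A"
    by (simp add: lborel_distr_plus)
  also have "\<dots> = emeasure lborel ((+) a -` A \<inter> space lborel)"
    using assms by (intro emeasure_distr) auto
  finally show ?thesis by (simp add: vimage_def add.commute)
qed

lemma distr_PiM_lborel_plus:
  fixes a :: "'i \<Rightarrow> 'a::euclidean_space"
  assumes I: "finite I"
  shows "distr (Pi\<^sub>M I (\<lambda>_. lborel)) (Pi\<^sub>M I (\<lambda>_. lborel)) (\<lambda>w. \<lambda>i\<in>I. w i + a i) = Pi\<^sub>M I (\<lambda>_. lborel)"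
    (is "distr ?P ?P ?t = ?P")
proof -
  interpret product_sigma_finite "\<lambda>_::'i. lborel :: 'a measure" ..
  have t: "?t \<in> measurable ?P ?P" by measurable
  show ?thesis
  proof (rule PiM_eqI[OF I])
    fix A :: "'i \<Rightarrow> 'a set" assume A: "\<And>i. i \<in> I \<Longrightarrow> A i \<in> sets lborel"
    define A' where "A' i = (\<lambda>x. x + a i) -` A i" for i
    have A': "A' i \<in> sets lborel" if "i \<in> I" for i
      using measurable_sets_borel[of "\<lambda>x. x + a i" borel "A i"] A[OF that] by (simp add: A'_def)
    have "?t -` Pi\<^sub>E I A \<inter> space ?P = Pi\<^sub>E I A'"
      by (auto simp: space_PiM A'_def PiE_iff)
    then have "emeasure (distr ?P ?P ?t) (Pi\<^sub>E I A) = emeasure ?P (Pi\<^sub>E I A')"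
      using A I by (subst emeasure_distr[OF t]) (auto intro!: sets_PiM_I_finite)
    also have "\<dots> = (\<Prod>i\<in>I. emeasure lborel (A' i))" using A' I by (intro emeasure_PiM) auto
    also have "\<dots> = (\<Prod>i\<in>I. emeasure lborel (A i))"
      using A by (intro prod.cong) (auto simp: A'_def emeasure_lborel_plus)
    finally show "emeasure (distr ?P ?P ?t) (Pi\<^sub>E I A) = (\<Prod>i\<in>I. emeasure lborel (A i))" .
  qed simp
qed

text \<open>The complement of the support is the union of all open null sets; second countability
  reduces it to a countable union.\<close>

lemma AE_measure_supp:
  fixes M :: "'a::second_countable_topology measure"
  assumes sets: "sets M = sets borel"
  shows "closed (measure_supp euclidean M)" "AE x in M. x \<in> measure_supp euclidean M"
proof -
  define F where "F = {U :: 'a set. open U \<and> emeasure M U = 0}"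
  have compl: "- measure_supp euclidean M = \<Union>F"
    by (auto simp: measure_supp_def F_def zero_less_iff_neq_zero)
  then show "closed (measure_supp euclidean M)"
    unfolding closed_def by (auto simp: F_def)
  obtain F' where F': "F' \<subseteq> F" "countable F'" "\<Union>F' = \<Union>F"
    by (rule Lindelof[of F]) (auto simp: F_def)
  have "(\<Union>U\<in>F'. U) \<in> null_sets M"
    using F' sets by (intro null_sets_UN') (auto simp: F_def null_sets_def)
  then have "- measure_supp euclidean M \<in> null_sets M" using compl F' by simp
  from AE_not_in[OF this] show "AE x in M. x \<in> measure_supp euclidean M" by simp
qed

lemma subspace_projection:
  assumes "subspace (E :: 'a::real_vector set)"
  obtains P where "linear P" "range P \<subseteq> E" "\<And>x. x \<in> E \<Longrightarrow> P x = x"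
proof -
  have "linear (id :: 'a \<Rightarrow> 'a)" by (rule linear_id)
  from linear_exists_left_inverse_on[OF this assms] that show ?thesis by auto
qed

section \<open>A subspace in linear coordinates and its Lebesgue measure\<close>

locale linear_chart =
  fixes E :: "'a::euclidean_space set" and p :: nat and R :: "'a \<Rightarrow> nat \<Rightarrow> real"
  assumes subspace_E: "subspace E" and iso_R: "linear_iso_Rp E p R"
begin

lemma R_bij: "bij_betw R E (Rp_carrier p)"
  and R_add: "x \<in> E \<Longrightarrow> y \<in> E \<Longrightarrow> i < p \<Longrightarrow> R (x + y) i = R x i + R y i"
  and R_scale: "x \<in> E \<Longrightarrow> i < p \<Longrightarrow> R (a *\<^sub>R x) i = a * R x i"
  using iso_R by (auto simp: linear_iso_Rp_def)

text \<open>\<open>R\<close> is linear on \<open>E\<close> only. Composing with a linear projection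
  onto \<open>E\<close> extends each coordinate to the whole space, where linear maps are continuous
  and bounded.\<close>

lemma R_extension:
  obtains r where "\<And>i. i < p \<Longrightarrow> linear (r i)" "\<And>i x. i < p \<Longrightarrow> x \<in> E \<Longrightarrow> R x i = r i x"
proof -
  obtain P where P: "linear P" "range P \<subseteq> E" "\<And>x. x \<in> E \<Longrightarrow> P x = x"
    using subspace_projection[OF subspace_E] by blast
  show ?thesis
  proof (rule that)
    fix i assume "i < p"
    show "linear (\<lambda>x. R (P x) i)"
      using P(2) \<open>i < p\<close> by (intro linearI) (auto simp: linear_add[OF P(1)] linear_scale[OF P(1)] R_add R_scale subset_iff)
    show "R x i = R (P x) i" if "x \<in> E" for x using P that by simp
  qed
qed

text \<open>The preimage of the \<open>i\<close>-th standard basis vector. For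
  \<open>i \<ge> p\<close> it is the preimage of 0, so membership in \<open>E\<close> holds for all
  \<open>i\<close>.\<close>

definition unit :: "nat \<Rightarrow> 'a" where
  "unit i = inv_into E R (\<lambda>j\<in>{..<p}. if j = i then 1 else 0)"

text \<open>The inverse chart. Being a finite sum, defined for all functions and depending on
  coordinates below \<open>p\<close> only, it is visibly continuous and measurable, unlike
  \<open>inv_into E R\<close>.\<close>

definition G :: "(nat \<Rightarrow> real) \<Rightarrow> 'a" where
  "G w = (\<Sum>i<p. w i *\<^sub>R unit i)"

lemma unit: "unit i \<in> E" "j < p \<Longrightarrow> R (unit i) j = (if j = i then 1 else 0)"
proof -
  have *: "(\<lambda>j\<in>{..<p}. if j = i then 1 else 0 :: real) \<in> R ` E"
    using R_bij by (simp add: bij_betw_def)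
  show "unit i \<in> E" unfolding unit_def by (rule inv_into_into[OF *])
  show "R (unit i) j = (if j = i then 1 else 0)" if "j < p"
    unfolding unit_def by (subst f_inv_into_f[OF *]) (use that in simp)
qed

lemma G_mem: "G w \<in> E"
  unfolding G_def by (intro subspace_sum subspace_E subspace_mul unit)

lemma R_G: "j < p \<Longrightarrow> R (G w) j = w j"
proof -
  assume j: "j < p"
  obtain r where r: "\<And>i. i < p \<Longrightarrow> linear (r i)" "\<And>i x. i < p \<Longrightarrow> x \<in> E \<Longrightarrow> R x i = r i x"
    using R_extension by blast
  have "R (G w) j = r j (G w)" using r j G_mem by simp
  also have "\<dots> = (\<Sum>i<p. w i * r j (unit i))"
    unfolding G_def linear_sum[OF r(1)[OF j]] linear_scale[OF r(1)[OF j]] by simp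
  also have "\<dots> = (\<Sum>i<p. w i * (if j = i then 1 else 0))"
    unfolding r(2)[OF j unit(1), symmetric] unit(2)[OF j] ..
  also have "\<dots> = (\<Sum>i<p. if i = j then w i else 0)" by (intro sum.cong) auto
  also have "\<dots> = w j" using j by simp
  finally show ?thesis .
qed

lemma R_carrier: "x \<in> E \<Longrightarrow> R x \<in> Rp_carrier p"
  using R_bij by (auto simp: bij_betw_def)

lemma R_G_carrier: "w \<in> Rp_carrier p \<Longrightarrow> R (G w) = w"
proof (rule PiE_ext)
  show "R (G w) \<in> Rp_carrier p" by (rule R_carrier[OF G_mem])
qed (simp_all add: R_G)

lemma G_R:
  assumes "x \<in> E"
  shows "G (R x) = x"
proof (rule inj_onD)
  show "inj_on R E" using R_bij by (simp add: bij_betw_def)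
  show "R (G (R x)) = R x" by (rule R_G_carrier[OF R_carrier[OF assms]])
qed (use assms G_mem in auto)

lemma G_restrict: "G (restrict w {..<p}) = G w"
  by (simp add: G_def)

lemma G_add: "G (\<lambda>i. w i + a i) = G w + G a"
  by (simp add: G_def scaleR_add_left sum.distrib)

lemma continuous_map_G: "continuous_map (Rp_topology p) euclidean G"
  unfolding G_def
proof (rule continuous_map_sum)
  fix i assume i: "i \<in> {..<p}"
  have "continuous_map euclideanreal euclidean (\<lambda>t. t *\<^sub>R unit i)"
    by (simp add: continuous_map_iff_continuous2) (intro continuous_intros)
  from continuous_map_compose[OF continuous_map_product_projection[OF i] this]
  show "continuous_map (Rp_topology p) euclidean (\<lambda>w. w i *\<^sub>R unit i)" by (simp add: o_def)
qed simp

lemma continuous_map_R: "continuous_map (top_of_set E) (Rp_topology p) R"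
proof -
  obtain r where r: "\<And>i. i < p \<Longrightarrow> linear (r i)" "\<And>i x. i < p \<Longrightarrow> x \<in> E \<Longrightarrow> R x i = r i x"
    using R_extension by blast
  have "continuous_on E (\<lambda>x. R x i)" if "i < p" for i
    using linear_continuous_on[OF linear_conv_bounded_linear[THEN iffD1, OF r(1)[OF that]], of E]
    by (rule continuous_on_eq) (use r(2) that in auto)
  then show ?thesis
    using R_carrier by (auto simp: continuous_map_componentwise PiE_iff)
qed

lemma measurable_G: "G \<in> borel_measurable (Rp_lebesgue p)"
  unfolding G_def
  by (intro borel_measurable_sum borel_measurable_scaleR borel_measurable_const)
    (auto intro!: measurable_component_singleton[where M="\<lambda>_. lborel", simplified])

lemma measurable_R:
  assumes "sets M = sets borel"
  shows "R \<in> measurable (restrict_space M E) (Rp_lebesgue p)"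
proof -
  obtain r where r: "\<And>i. i < p \<Longrightarrow> linear (r i)" "\<And>i x. i < p \<Longrightarrow> x \<in> E \<Longrightarrow> R x i = r i x"
    using R_extension by blast
  have space: "space (restrict_space M E) = E"
    using sets_eq_imp_space_eq[OF assms] by (simp add: space_restrict_space)
  have "(\<lambda>x. R x i) \<in> measurable (restrict_space M E) lborel" if "i < p" for i
  proof -
    have "r i \<in> borel_measurable borel"
      using r(1)[OF that] by (intro borel_measurable_continuous_onI linear_continuous_on)
        (simp add: linear_conv_bounded_linear)
    then have "r i \<in> borel_measurable M" using assms by (simp cong: measurable_cong_sets)
    then have "r i \<in> borel_measurable (restrict_space M E)" by (rule measurable_restrict_space1)
    then have "(\<lambda>x. R x i) \<in> borel_measurable (restrict_space M E)"
      by (rule measurable_cong[THEN iffD1, rotated]) (use r that space in auto)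
    then show ?thesis by simp
  qed
  moreover have "R \<in> space (restrict_space M E) \<rightarrow> Rp_carrier p"
    using R_carrier space by auto
  ultimately show ?thesis
    using measurable_PiM_single'[of "{..<p}" "\<lambda>i x. R x i" "restrict_space M E" "\<lambda>_. lborel"] by simp
qed

text \<open>A translation-invariant measure on \<open>E\<close>, carried as a Borel measure on the
  ambient space: Lebesgue measure in the chart. For \<open>p = 0\<close> it is the unit mass at
  0.\<close>

definition vol :: "'a measure" where
  "vol = distr (Rp_lebesgue p) borel G"

lemma sets_vol: "sets vol = sets borel"
  by (simp add: vol_def)

text \<open>In coordinates, translation by \<open>e\<close> is translation by \<open>R e\<close>,
  which preserves the product Lebesgue measure.\<close>

lemma vol_translate:
  assumes e: "e \<in> E" and A: "A \<in> sets borel"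
  shows "emeasure vol ((\<lambda>x. x + e) -` A) = emeasure vol A"
proof -
  let ?P = "Rp_lebesgue p" and ?t = "\<lambda>w. \<lambda>i\<in>{..<p}. w i + R e i"
  have t: "?t \<in> measurable ?P ?P" by measurable
  have Gt: "G (?t w) = G w + e" for w
    unfolding G_restrict G_add using G_R[OF e] by simp
  have A': "(\<lambda>x. x + e) -` A \<in> sets borel"
    using measurable_sets_borel[of "\<lambda>x. x + e" borel A] A by simp
  have GA: "G -` A \<inter> space ?P \<in> sets ?P" using measurable_sets[OF measurable_G A] .
  have "emeasure vol ((\<lambda>x. x + e) -` A) = emeasure ?P (?t -` (G -` A \<inter> space ?P) \<inter> space ?P)"
    unfolding vol_def emeasure_distr[OF measurable_G A']
    by (intro arg_cong[where f="emeasure ?P"]) (auto simp: Gt space_PiM)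
  also have "\<dots> = emeasure (distr ?P ?P ?t) (G -` A \<inter> space ?P)"
    by (rule emeasure_distr[OF t GA, symmetric])
  also have "\<dots> = emeasure vol A"
    unfolding vol_def emeasure_distr[OF measurable_G A] by (subst distr_PiM_lborel_plus) auto
  finally show ?thesis .
qed

text \<open>Linear coordinates are bounded by a multiple of the norm, so a ball pulls back into a
  box of finite volume.\<close>

lemma vol_cball_finite: "emeasure vol (cball 0 b) < \<infinity>"
proof -
  obtain r where r: "\<And>i. i < p \<Longrightarrow> linear (r i)" "\<And>i x. i < p \<Longrightarrow> x \<in> E \<Longrightarrow> R x i = r i x"
    using R_extension by blast
  have "\<exists>B. \<forall>x. norm (r i x) \<le> norm x * B" if "i < p" for i
    using bounded_linear.bounded[of "r i"] r(1)[OF that] by (simp add: linear_conv_bounded_linear)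
  then have "\<forall>i. \<exists>B. i < p \<longrightarrow> (\<forall>x. norm (r i x) \<le> norm x * B)" by blast
  from choice[OF this] obtain B where B: "\<And>i x. i < p \<Longrightarrow> norm (r i x) \<le> norm x * B i" by blast
  let ?I = "\<lambda>i. {- (b * \<bar>B i\<bar>)..b * \<bar>B i\<bar>}"
  have sub: "G -` cball 0 b \<inter> space (Rp_lebesgue p) \<subseteq> Pi\<^sub>E {..<p} ?I"
  proof
    fix w assume w: "w \<in> G -` cball 0 b \<inter> space (Rp_lebesgue p)"
    have "w i \<in> ?I i" if "i < p" for i
    proof -
      have "\<bar>w i\<bar> = norm (r i (G w))" using R_G[OF that, of w] r(2)[OF that G_mem] by simp
      also have "\<dots> \<le> norm (G w) * B i" by (rule B[OF that])
      also have "\<dots> \<le> norm (G w) * \<bar>B i\<bar>" by (intro mult_left_mono) auto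
      also have "\<dots> \<le> b * \<bar>B i\<bar>" using w by (intro mult_right_mono) auto
      finally show ?thesis by auto
    qed
    then show "w \<in> Pi\<^sub>E {..<p} ?I" using w by (auto simp: space_PiM PiE_iff)
  qed
  interpret product_sigma_finite "\<lambda>_::nat. lborel :: real measure" ..
  have "emeasure vol (cball 0 b) = emeasure (Rp_lebesgue p) (G -` cball 0 b \<inter> space (Rp_lebesgue p))"
    unfolding vol_def by (rule emeasure_distr[OF measurable_G]) simp
  also have "\<dots> \<le> emeasure (Rp_lebesgue p) (Pi\<^sub>E {..<p} ?I)"
    by (rule emeasure_mono[OF sub]) (auto intro!: sets_PiM_I_finite)
  also have "\<dots> = (\<Prod>i<p. emeasure lborel (?I i))" by (intro emeasure_PiM) auto
  also have "\<dots> < \<infinity>" by (simp add: emeasure_lborel_Icc_eq prod_ennreal)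
  finally show ?thesis .
qed

lemma E_closed: "closed E"
  using subspace_E by (rule closed_subspace)

text \<open>A \<open>vol\<close>-null set \<open>Z\<close> has a Lebesgue null preimage under
  \<open>G\<close>. Pulling that back along \<open>R\<close> gives \<open>Z \<inter> E\<close>,
  because \<open>G\<close> inverts \<open>R\<close> on \<open>E\<close>.\<close>

lemma null_sets_vol_subset:
  assumes sets: "sets M = sets borel" and AE_E: "AE x in M. x \<in> E"
    and ac: "absolutely_continuous (Rp_lebesgue p) (pushforward_Rp E p R M)"
  shows "null_sets vol \<subseteq> null_sets M"
proof
  fix Z assume Z: "Z \<in> null_sets vol"
  then have Z_sets: "Z \<in> sets borel" by (simp add: null_sets_def sets_vol)
  let ?W = "G -` Z \<inter> space (Rp_lebesgue p)"
  have E_M: "E \<inter> space M \<in> sets M" using E_closed sets sets_eq_imp_space_eq[OF sets] by simp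
  have "emeasure vol Z = emeasure (Rp_lebesgue p) ?W"
    unfolding vol_def by (rule emeasure_distr[OF measurable_G Z_sets])
  then have "?W \<in> null_sets (Rp_lebesgue p)"
    using Z measurable_sets[OF measurable_G Z_sets] by (auto simp: null_sets_def)
  then have "?W \<in> null_sets (pushforward_Rp E p R M)"
    using ac by (auto simp: absolutely_continuous_def)
  then have "0 = emeasure (pushforward_Rp E p R M) ?W" by auto
  also have "\<dots> = emeasure (restrict_space M E) (R -` ?W \<inter> space (restrict_space M E))"
    unfolding pushforward_Rp_def
    by (rule emeasure_distr[OF measurable_R[OF sets]]) (rule measurable_sets[OF measurable_G Z_sets])
  also have "R -` ?W \<inter> space (restrict_space M E) = Z \<inter> E"
    using sets_eq_imp_space_eq[OF sets] R_carrier by (auto simp: space_restrict_space G_R space_PiM)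
  also have "emeasure (restrict_space M E) (Z \<inter> E) = emeasure M (Z \<inter> E)"
    using E_M by (intro emeasure_restrict_space) auto
  also have "\<dots> = emeasure M Z"
    using AE_E Z_sets sets E_closed by (intro emeasure_eq_AE) auto
  finally show "Z \<in> null_sets M" using Z_sets sets by (auto simp: null_sets_def)
qed

text \<open>The support is closed, and it lies in the image of the compact coordinate support under
  the continuous \<open>G\<close>: a neighbourhood of \<open>R x\<close> corresponds to a relatively
  open subset of \<open>E\<close> around \<open>x\<close>, hence has positive mass.\<close>

lemma compact_measure_supp:
  assumes sets: "sets M = sets borel" and supp: "measure_supp euclidean M \<subseteq> E"
    and comp: "compactin (Rp_topology p) (measure_supp (Rp_topology p) (pushforward_Rp E p R M))"
  shows "compact (measure_supp euclidean M)"
proof -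
  let ?C = "measure_supp (Rp_topology p) (pushforward_Rp E p R M)"
  have "x \<in> G ` ?C" if x: "x \<in> measure_supp euclidean M" for x
  proof (rule image_eqI)
    have "x \<in> E" using x supp by auto
    then show "x = G (R x)" by (simp add: G_R)
    have "emeasure (pushforward_Rp E p R M) U > 0" if U: "openin (Rp_topology p) U" "R x \<in> U" for U
    proof -
      have "openin (top_of_set E) {y \<in> E. R y \<in> U}"
        using openin_continuous_map_preimage[OF continuous_map_R U(1)] by simp
      then obtain V where V: "open V" "{y \<in> E. R y \<in> U} = E \<inter> V" by (auto simp: openin_open)
      have EV: "E \<inter> V \<in> sets borel" using E_closed V by auto
      have U_sub: "U \<subseteq> Rp_carrier p" using openin_subset[OF U(1)] by simp
      have "G w \<in> E \<inter> V \<longleftrightarrow> w \<in> U" if "w \<in> Rp_carrier p" for w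
        unfolding V(2)[symmetric] using G_mem R_G_carrier[OF that] by simp
      then have "G -` (E \<inter> V) \<inter> space (Rp_lebesgue p) = U"
        using U_sub by (auto simp: space_PiM)
      then have U_sets: "U \<in> sets (Rp_lebesgue p)" using measurable_sets[OF measurable_G EV] by simp
      have "emeasure (pushforward_Rp E p R M) U
          = emeasure (restrict_space M E) (R -` U \<inter> space (restrict_space M E))"
        unfolding pushforward_Rp_def by (rule emeasure_distr[OF measurable_R[OF sets] U_sets])
      also have "R -` U \<inter> space (restrict_space M E) = E \<inter> V"
        using V(2) sets_eq_imp_space_eq[OF sets] by (auto simp: space_restrict_space)
      also have "emeasure (restrict_space M E) (E \<inter> V) = emeasure M (E \<inter> V)"
        using E_closed sets sets_eq_imp_space_eq[OF sets] by (intro emeasure_restrict_space) auto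
      also have "\<dots> = emeasure M V"
        using AE_measure_supp(2)[OF sets] supp EV V sets by (intro emeasure_eq_AE) auto
      also have "\<dots> > 0"
        using x V U(2) \<open>x \<in> E\<close> by (auto simp: measure_supp_def)
      finally show ?thesis .
    qed
    then show "R x \<in> ?C" using R_carrier[OF \<open>x \<in> E\<close>] by (simp add: measure_supp_def)
  qed
  then have "measure_supp euclidean M \<subseteq> G ` ?C" by blast
  moreover have "compact (G ` ?C)"
    using image_compactin[OF comp continuous_map_G] by simp
  ultimately show ?thesis
    using AE_measure_supp(1)[OF sets] by (metis compact_Int_closed inf.absorb_iff2)
qed

end

section \<open>The cost between equilibria\<close>

locale control_problem =
  fixes A :: "real^'d^'d" and B :: "real^'m^'d"
    and L :: "real^'d \<Rightarrow> real^'m \<Rightarrow> real" and \<theta> lam :: real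
  assumes controllable: "controllable A B"
    and \<theta>: "0 < \<theta>" "\<And>x u. \<theta> * (norm u)\<^sup>2 \<le> L x u"
    and lam: "0 < lam" "\<And>x y u v \<alpha>. 0 < \<alpha> \<Longrightarrow> \<alpha> < 1 \<Longrightarrow>
          L (\<alpha> *\<^sub>R x + (1 - \<alpha>) *\<^sub>R y) (\<alpha> *\<^sub>R u + (1 - \<alpha>) *\<^sub>R v)
            \<le> \<alpha> * L x u + (1 - \<alpha>) * L y v - \<alpha> * (1 - \<alpha>) * lam / 2 * (norm (u - v))\<^sup>2"
    and L_proj: "\<And>x u. L x u = L (orth_proj (orthogonal_comp (equilibria A)) x) u"
begin

abbreviation "cost \<equiv> control_cost A B L"

lemma subspace_equilibria: "subspace (equilibria A)"
  unfolding equilibria_def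
  by (auto simp: subspace_def matrix_vector_right_distrib linear_scale[OF matrix_vector_mul_linear])

lemma L_nonneg: "0 \<le> L x u"
  using \<theta>(2)[of u x] \<theta>(1) by (meson less_imp_le mult_nonneg_nonneg order_trans zero_le_power2)

text \<open>\<open>e\<close> belongs to the double orthogonal complement, so \<open>x\<close> and
  \<open>x + e\<close> satisfy the same defining condition for the projection; the two definite
  descriptions agree.\<close>

lemma L_translate:
  assumes "e \<in> equilibria A"
  shows "L (x + e) u = L x u"
proof -
  have "e \<in> orthogonal_comp (orthogonal_comp (equilibria A))"
    using assms by (auto simp: orthogonal_comp_def orthogonal_commute)
  then have "x + e - z \<in> orthogonal_comp (orthogonal_comp (equilibria A)) \<longleftrightarrow> x - z \<in> orthogonal_comp (orthogonal_comp (equilibria A))" for z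
    using subspace_add[OF subspace_orthogonal_comp, of "x - z" "orthogonal_comp (equilibria A)" e]
      subspace_diff[OF subspace_orthogonal_comp, of "x + e - z" "orthogonal_comp (equilibria A)" e]
    by (auto simp: algebra_simps)
  then have "orth_proj (orthogonal_comp (equilibria A)) (x + e) = orth_proj (orthogonal_comp (equilibria A)) x"
    unfolding orth_proj_def by simp
  then show ?thesis using L_proj[of "x + e"] L_proj[of x] by simp
qed

text \<open>Discarding the quadratic gap leaves joint convexity, which implies continuity in finite
  dimension. It makes the running cost measurable.\<close>

lemma continuous_on_L: "continuous_on UNIV (\<lambda>z. L (fst z) (snd z))"
proof (rule convex_on_continuous)
  show "convex_on UNIV (\<lambda>z. L (fst z) (snd z))"
  proof (rule convex_onI)
    fix t :: real and z w :: "(real^'d) \<times> (real^'m)" assume t: "0 < t" "t < 1"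
    have "0 \<le> t * (1 - t) * lam / 2 * (norm (snd w - snd z))\<^sup>2" using t lam(1) by simp
    with lam(2)[OF t, of "fst w" "fst z" "snd w" "snd z"]
    show "L (fst ((1 - t) *\<^sub>R z + t *\<^sub>R w)) (snd ((1 - t) *\<^sub>R z + t *\<^sub>R w))
      \<le> (1 - t) * L (fst z) (snd z) + t * L (fst w) (snd w)" by (simp add: add.commute)
  qed simp
qed simp

definition action :: "(real \<Rightarrow> real^'d) \<Rightarrow> (real \<Rightarrow> real^'m) \<Rightarrow> ennreal" where
  "action \<gamma> u = (\<integral>\<^sup>+ t. ennreal (L (\<gamma> t) (u t)) \<partial>(lebesgue_on {0..1}))"

lemma cost_le: "admissible A B 1 x y \<gamma> u \<Longrightarrow> cost x y \<le> action \<gamma> u"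
  unfolding control_cost_def action_def by (rule INF_lower2[of "(\<gamma>, u)"]) auto

lemma cost_ge: "(\<And>\<gamma> u. admissible A B 1 x y \<gamma> u \<Longrightarrow> m \<le> action \<gamma> u) \<Longrightarrow> m \<le> cost x y"
  unfolding control_cost_def action_def by (rule INF_greatest) auto

lemma cost_approx:
  assumes "cost x y < c"
  obtains \<gamma> u where "admissible A B 1 x y \<gamma> u" "action \<gamma> u < c"
  using assms unfolding control_cost_def INF_less_iff action_def by auto

lemma admissible_translate:
  assumes adm: "admissible A B 1 x y \<gamma> u" and e: "e \<in> equilibria A"
  shows "admissible A B 1 (x + e) (y + e) (\<lambda>t. \<gamma> t + e) u"
proof -
  have "A *v (\<gamma> t + e) = A *v \<gamma> t" for t
    using e by (simp add: equilibria_def matrix_vector_right_distrib)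
  moreover have "((\<lambda>t. \<gamma> t + e) has_vector_derivative D) F \<longleftrightarrow> (\<gamma> has_vector_derivative D) F" for D F
    using has_vector_derivative_add[of \<gamma> D F "\<lambda>_. e" 0]
      has_vector_derivative_add[of "\<lambda>t. \<gamma> t + e" D F "\<lambda>_. - e" 0] by auto
  ultimately show ?thesis
    using adm by (simp add: admissible_def abs_continuous_curve_def)
qed

lemma cost_translate:
  assumes "e \<in> equilibria A"
  shows "cost (x + e) (y + e) = cost x y"
proof -
  have le: "cost (x + e) (y + e) \<le> cost x y" if "e \<in> equilibria A" for x y e
  proof (rule cost_ge)
    fix \<gamma> u assume "admissible A B 1 x y \<gamma> u"
    then have "cost (x + e) (y + e) \<le> action (\<lambda>t. \<gamma> t + e) u"
      using that by (intro cost_le admissible_translate)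
    then show "cost (x + e) (y + e) \<le> action \<gamma> u" by (simp add: action_def L_translate[OF that])
  qed
  have "- e \<in> equilibria A" using assms by (rule subspace_neg[OF subspace_equilibria])
  from le[OF this, of "x + e" "y + e"] le[OF assms, of x y] show ?thesis by simp
qed

text \<open>Translation by the equilibrium \<open>y\<close> makes 0 the target. Steering to 0 uses a
  continuous control, so the running cost is bounded on the unit interval.\<close>

lemma cost_finite:
  assumes "y \<in> equilibria A"
  shows "cost x y < \<infinity>"
proof -
  obtain \<gamma> u where deriv: "\<And>t. (\<gamma> has_vector_derivative (A *v \<gamma> t + B *v u t)) (at t)"
    and u: "continuous_on UNIV u" and ends: "\<gamma> 0 = x - y" "\<gamma> 1 = 0"
    by (rule steer_to_zero[OF controllable]) blast
  have \<gamma>: "continuous_on S \<gamma>" for S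
    by (rule continuous_on_vector_derivative[OF has_vector_derivative_at_within[OF deriv]])
  have u': "continuous_on S u" for S using u continuous_on_subset by blast
  have "continuous_on {0..1::real} (\<lambda>t. L (\<gamma> t) (u t))"
    using continuous_on_compose2[OF continuous_on_L continuous_on_Pair[OF \<gamma> u'], of "{0..1}"] by simp
  then have "bounded ((\<lambda>t. L (\<gamma> t) (u t)) ` {0..1})"
    by (intro compact_imp_bounded compact_continuous_image) auto
  then obtain M where "\<forall>l\<in>(\<lambda>t. L (\<gamma> t) (u t)) ` {0..1}. norm l \<le> M" unfolding bounded_iff by blast
  then have M: "L (\<gamma> t) (u t) \<le> M" if "t \<in> {0..1}" for t
    using that L_nonneg by (auto simp: abs_of_nonneg)
  have "cost x y = cost (x - y) 0" using cost_translate[OF assms, of "x - y" 0] by simp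
  also have "\<dots> \<le> action \<gamma> u"
    using admissible_C1[OF deriv u, of 1] ends by (intro cost_le) simp
  also have "\<dots> \<le> (\<integral>\<^sup>+ t. ennreal M \<partial>(lebesgue_on {0..1::real}))"
    unfolding action_def using M by (intro nn_integral_mono ennreal_leI) simp
  also have "\<dots> < \<infinity>"
    by (simp add: emeasure_restrict_space ennreal_mult_less_top)
  finally show ?thesis .
qed

lemma action_measurable:
  assumes "admissible A B 1 x y \<gamma> u"
  shows "(\<lambda>t. L (\<gamma> t) (u t)) \<in> borel_measurable (lebesgue_on {0..1})"
proof (rule borel_measurable_continuous_Pair[OF _ _ continuous_on_L])
  have "abs_continuous_curve 0 1 \<gamma>" using assms by (simp add: admissible_def)
  then show "\<gamma> \<in> borel_measurable (lebesgue_on {0..1})"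
    by (intro continuous_imp_measurable_on_sets_lebesgue abs_continuous_curve_continuous_on) auto
  show "u \<in> borel_measurable (lebesgue_on {0..1})"
    using assms by (simp add: admissible_def square_integrable_def)
qed

text \<open>Averaging two admissible pairs gains a multiple of the squared distance of the controls.
  Their difference steers 0 to \<open>z - w\<close>, so the endpoint bound turns this gain into a
  multiple of \<open>(norm (z - w))\<^sup>2\<close>.\<close>

lemma cost_strongly_convex:
  obtains \<kappa> where "0 < \<kappa>" "\<And>z w \<alpha>. z \<in> equilibria A \<Longrightarrow> w \<in> equilibria A \<Longrightarrow> 0 < \<alpha> \<Longrightarrow> \<alpha> < 1 \<Longrightarrow>
    enn2real (cost 0 (\<alpha> *\<^sub>R z + (1 - \<alpha>) *\<^sub>R w)) + \<alpha> * (1 - \<alpha>) * \<kappa> * (norm (z - w))\<^sup>2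
      \<le> \<alpha> * enn2real (cost 0 z) + (1 - \<alpha>) * enn2real (cost 0 w)"
proof -
  obtain C where C: "0 < C" "\<And>z \<gamma> u. admissible A B 1 0 z \<gamma> u \<Longrightarrow>
    (norm z)\<^sup>2 \<le> C * (\<integral>t. (norm (u t))\<^sup>2 \<partial>lebesgue_on {0..1})"
    using endpoint_bound[of A B] by blast
  \<comment> \<open>\<open>lam / 2\<close> is the gain in the convexity of \<open>L\<close>, and
    \<open>1 / C\<close> is the loss in the endpoint bound.\<close>
  define \<kappa> where "\<kappa> = lam / (2 * C)"
  have \<kappa>: "0 < \<kappa>" using C(1) lam(1) by (simp add: \<kappa>_def)
  show ?thesis
  proof (rule that[OF \<kappa>])
    fix z w \<alpha> assume zw: "z \<in> equilibria A" "w \<in> equilibria A" and \<alpha>: "0 < \<alpha>" "\<alpha> < (1::real)"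
    let ?m = "\<alpha> *\<^sub>R z + (1 - \<alpha>) *\<^sub>R w" and ?M = "lebesgue_on {0..1::real}"
    define hz hw hm where "hz = enn2real (cost 0 z)" and "hw = enn2real (cost 0 w)" and "hm = enn2real (cost 0 ?m)"
    have "?m \<in> equilibria A" using zw by (intro subspace_add subspace_mul subspace_equilibria)
    then have h: "cost 0 z = ennreal hz" "cost 0 w = ennreal hw" "cost 0 ?m = ennreal hm"
      and h0: "0 \<le> hz" "0 \<le> hw" "0 \<le> hm"
      using cost_finite zw by (auto simp: hz_def hw_def hm_def less_top)
    \<comment> \<open>Pairs within \<open>\<epsilon>\<close> of the infimum replace minimisers of
      the control problem, whose existence is not at issue here.\<close>
    have "hm + \<alpha> * (1 - \<alpha>) * \<kappa> * (norm (z - w))\<^sup>2 \<le> \<alpha> * hz + (1 - \<alpha>) * hw + \<epsilon>" if \<epsilon>: "0 < \<epsilon>" for \<epsilon>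
    proof -
      have "cost 0 z < ennreal (hz + \<epsilon>)" "cost 0 w < ennreal (hw + \<epsilon>)"
        using h h0 \<epsilon> by (auto intro!: ennreal_lessI)
      then obtain \<gamma> u \<eta> v where adm: "admissible A B 1 0 z \<gamma> u" "admissible A B 1 0 w \<eta> v"
        and act: "action \<gamma> u < ennreal (hz + \<epsilon>)" "action \<eta> v < ennreal (hw + \<epsilon>)"
        by (meson cost_approx)
      let ?\<gamma> = "\<lambda>t. \<alpha> *\<^sub>R \<gamma> t + (1 - \<alpha>) *\<^sub>R \<eta> t" and ?u = "\<lambda>t. \<alpha> *\<^sub>R u t + (1 - \<alpha>) *\<^sub>R v t"
      have admm: "admissible A B 1 0 ?m ?\<gamma> ?u"
        using admissible_lincomb[OF adm, of \<alpha> "1 - \<alpha>"] by simp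
      have "admissible A B 1 0 (z - w) (\<lambda>t. \<gamma> t - \<eta> t) (\<lambda>t. u t - v t)"
        using admissible_lincomb[OF adm, of 1 "- 1"] by simp
      note diff = C(2)[OF this]
      have sq: "square_integrable 0 1 (\<lambda>t. u t - v t)"
        using \<open>admissible A B 1 0 (z - w) (\<lambda>t. \<gamma> t - \<eta> t) (\<lambda>t. u t - v t)\<close> by (simp add: admissible_def)
      note [measurable] = action_measurable[OF adm(1)] action_measurable[OF adm(2)] action_measurable[OF admm]
      let ?k = "\<alpha> * (1 - \<alpha>) * lam / 2"
      have k: "0 \<le> ?k" using \<alpha> lam(1) by simp
      let ?n = "\<lambda>t. (norm (u t - v t))\<^sup>2"
      have int_n: "integrable ?M ?n" using sq by (simp add: square_integrable_def)
      then have [measurable]: "?n \<in> borel_measurable ?M" by simp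
      have "\<alpha> * (1 - \<alpha>) * \<kappa> * (norm (z - w))\<^sup>2 \<le> \<alpha> * (1 - \<alpha>) * \<kappa> * (C * (\<integral>t. ?n t \<partial>?M))"
        using \<alpha> \<kappa> diff by (intro mult_left_mono) auto
      also have "\<dots> = ?k * (\<integral>t. ?n t \<partial>?M)" using C(1) by (simp add: \<kappa>_def)
      finally have gap: "\<alpha> * (1 - \<alpha>) * \<kappa> * (norm (z - w))\<^sup>2 \<le> (\<integral>t. ?k * ?n t \<partial>?M)" by simp
      \<comment> \<open>The gain is added on the side of the averaged pair instead of being
        subtracted from the other, so every integrand stays nonnegative.\<close>
      have "ennreal (hm + \<alpha> * (1 - \<alpha>) * \<kappa> * (norm (z - w))\<^sup>2)
        = ennreal hm + ennreal (\<alpha> * (1 - \<alpha>) * \<kappa> * (norm (z - w))\<^sup>2)"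
        using h0 \<alpha> \<kappa> by (intro ennreal_plus) auto
      also have "\<dots> \<le> action ?\<gamma> ?u + ennreal (\<integral>t. ?k * ?n t \<partial>?M)"
        using cost_le[OF admm] h(3) gap by (intro add_mono ennreal_leI) auto
      also have "ennreal (\<integral>t. ?k * ?n t \<partial>?M) = (\<integral>\<^sup>+t. ennreal (?k * ?n t) \<partial>?M)"
        using int_n k by (intro nn_integral_eq_integral[symmetric]) auto
      also have "action ?\<gamma> ?u + (\<integral>\<^sup>+t. ennreal (?k * ?n t) \<partial>?M)
        = (\<integral>\<^sup>+t. ennreal (L (?\<gamma> t) (?u t)) + ennreal (?k * ?n t) \<partial>?M)"
        unfolding action_def by (rule nn_integral_add[symmetric]) measurable
      also have "\<dots> \<le> (\<integral>\<^sup>+t. ennreal \<alpha> * ennreal (L (\<gamma> t) (u t)) + ennreal (1 - \<alpha>) * ennreal (L (\<eta> t) (v t)) \<partial>?M)"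
      proof (rule nn_integral_mono)
        fix t
        have "L (?\<gamma> t) (?u t) + ?k * ?n t \<le> \<alpha> * L (\<gamma> t) (u t) + (1 - \<alpha>) * L (\<eta> t) (v t)"
          using lam(2)[OF \<alpha>, of "\<gamma> t" "\<eta> t" "u t" "v t"] by simp
        then show "ennreal (L (?\<gamma> t) (?u t)) + ennreal (?k * ?n t)
          \<le> ennreal \<alpha> * ennreal (L (\<gamma> t) (u t)) + ennreal (1 - \<alpha>) * ennreal (L (\<eta> t) (v t))"
          using \<alpha> k L_nonneg by (simp flip: ennreal_plus ennreal_mult' add: ennreal_leI)
      qed
      also have "\<dots> = ennreal \<alpha> * action \<gamma> u + ennreal (1 - \<alpha>) * action \<eta> v"
        unfolding action_def by (simp add: nn_integral_add nn_integral_cmult)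
      also have "\<dots> \<le> ennreal \<alpha> * ennreal (hz + \<epsilon>) + ennreal (1 - \<alpha>) * ennreal (hw + \<epsilon>)"
        using act by (intro add_mono mult_left_mono) auto
      also have "\<dots> = ennreal (\<alpha> * hz + (1 - \<alpha>) * hw + \<epsilon>)"
      proof -
        have "\<alpha> * (hz + \<epsilon>) + (1 - \<alpha>) * (hw + \<epsilon>) = \<alpha> * hz + (1 - \<alpha>) * hw + \<epsilon>" by (simp add: algebra_simps)
        then show ?thesis
          using \<alpha> \<epsilon> h0 by (metis add_nonneg_nonneg diff_ge_0_iff_ge ennreal_mult ennreal_plus less_imp_le mult_nonneg_nonneg)
      qed
      finally show ?thesis
        using h0 \<alpha> \<epsilon> by (subst (asm) ennreal_le_iff) auto
    qed
    then have "hm + \<alpha> * (1 - \<alpha>) * \<kappa> * (norm (z - w))\<^sup>2 \<le> \<alpha> * hz + (1 - \<alpha>) * hw"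
      by (rule field_le_epsilon)
    then show "enn2real (cost 0 ?m) + \<alpha> * (1 - \<alpha>) * \<kappa> * (norm (z - w))\<^sup>2
      \<le> \<alpha> * enn2real (cost 0 z) + (1 - \<alpha>) * enn2real (cost 0 w)"
      by (simp add: hz_def hw_def hm_def)
  qed
qed

text \<open>The cost from 0 is known to be finite on the equilibria. Composing with a linear
  projection onto them gives a finite convex function on the whole space, so continuity follows from
  convexity. Strictness is claimed on the equilibria, since the profile is constant along the kernel
  of the projection.\<close>

lemma cost_profile:
  "\<exists>H. continuous_on UNIV H \<and> convex_on (equilibria A) H \<and>
    (\<forall>x\<in>equilibria A. \<forall>y\<in>equilibria A. x \<noteq> y \<longrightarrow> H ((1/2) *\<^sub>R (x + y)) < (H x + H y) / 2) \<and>
    (\<forall>x\<in>equilibria A. \<forall>y\<in>equilibria A. cost x y = ennreal (H (y - x))) \<and> (\<forall>x. 0 \<le> H x)"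
proof -
  obtain P where P: "linear P" "range P \<subseteq> equilibria A" "\<And>x. x \<in> equilibria A \<Longrightarrow> P x = x"
    using subspace_projection[OF subspace_equilibria] by blast
  define h where "h z = enn2real (cost 0 z)" for z
  obtain \<kappa> where \<kappa>: "0 < \<kappa>" "\<And>z w \<alpha>. z \<in> equilibria A \<Longrightarrow> w \<in> equilibria A \<Longrightarrow> 0 < \<alpha> \<Longrightarrow> \<alpha> < 1 \<Longrightarrow>
    h (\<alpha> *\<^sub>R z + (1 - \<alpha>) *\<^sub>R w) + \<alpha> * (1 - \<alpha>) * \<kappa> * (norm (z - w))\<^sup>2 \<le> \<alpha> * h z + (1 - \<alpha>) * h w"
    unfolding h_def using cost_strongly_convex by blast
  define H where "H = (\<lambda>z. h (P z))"
  have convex: "convex_on UNIV H"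
  proof (rule convex_onI)
    fix t :: real and z w assume t: "0 < t" "t < 1"
    have "0 \<le> t * (1 - t) * \<kappa> * (norm (P w - P z))\<^sup>2" using t \<kappa>(1) by simp
    with \<kappa>(2)[of "P w" "P z" t] t P(2)
    show "H ((1 - t) *\<^sub>R z + t *\<^sub>R w) \<le> (1 - t) * H z + t * H w"
      by (simp add: H_def linear_add[OF P(1)] linear_scale[OF P(1)] add.commute range_subsetD)
  qed simp
  show ?thesis
  proof (intro exI[of _ H] conjI ballI allI impI)
    show "continuous_on UNIV H" using convex by (intro convex_on_continuous) auto
    show "convex_on (equilibria A) H" by (rule convex_on_subset[OF convex _ subspace_imp_convex[OF subspace_equilibria]]) simp
    show "H ((1/2) *\<^sub>R (x + y)) < (H x + H y) / 2" if "x \<in> equilibria A" "y \<in> equilibria A" "x \<noteq> y" for x y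
    proof -
      have "(1/2) *\<^sub>R (x + y) \<in> equilibria A" using that by (intro subspace_mul subspace_add subspace_equilibria)
      moreover have "0 < 1/2 * (1 - 1/2) * \<kappa> * (norm (x - y))\<^sup>2" using \<kappa>(1) that by simp
      ultimately show ?thesis
        using \<kappa>(2)[of x y "1/2"] that P(3) by (simp add: H_def scaleR_add_right)
    qed
    show "cost x y = ennreal (H (y - x))" if "x \<in> equilibria A" "y \<in> equilibria A" for x y
    proof -
      have yx: "y - x \<in> equilibria A" using that by (intro subspace_diff subspace_equilibria)
      have "cost x y = cost 0 (y - x)" using cost_translate[OF that(1), of 0 "y - x"] by simp
      also have "\<dots> = ennreal (h (y - x))" using cost_finite[OF yx] by (simp add: h_def less_top)
      finally show ?thesis using P(3)[OF yx] by (simp add: H_def)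
    qed
    show "0 \<le> H x" for x by (simp add: H_def h_def)
  qed
qed

end

section \<open>The Monge problem on the equilibria\<close>

theorem theorem3p5:
  fixes A :: "real^'d^'d" and B :: "real^'m^'d"
    and L :: "real^'d \<Rightarrow> real^'m \<Rightarrow> real"
    and E :: "(real^'d) set" and p :: nat
    and R :: "real^'d \<Rightarrow> nat \<Rightarrow> real"
    and \<mu> \<nu> :: "(real^'d) measure"
  assumes "controllable A B"
    and E_def: "E = equilibria A"
    and p_def: "p = dim E"
    and L_lower: "\<exists>\<theta>>0. \<forall>\<gamma> u. L \<gamma> u \<ge> \<theta> * (norm u)\<^sup>2"
    and L_convex: "\<exists>lam>0. \<forall>\<gamma> \<eta> u v. \<forall>\<alpha>\<in>{0<..<1}.
          L (\<alpha> *\<^sub>R \<gamma> + (1 - \<alpha>) *\<^sub>R \<eta>) (\<alpha> *\<^sub>R u + (1 - \<alpha>) *\<^sub>R v)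
            \<le> \<alpha> * L \<gamma> u + (1 - \<alpha>) * L \<eta> v - \<alpha> * (1 - \<alpha>) * lam / 2 * (norm (u - v))\<^sup>2"
    and L_proj: "\<forall>\<gamma> u. L \<gamma> u = L (orth_proj (orthogonal_comp E) \<gamma>) u"
    and R_iso: "linear_iso_Rp E p R"
    and "\<mu> \<in> P2_eq A" and "\<nu> \<in> P2_eq A"
    and "absolutely_continuous (Rp_lebesgue p) (pushforward_Rp E p R \<mu>)"
    and "absolutely_continuous (Rp_lebesgue p) (pushforward_Rp E p R \<nu>)"
    and "compactin (Rp_topology p) (measure_supp (Rp_topology p) (pushforward_Rp E p R \<mu>))"
    and "compactin (Rp_topology p) (measure_supp (Rp_topology p) (pushforward_Rp E p R \<nu>))"
  shows "(\<exists>T. monge_solution (control_cost A B L) \<mu> \<nu> T) \<and>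
         (\<forall>T S. monge_solution (control_cost A B L) \<mu> \<nu> T \<and> monge_solution (control_cost A B L) \<mu> \<nu> S
            \<longrightarrow> (AE x in \<mu>. T x = S x))"
proof -
  obtain \<theta> where \<theta>: "0 < \<theta>" "\<And>\<gamma> u. \<theta> * (norm u)\<^sup>2 \<le> L \<gamma> u" using L_lower by blast
  obtain lam where lam: "0 < lam" "\<And>\<gamma> \<eta> u v \<alpha>. \<alpha> \<in> {0<..<1} \<Longrightarrow>
          L (\<alpha> *\<^sub>R \<gamma> + (1 - \<alpha>) *\<^sub>R \<eta>) (\<alpha> *\<^sub>R u + (1 - \<alpha>) *\<^sub>R v)
            \<le> \<alpha> * L \<gamma> u + (1 - \<alpha>) * L \<eta> v - \<alpha> * (1 - \<alpha>) * lam / 2 * (norm (u - v))\<^sup>2"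
    using L_convex by blast
  interpret control_problem A B L \<theta> lam
    using \<open>controllable A B\<close> \<theta> lam L_proj E_def by unfold_locales auto
  interpret linear_chart E p R
    using subspace_equilibria R_iso by unfold_locales (simp_all add: E_def)
  define X K where "X = measure_supp euclidean \<mu>" and "K = measure_supp euclidean \<nu>"
  have \<mu>: "sets \<mu> = sets borel" "prob_space \<mu>" "X \<subseteq> E" and \<nu>: "sets \<nu> = sets borel" "prob_space \<nu>" "K \<subseteq> E"
    using \<open>\<mu> \<in> P2_eq A\<close> \<open>\<nu> \<in> P2_eq A\<close> by (auto simp: P2_eq_def P2_def X_def K_def E_def)
  have X: "compact X" "AE x in \<mu>. x \<in> X"
    using assms compact_measure_supp[OF \<mu>(1)] AE_measure_supp(2)[OF \<mu>(1)] \<mu>(3) by (auto simp: X_def)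
  have K: "compact K" "AE y in \<nu>. y \<in> K"
    using assms compact_measure_supp[OF \<nu>(1)] AE_measure_supp(2)[OF \<nu>(1)] \<nu>(3) by (auto simp: K_def)
  obtain H where H: "continuous_on UNIV H" "convex_on E H"
    "\<forall>x\<in>E. \<forall>y\<in>E. x \<noteq> y \<longrightarrow> H ((1/2) *\<^sub>R (x + y)) < (H x + H y) / 2"
    and cost: "\<forall>x\<in>E. \<forall>y\<in>E. control_cost A B L x y = ennreal (H (y - x))"
    and H0: "\<forall>x. 0 \<le> H x"
    using cost_profile[folded E_def] by (elim exE conjE)
  define c where "c = (\<lambda>x y. H (y - x))"
  have "continuous_on UNIV (\<lambda>(x, y). c x y)"
    unfolding c_def case_prod_unfold
    by (rule continuous_on_compose2[OF H(1)]) (auto intro!: continuous_intros)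
  then interpret dual_transport c X K \<mu> \<nu>
    by (rule dual_transport.intro[OF _ X(1) K(1) \<mu>(2) \<nu>(2) \<mu>(1) \<nu>(1) X(2) K(2)])
  obtain \<psi> where \<psi>: "continuous_on UNIV \<psi>"
    and \<psi>_opt: "\<forall>\<phi>' \<psi>'. feasible \<phi>' \<psi>' \<longrightarrow> dual_value \<phi>' \<psi>' \<le> dual_value (ctrans c K \<psi>) \<psi>"
    using dual_attained by (elim exE conjE)
  have \<psi>K: "continuous_on K \<psi>" using \<psi> continuous_on_subset by blast
  have "\<exists>Z\<in>null_sets vol. \<forall>x\<in>E - Z. \<forall>y\<in>K. \<forall>z\<in>K.
    H (y - x) - \<psi> y \<le> ctrans c K \<psi> x \<longrightarrow> H (z - x) - \<psi> z \<le> ctrans c K \<psi> x \<longrightarrow> y = z"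
    unfolding c_def
  proof (rule unique_minimizer_off_null_set[OF subspace_E sets_vol vol_cball_finite _ H(1,2) _ compact_K \<nu>(3) \<psi>K])
    show "H ((1/2) *\<^sub>R (x + y)) < (H x + H y) / 2" if "x \<in> E" "y \<in> E" "x \<noteq> y" for x y
      using H(3) that by blast
  qed (rule vol_translate)
  then obtain Z where Z: "Z \<in> null_sets vol" "\<forall>x\<in>E - Z. \<forall>y\<in>K. \<forall>z\<in>K.
    H (y - x) - \<psi> y \<le> ctrans c K \<psi> x \<longrightarrow> H (z - x) - \<psi> z \<le> ctrans c K \<psi> x \<longrightarrow> y = z"
    by (elim bexE)
  have AE_E: "AE x in \<mu>. x \<in> E" using AE_X \<mu>(3) by auto
  \<comment> \<open>Absolute continuity of the coordinate image of \<open>\<mu>\<close> turns almost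
    everywhere on \<open>E\<close> into \<open>\<mu>\<close>-almost everywhere.\<close>
  have "Z \<in> null_sets \<mu>"
    using null_sets_vol_subset[OF \<mu>(1) AE_E] Z(1) assms(10) by blast
  from AE_not_in[OF this] AE_E
  have uniq: "AE x in \<mu>. \<forall>y\<in>K. \<forall>z\<in>K. c x y - \<psi> y \<le> ctrans c K \<psi> x \<longrightarrow>
      c x z - \<psi> z \<le> ctrans c K \<psi> x \<longrightarrow> y = z"
  proof eventually_elim
    case (elim x)
    with Z(2) show ?case by (auto simp: c_def)
  qed
  have cost': "control_cost A B L x y = ennreal (c x y)" and nonneg: "0 \<le> c x y" if "x \<in> X" "y \<in> K" for x y
    using that \<mu>(3) \<nu>(3) cost H0 by (auto simp: c_def subset_iff)
  show ?thesis
    using monge_of_unique_minimizer[OF cost' nonneg \<psi> \<psi>_opt[rule_format] uniq] by blast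
qed

end
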